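(* Let $\Gamma$ be a compact metric graph and let $(p,\alpha)\in[1,\infty)\times(0,1)$. (i) If $\alpha<1/p$, then $W^{\alpha,p}(\Gamma)$ embeds compactly into $\mathbb{L}_k(\Gamma)$ for every $1\le k<p/(1-\alpha p)$. (ii) If $\alpha=1/p$, then $W^{\alpha,p}(\Gamma)$ embeds compactly into $\mathbb{L}_k(\Gamma)$ for every $1\le k<\infty$. (iii) If $\alpha>1/p$, then $W^{\alpha,p}(\Gamma)$ embeds compactly into $C^{(0),\lambda}(\Gamma)$ for every $0\le\lambda<\alpha-1/p$.
   Context: $\Gamma$ is a compact metric graph: it is obtained from a finite connected graph (loops and multiple edges allowed) by identifying every edge $e\in\mathcal{E}$ with an interval $[0,l_e]$, $0<l_e<\infty$, and gluing together the interval endpoints that correspond to the same vertex. $d$ is the geodesic (shortest-path) distance on $\Gamma$. Functions on an edge $e$ are identified with functions on $[0,l_e]$; $\mathbb{L}_k(\Gamma)=\bigoplus_{e}\mathbb{L}_k(e)$ with Lebesgue measure on each edge. For $p\in[1,\infty)$ and $\alpha\in(0,1)$, $W^{\alpha,p}(\Gamma)$ is the space of $\varphi\in\mathbb{L}_p(\Gamma)$ with $|\varphi|_{\alpha,p}^p=\int_\Gamma\int_\Gamma\frac{|\varphi(x)-\varphi(y)|^p}{d(x,y)^{1+\alpha p}}dx\,dy<\infty$, with norm $\|\varphi\|_{W^{\alpha,p}(\Gamma)}^p=\sum_{e}\big(\|\varphi\|_{\mathbb{L}_p(e)}^p+|\varphi|_{\alpha,p,e}^p\big)+|\varphi|_{\alpha,p}^p$,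 where $|\varphi|_{\alpha,p,e}^p=\int_0^{l_e}\int_0^{l_e}\frac{|\varphi(x)-\varphi(y)|^p}{|x-y|^{1+\alpha p}}dx\,dy$. $C^{(0),0}(\Gamma)=C(\Gamma)$ with the supremum norm, and for $\lambda\in(0,1]$, $C^{(0),\lambda}(\Gamma)$ is the space of $\lambda$-Hölder continuous functions on $(\Gamma,d)$ with the usual Hölder norm. $X$ embeds compactly into $Y$ if $X\subset Y$ (up to a.e. equality) and the inclusion map is a compact linear operator. *)

theory Defs
  imports "Graph_Theory.Digraph_Component" "HOL-Analysis.Analysis"
begin

section \<open>Compact metric graphs\<close>

text \<open>
  The underlying finite connected multigraph is a finite multi-digraph that is connected as an
  undirected graph. The direction of an arc \<open>e\<close> only records which of its end vertices corresponds
  to \<open>0\<close> (the tail) and which to \<open>l e\<close> (the head) in the identification of \<open>e\<close> with \<open>{0..l e}\<close>.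
\<close>

locale compact_metric_graph = fin_digraph G
  for G :: "('v, 'e) pre_digraph" +
  fixes l :: "'e \<Rightarrow> real"
  assumes connected_graph: "Digraph_Component.connected G"
    and length_pos: "e \<in> arcs G \<Longrightarrow> 0 < l e"

text \<open>
  The glued space is modelled by canonical representatives: one point for each vertex and one for
  each interior point of an edge. The map \<open>edge_pt G l e\<close> on \<open>{0..l e}\<close> is the canonical map of the
  edge \<open>e\<close> into the glued space; lemmas \<open>edge_pt_eq_iff\<close> and \<open>mg_space_eq\<close> below show
  that it glues exactly the interval endpoints belonging to the same vertex.
\<close>

datatype ('v, 'e) mg_point = Vertex 'v | Interior 'e real

definition edge_pt :: "('v, 'e) pre_digraph \<Rightarrow> ('e \<Rightarrow> real) \<Rightarrow> 'e \<Rightarrow> real \<Rightarrow> ('v, 'e) mg_point" where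
  "edge_pt G l e t =
     (if t = 0 then Vertex (tail G e) else if t = l e then Vertex (head G e) else Interior e t)"

definition mg_space :: "('v, 'e) pre_digraph \<Rightarrow> ('e \<Rightarrow> real) \<Rightarrow> ('v, 'e) mg_point set" where
  "mg_space G l = Vertex ` verts G \<union> {Interior e t | e t. e \<in> arcs G \<and> 0 < t \<and> t < l e}"

text \<open>
  A path is a finite chain of segments; the triple \<open>(e, s, t)\<close> stands for the part of the
  edge \<open>e\<close> that is traversed from parameter \<open>s\<close> to parameter \<open>t\<close>.
\<close>

fun mg_path :: "('v, 'e) pre_digraph \<Rightarrow> ('e \<Rightarrow> real) \<Rightarrow>
    ('v, 'e) mg_point \<Rightarrow> ('e \<times> real \<times> real) list \<Rightarrow> ('v, 'e) mg_point \<Rightarrow> bool" where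
  "mg_path G l x [] y \<longleftrightarrow> x = y"
| "mg_path G l x ((e, s, t) # ps) y \<longleftrightarrow>
     e \<in> arcs G \<and> s \<in> {0..l e} \<and> t \<in> {0..l e} \<and> x = edge_pt G l e s \<and>
     mg_path G l (edge_pt G l e t) ps y"

definition path_len :: "('e \<times> real \<times> real) list \<Rightarrow> real" where
  "path_len ps = (\<Sum>(e, s, t)\<leftarrow>ps. \<bar>t - s\<bar>)"

text \<open>The value \<open>0\<close> outside the space is immaterial; \<open>Metric_space\<close> asks for a function that is
  nonnegative and symmetric on the whole type.\<close>

definition mg_dist :: "('v, 'e) pre_digraph \<Rightarrow> ('e \<Rightarrow> real) \<Rightarrow>
    ('v, 'e) mg_point \<Rightarrow> ('v, 'e) mg_point \<Rightarrow> real" where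
  "mg_dist G l x y =
     (if x \<in> mg_space G l \<and> y \<in> mg_space G l then Inf {path_len ps | ps. mg_path G l x ps y} else 0)"


section \<open>Function spaces\<close>

text \<open>
  A function space is given by a set of functions together with a seminorm. Functions are
  represented pointwise, so elements at seminorm distance \<open>0\<close> (a.e. equal functions, or functions
  that differ only outside the graph) stand for the same vector of the normed space.
\<close>

type_synonym 'a fun_space = "('a \<Rightarrow> real) set \<times> (('a \<Rightarrow> real) \<Rightarrow> real)"

definition mg_nn_integral ::
    "('v, 'e) pre_digraph \<Rightarrow> ('e \<Rightarrow> real) \<Rightarrow> (('v, 'e) mg_point \<Rightarrow> ennreal) \<Rightarrow> ennreal" where
  "mg_nn_integral G l F =
     (\<Sum>e\<in>arcs G. \<integral>\<^sup>+ t. F (edge_pt G l e t) \<partial>lebesgue_on {0..l e})"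

definition mg_ae_eq :: "('v, 'e) pre_digraph \<Rightarrow> ('e \<Rightarrow> real) \<Rightarrow>
    (('v, 'e) mg_point \<Rightarrow> real) \<Rightarrow> (('v, 'e) mg_point \<Rightarrow> real) \<Rightarrow> bool" where
  "mg_ae_eq G l f g \<longleftrightarrow>
     (\<forall>e\<in>arcs G. AE t in lebesgue_on {0..l e}. f (edge_pt G l e t) = g (edge_pt G l e t))"

definition Lebesgue_space ::
    "('v, 'e) pre_digraph \<Rightarrow> ('e \<Rightarrow> real) \<Rightarrow> real \<Rightarrow> ('v, 'e) mg_point fun_space" where
  "Lebesgue_space G l k =
     ({f. (\<forall>e\<in>arcs G. (\<lambda>t. f (edge_pt G l e t)) \<in> borel_measurable (lebesgue_on {0..l e})) \<and>
          mg_nn_integral G l (\<lambda>x. ennreal (\<bar>f x\<bar> powr k)) < \<infinity>},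
      (\<lambda>f. enn2real (mg_nn_integral G l (\<lambda>x. ennreal (\<bar>f x\<bar> powr k))) powr (1 / k)))"

text \<open>The \<open>p\<close>-th powers of the fractional seminorms on the graph and on a single edge. The value of the
  integrands on the diagonal is \<open>0 / 0 = 0\<close>, which is irrelevant since the diagonal is a null set.\<close>

definition frac_seminorm_pow :: "('v, 'e) pre_digraph \<Rightarrow> ('e \<Rightarrow> real) \<Rightarrow>
    real \<Rightarrow> real \<Rightarrow> (('v, 'e) mg_point \<Rightarrow> real) \<Rightarrow> ennreal" where
  "frac_seminorm_pow G l \<alpha> p f =
     mg_nn_integral G l (\<lambda>x. mg_nn_integral G l (\<lambda>y.
       ennreal (\<bar>f x - f y\<bar> powr p / mg_dist G l x y powr (1 + \<alpha> * p))))"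

definition edge_frac_seminorm_pow :: "('v, 'e) pre_digraph \<Rightarrow> ('e \<Rightarrow> real) \<Rightarrow>
    real \<Rightarrow> real \<Rightarrow> 'e \<Rightarrow> (('v, 'e) mg_point \<Rightarrow> real) \<Rightarrow> ennreal" where
  "edge_frac_seminorm_pow G l \<alpha> p e f =
     (\<integral>\<^sup>+ s. (\<integral>\<^sup>+ t.
        ennreal (\<bar>f (edge_pt G l e s) - f (edge_pt G l e t)\<bar> powr p / \<bar>s - t\<bar> powr (1 + \<alpha> * p))
      \<partial>lebesgue_on {0..l e}) \<partial>lebesgue_on {0..l e})"

definition Sobolev_space ::
    "('v, 'e) pre_digraph \<Rightarrow> ('e \<Rightarrow> real) \<Rightarrow> real \<Rightarrow> real \<Rightarrow> ('v, 'e) mg_point fun_space" where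
  "Sobolev_space G l \<alpha> p =
     ({f \<in> fst (Lebesgue_space G l p). frac_seminorm_pow G l \<alpha> p f < \<infinity>},
      (\<lambda>f. enn2real
         ((\<Sum>e\<in>arcs G. (\<integral>\<^sup>+ t. ennreal (\<bar>f (edge_pt G l e t)\<bar> powr p) \<partial>lebesgue_on {0..l e})
                         + edge_frac_seminorm_pow G l \<alpha> p e f)
          + frac_seminorm_pow G l \<alpha> p f) powr (1 / p)))"

definition sup_norm :: "('v, 'e) pre_digraph \<Rightarrow> ('e \<Rightarrow> real) \<Rightarrow> (('v, 'e) mg_point \<Rightarrow> real) \<Rightarrow> real" where
  "sup_norm G l f = (SUP x\<in>mg_space G l. \<bar>f x\<bar>)"

text \<open>Pairs \<open>x = y\<close> contribute \<open>0 / 0 = 0\<close> to the supremum of the difference quotients.\<close>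

definition Hoelder_space ::
    "('v, 'e) pre_digraph \<Rightarrow> ('e \<Rightarrow> real) \<Rightarrow> real \<Rightarrow> ('v, 'e) mg_point fun_space" where
  "Hoelder_space G l lam =
     (if lam = 0 then
        ({f. continuous_map (Metric_space.mtopology (mg_space G l) (mg_dist G l)) euclideanreal f},
         sup_norm G l)
      else
        ({f. \<exists>C. \<forall>x\<in>mg_space G l. \<forall>y\<in>mg_space G l. \<bar>f x - f y\<bar> \<le> C * mg_dist G l x y powr lam},
         (\<lambda>f. sup_norm G l f +
            (SUP (x, y)\<in>mg_space G l \<times> mg_space G l. \<bar>f x - f y\<bar> / mg_dist G l x y powr lam))))"


section \<open>Compact embeddings\<close>

definition seminorm_topology :: "'a fun_space \<Rightarrow> ('a \<Rightarrow> real) topology" where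
  "seminorm_topology Y = topology (\<lambda>U. U \<subseteq> fst Y \<and>
     (\<forall>f\<in>U. \<exists>r>0. \<forall>g\<in>fst Y. snd Y (\<lambda>x. g x - f x) < r \<longrightarrow> g \<in> U))"

text \<open>A set is compact in the seminorm topology iff its image in the associated normed space (the
  quotient by the functions of seminorm \<open>0\<close>) is compact.\<close>

definition compact_linear_operator ::
    "'a fun_space \<Rightarrow> 'b fun_space \<Rightarrow> (('a \<Rightarrow> real) \<Rightarrow> ('b \<Rightarrow> real)) \<Rightarrow> bool" where
  "compact_linear_operator X Y J \<longleftrightarrow>
     J \<in> fst X \<rightarrow> fst Y \<and>
     (\<forall>f\<in>fst X. \<forall>g\<in>fst X. J (\<lambda>x. f x + g x) = (\<lambda>x. J f x + J g x)) \<and>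
     (\<forall>c. \<forall>f\<in>fst X. J (\<lambda>x. c * f x) = (\<lambda>x. c * J f x)) \<and>
     (\<forall>B. B \<subseteq> fst X \<and> (\<exists>M. \<forall>f\<in>B. snd X f \<le> M) \<longrightarrow>
        compactin (seminorm_topology Y) (seminorm_topology Y closure_of (J ` B)))"

text \<open>The inclusion map up to a.e. equality sends each function to an a.e. equal representative that
  lies in the target space.\<close>

definition compactly_embeds :: "('v, 'e) pre_digraph \<Rightarrow> ('e \<Rightarrow> real) \<Rightarrow>
    ('v, 'e) mg_point fun_space \<Rightarrow> ('v, 'e) mg_point fun_space \<Rightarrow> bool" where
  "compactly_embeds G l X Y \<longleftrightarrow>
     (\<exists>J. (\<forall>f\<in>fst X. J f \<in> fst Y \<and> mg_ae_eq G l (J f) f) \<and> compact_linear_operator X Y J)"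


section \<open>Basic facts\<close>

lemma openin_seminorm_topology:
  "openin (seminorm_topology Y) U \<longleftrightarrow> U \<subseteq> fst Y \<and>
     (\<forall>f\<in>U. \<exists>r>0. \<forall>g\<in>fst Y. snd Y (\<lambda>x. g x - f x) < r \<longrightarrow> g \<in> U)"
proof -
  have "istopology (\<lambda>U. U \<subseteq> fst Y \<and>
     (\<forall>f\<in>U. \<exists>r>0. \<forall>g\<in>fst Y. snd Y (\<lambda>x. g x - f x) < r \<longrightarrow> g \<in> U))" (is "istopology ?P")
    unfolding istopology_def
  proof (intro conjI allI impI)
    fix S T assume S: "?P S" and T: "?P T"
    show "S \<inter> T \<subseteq> fst Y" using S by blast
    show "\<forall>f\<in>S \<inter> T. \<exists>r>0. \<forall>g\<in>fst Y. snd Y (\<lambda>x. g x - f x) < r \<longrightarrow> g \<in> S \<inter> T"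
    proof
      fix f assume f: "f \<in> S \<inter> T"
      obtain r where r: "r > 0" "\<forall>g\<in>fst Y. snd Y (\<lambda>x. g x - f x) < r \<longrightarrow> g \<in> S"
        using S f by blast
      obtain r' where r': "r' > 0" "\<forall>g\<in>fst Y. snd Y (\<lambda>x. g x - f x) < r' \<longrightarrow> g \<in> T"
        using T f by blast
      show "\<exists>r>0. \<forall>g\<in>fst Y. snd Y (\<lambda>x. g x - f x) < r \<longrightarrow> g \<in> S \<inter> T"
        using r r' by (intro exI[of _ "min r r'"]) auto
    qed
  next
    fix K assume K: "\<forall>S\<in>K. ?P S"
    show "\<Union>K \<subseteq> fst Y" using K by blast
    show "\<forall>f\<in>\<Union>K. \<exists>r>0. \<forall>g\<in>fst Y. snd Y (\<lambda>x. g x - f x) < r \<longrightarrow> g \<in> \<Union>K"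
      using K by (meson UnionE UnionI)
  qed
  then show ?thesis
    by (simp add: seminorm_topology_def topology_inverse')
qed

lemma path_len_nonneg: "0 \<le> path_len ps"
  unfolding path_len_def by (induction ps) auto

lemma mg_path_append:
  "mg_path G l x ps y \<Longrightarrow> mg_path G l y qs z \<Longrightarrow> mg_path G l x (ps @ qs) z"
  by (induction G l x ps y rule: mg_path.induct) auto

lemma mg_path_rev:
  "mg_path G l x ps y \<Longrightarrow> \<exists>qs. mg_path G l y qs x \<and> path_len qs = path_len ps"
proof (induction G l x ps y rule: mg_path.induct)
  case (1 G l x y)
  then show ?case by (intro exI[of _ "[]"]) auto
next
  case (2 G l x e s t ps y)
  then obtain qs where "mg_path G l y qs (edge_pt G l e t)" "path_len qs = path_len ps"
    by auto
  moreover have "mg_path G l (edge_pt G l e t) [(e, t, s)] x"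
    using 2 by auto
  ultimately show ?case
    using mg_path_append by (intro exI[of _ "qs @ [(e, t, s)]"] conjI) (blast, auto simp: path_len_def)
qed

lemma mg_path_lipschitz:
  assumes "\<And>e s t. e \<in> arcs G \<Longrightarrow> s \<in> {0..l e} \<Longrightarrow> t \<in> {0..l e} \<Longrightarrow>
      \<bar>u (edge_pt G l e t) - u (edge_pt G l e s)\<bar> \<le> \<bar>t - s\<bar>"
  shows "mg_path G l x ps y \<Longrightarrow> \<bar>u y - u x\<bar> \<le> path_len ps"
proof (induction ps arbitrary: x)
  case Nil
  then show ?case by (simp add: path_len_def)
next
  case (Cons q ps)
  obtain e s t where q: "q = (e, s, t)" by (cases q)
  have "\<bar>u y - u (edge_pt G l e t)\<bar> \<le> path_len ps"
    using Cons q by auto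
  moreover have "\<bar>u (edge_pt G l e t) - u x\<bar> \<le> \<bar>t - s\<bar>"
    using Cons.prems q assms by auto
  ultimately show ?case
    using q by (auto simp: path_len_def)
qed

context compact_metric_graph
begin

lemma edge_pt_in_mg_space:
  "e \<in> arcs G \<Longrightarrow> t \<in> {0..l e} \<Longrightarrow> edge_pt G l e t \<in> mg_space G l"
  by (auto simp: edge_pt_def mg_space_def)

lemma mg_space_eq: "mg_space G l = Vertex ` verts G \<union> (\<Union>e\<in>arcs G. edge_pt G l e ` {0..l e})"
proof -
  have "Interior e t \<in> edge_pt G l e ` {0..l e}" if "0 < t" "t < l e" for e t
    using that by (intro image_eqI[of _ _ t]) (auto simp: edge_pt_def)
  then show ?thesis
    using edge_pt_in_mg_space by (fastforce simp: mg_space_def)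
qed

lemma edge_pt_eq_iff:
  assumes "e \<in> arcs G" "f \<in> arcs G" "s \<in> {0..l e}" "t \<in> {0..l f}"
  shows "edge_pt G l e s = edge_pt G l f t \<longleftrightarrow>
    (e = f \<and> s = t) \<or>
    (\<exists>v. (s = 0 \<and> tail G e = v \<or> s = l e \<and> head G e = v) \<and>
         (t = 0 \<and> tail G f = v \<or> t = l f \<and> head G f = v))"
  using length_pos[OF assms(1)] length_pos[OF assms(2)] by (auto simp: edge_pt_def)

lemma mg_path_vertices:
  assumes "u \<in> verts G" "v \<in> verts G"
  shows "\<exists>ps. mg_path G l (Vertex u) ps (Vertex v)"
proof -
  let ?R = "\<Union>e\<in>arcs G. {(tail G e, head G e), (head G e, tail G e)}"
  have "(u, v) \<in> rtrancl_on (verts G) ?R"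
    using assms connected_graph
    by (auto simp: Digraph_Component.connected_def strongly_connected_def reachable_def
        mk_symmetric_def arcs_ends_conv with_proj_def)
  then show ?thesis
  proof induction
    case base
    then show ?case by (intro exI[of _ "[]"]) auto
  next
    case (step a b)
    then obtain ps where ps: "mg_path G l (Vertex b) ps (Vertex v)" by auto
    from step obtain e where e: "e \<in> arcs G"
      "a = tail G e \<and> b = head G e \<or> a = head G e \<and> b = tail G e" by auto
    then have "mg_path G l (Vertex a) [(e, 0, l e)] (Vertex b) \<or>
      mg_path G l (Vertex a) [(e, l e, 0)] (Vertex b)"
      using length_pos[OF e(1)] by (auto simp: edge_pt_def)
    then show ?case
      using mg_path_append[OF _ ps] by blast
  qed
qed

lemma mg_path_to_vertex:
  assumes "x \<in> mg_space G l"
  shows "\<exists>v\<in>verts G. \<exists>ps. mg_path G l x ps (Vertex v)"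
  using assms unfolding mg_space_def
proof (elim UnE)
  assume "x \<in> Vertex ` verts G"
  then show ?thesis by (auto intro!: exI[of _ "[]"])
next
  assume "x \<in> {Interior e t | e t. e \<in> arcs G \<and> 0 < t \<and> t < l e}"
  then obtain e t where "x = Interior e t" "e \<in> arcs G" "0 < t" "t < l e" by auto
  then show ?thesis
    by (intro bexI[of _ "tail G e"] exI[of _ "[(e, t, 0)]"]) (auto simp: edge_pt_def)
qed

lemma mg_path_exists:
  assumes "x \<in> mg_space G l" "y \<in> mg_space G l"
  shows "\<exists>ps. mg_path G l x ps y"
  using mg_path_to_vertex[OF assms(1)] mg_path_to_vertex[OF assms(2)]
    mg_path_vertices mg_path_append mg_path_rev by metis

lemma mg_dist_le:
  assumes "x \<in> mg_space G l" "y \<in> mg_space G l" "mg_path G l x ps y"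
  shows "mg_dist G l x y \<le> path_len ps"
proof -
  have "bdd_below {path_len ps | ps. mg_path G l x ps y}"
    by (intro bdd_belowI[of _ 0]) (auto simp: path_len_nonneg)
  then show ?thesis
    using assms by (auto simp: mg_dist_def intro: cInf_lower)
qed

lemma mg_dist_ge:
  assumes "x \<in> mg_space G l" "y \<in> mg_space G l" "\<And>ps. mg_path G l x ps y \<Longrightarrow> c \<le> path_len ps"
  shows "c \<le> mg_dist G l x y"
  using assms mg_path_exists[OF assms(1,2)] by (auto simp: mg_dist_def intro!: cInf_greatest)

lemma mg_dist_less:
  assumes "x \<in> mg_space G l" "y \<in> mg_space G l" "mg_dist G l x y < c"
  shows "\<exists>ps. mg_path G l x ps y \<and> path_len ps < c"
  using mg_dist_ge[OF assms(1,2), of c] assms(3) by (meson leI not_le)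

lemma mg_dist_pos:
  assumes x: "x \<in> mg_space G l" and y: "y \<in> mg_space G l" and "x \<noteq> y"
  shows "0 < mg_dist G l x y"
proof -
  have "\<exists>u. u x = 0 \<and> u y > 0 \<and> (\<forall>e\<in>arcs G. \<forall>s\<in>{0..l e}. \<forall>t\<in>{0..l e}.
      \<bar>u (edge_pt G l e t) - u (edge_pt G l e s)\<bar> \<le> \<bar>t - s\<bar>)"
  proof (cases x)
    case (Interior e s)
    then have e: "e \<in> arcs G" "0 < s" "s < l e"
      using x by (auto simp: mg_space_def)
    define r where "r = min s (l e - s)"
    define u where "u = (\<lambda>z :: ('v, 'e) mg_point. case z of Vertex _ \<Rightarrow> r
      | Interior f t \<Rightarrow> if f = e then min r \<bar>t - s\<bar> else r)"
    have "r > 0" using e by (auto simp: r_def)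
    have ue: "u (edge_pt G l e t) = min r \<bar>t - s\<bar>" if "t \<in> {0..l e}" for t
      using that e by (auto simp: u_def edge_pt_def r_def)
    have uf: "u (edge_pt G l f t) = r" if "f \<noteq> e" for f t
      using that by (auto simp: u_def edge_pt_def)
    have "\<bar>u (edge_pt G l f t') - u (edge_pt G l f s')\<bar> \<le> \<bar>t' - s'\<bar>"
      if "s' \<in> {0..l f}" "t' \<in> {0..l f}" for f s' t'
      using that by (cases "f = e") (auto simp: ue uf)
    moreover have "u x = 0" "u y > 0"
      using Interior \<open>x \<noteq> y\<close> \<open>r > 0\<close> by (auto simp: u_def split: mg_point.splits)
    ultimately show ?thesis by blast
  next
    case (Vertex v)
    obtain r where r: "r > 0" "\<And>e. e \<in> arcs G \<Longrightarrow> r \<le> l e"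
    proof (cases "arcs G = {}")
      case True
      then show ?thesis using that[of 1] by simp
    next
      case False
      show ?thesis
        using False length_pos by (intro that[of "Min (l ` arcs G)"]) auto
    qed
    define h where "h = (\<lambda>f t. min r (min (if tail G f = v then t else r)
      (if head G f = v then l f - t else r)))"
    define u where "u = (\<lambda>z :: ('v, 'e) mg_point. case z of
      Vertex w \<Rightarrow> if w = v then 0 else r | Interior f t \<Rightarrow> h f t)"
    have ue: "u (edge_pt G l f t) = h f t" if "f \<in> arcs G" "t \<in> {0..l f}" for f t
      using that r(1) r(2)[OF that(1)] by (auto simp: u_def h_def edge_pt_def)
    have "\<bar>h f t - h f s\<bar> \<le> \<bar>t - s\<bar>" for f s t
      by (auto simp: h_def)
    then have "\<bar>u (edge_pt G l f t') - u (edge_pt G l f s')\<bar> \<le> \<bar>t' - s'\<bar>"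
      if "f \<in> arcs G" "s' \<in> {0..l f}" "t' \<in> {0..l f}" for f s' t'
      using that by (simp add: ue)
    moreover have "u x = 0" "u y > 0"
      using Vertex \<open>x \<noteq> y\<close> r y by (auto simp: u_def h_def mg_space_def split: mg_point.splits)
    ultimately show ?thesis by blast
  qed
  then obtain u where u: "u x = 0" "u y > 0" "\<And>e s t. e \<in> arcs G \<Longrightarrow> s \<in> {0..l e} \<Longrightarrow> t \<in> {0..l e} \<Longrightarrow>
      \<bar>u (edge_pt G l e t) - u (edge_pt G l e s)\<bar> \<le> \<bar>t - s\<bar>"
    by blast
  have "u y \<le> path_len ps" if "mg_path G l x ps y" for ps
    using mg_path_lipschitz[of G l u, OF u(3) that] u(1) by auto
  then show ?thesis
    using mg_dist_ge[OF x y, of "u y"] u(2) by force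
qed

lemma mg_dist_sym_le:
  assumes "x \<in> mg_space G l" "y \<in> mg_space G l"
  shows "mg_dist G l y x \<le> mg_dist G l x y"
  using mg_dist_ge[OF assms] mg_path_rev mg_dist_le[OF assms(2,1)] by metis

sublocale Metric_space "mg_space G l" "mg_dist G l"
proof
  fix x y
  show "0 \<le> mg_dist G l x y"
  proof (cases "x \<in> mg_space G l \<and> y \<in> mg_space G l")
    case True
    then show ?thesis using mg_dist_ge path_len_nonneg by blast
  next
    case False
    then show ?thesis by (auto simp: mg_dist_def)
  qed
  show "mg_dist G l x y = mg_dist G l y x"
  proof (cases "x \<in> mg_space G l \<and> y \<in> mg_space G l")
    case True
    then show ?thesis using mg_dist_sym_le by (simp add: order_antisym)
  next
    case False
    then show ?thesis by (auto simp: mg_dist_def)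
  qed
next
  fix x y assume xy: "x \<in> mg_space G l" "y \<in> mg_space G l"
  have "mg_dist G l x x \<le> 0"
    using mg_dist_le[OF xy(1) xy(1), of "[]"] by (simp add: path_len_def)
  moreover have "0 \<le> mg_dist G l x x"
    using mg_dist_ge[OF xy(1) xy(1)] path_len_nonneg by blast
  ultimately show "mg_dist G l x y = 0 \<longleftrightarrow> x = y"
    using mg_dist_pos[OF xy] by (cases "x = y") auto
next
  fix x y z assume xyz: "x \<in> mg_space G l" "y \<in> mg_space G l" "z \<in> mg_space G l"
  show "mg_dist G l x z \<le> mg_dist G l x y + mg_dist G l y z"
  proof (rule field_le_epsilon)
    fix \<epsilon> :: real assume "0 < \<epsilon>"
    then obtain ps qs where "mg_path G l x ps y" "path_len ps < mg_dist G l x y + \<epsilon> / 2"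
      "mg_path G l y qs z" "path_len qs < mg_dist G l y z + \<epsilon> / 2"
      using mg_dist_less[OF xyz(1,2), of "mg_dist G l x y + \<epsilon> / 2"]
        mg_dist_less[OF xyz(2,3), of "mg_dist G l y z + \<epsilon> / 2"] by auto
    moreover from this have "mg_dist G l x z \<le> path_len (ps @ qs)"
      using mg_dist_le xyz mg_path_append by blast
    moreover have "path_len (ps @ qs) = path_len ps + path_len qs"
      by (simp add: path_len_def)
    ultimately show "mg_dist G l x z \<le> mg_dist G l x y + mg_dist G l y z + \<epsilon>"
      by linarith
  qed
qed

end

end

theory Submission
  imports Defs "HOL-Complex_Analysis.Great_Picard"
begin

text \<open>
  Every edge is cut dyadically into \<open>2 ^ n\<close> cells, and a function \<open>f\<close> is compared with its cell
  averages. Jensen's inequality applied to a product of two cells shows that the averages over two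
  cells of length about \<open>2 ^ -n\<close> lying at distance about \<open>2 ^ -n\<close> in the graph differ by at most a
  constant times \<open>2 ^ (n (1 / p - \<alpha>))\<close> times the fractional seminorm; applied to one point and its
  cell it shows that the step function of the averages approximates \<open>f\<close> in \<open>L\<^sub>p\<close> at rate
  \<open>2 ^ (- \<alpha> n)\<close>.

  For \<open>\<alpha> \<le> 1 / p\<close>, interpolation between the two estimates makes consecutive step functions
  differ by a geometrically decreasing amount in \<open>L\<^sub>q\<close> for every subcritical \<open>q\<close>, uniformly on
  bounded sets of the Sobolev space. For \<open>\<alpha> > 1 / p\<close>, the first estimate alone makes the averages
  around each point converge uniformly; the limits define a representative that is Hoelder
  continuous of order \<open>\<alpha> - 1 / p\<close> on the whole graph, vertices included. In both cases a diagonal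
  subsequence along which all the countably many averages converge is convergent in the target
  space; for Hoelder norms of smaller order one interpolates with the supremum norm.
\<close>

section \<open>Convexity inequalities\<close>

text \<open>The exponents come from one count. Two cells of length about h at distance about h
  contribute at least a constant times h^2 h^(-1 - \<alpha> p) |difference|^p to the double
  integral, so their averages differ by at most a constant times h^(\<alpha> - 1/p). In the integral
  of |difference|^q, q - p powers are bounded in this way and the other p powers by h^(\<alpha> p),
  which leaves h^(1 - q (1/p - \<alpha>)): decay exactly for subcritical q.

  The two cells may lie on different edges. Such pairs are seen only by the double integral over the
  whole graph, not by the edgewise seminorms, and this is what ties the edges together at a vertex.

  Functions are pointwise objects here, not classes, so the embedding must be linear as a map of
  functions. For Lebesgue targets the identity serves; for Hoelder targets the representative is a
  limit of averages over cells chosen independently of the function. Compactness of a closure is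
  derived from convergent subsequences of the set itself, with explicitly built limits, and so
  without a separate completeness proof for the target.\<close>

lemma young_powr_tangent:
  fixes a b p :: real
  assumes "1 \<le> p" "0 \<le> a" "0 \<le> b"
  shows "p * a powr (p - 1) * b \<le> (p - 1) * a powr p + b powr p"
proof (cases "p = 1 \<or> a = 0 \<or> b = 0")
  case True
  then show ?thesis using assms by auto
next
  case False
  then have "p > 1" "a > 0" "b > 0" using assms by auto
  then have "(a powr p) powr ((p - 1) / p) * (b powr p) powr (1 / p)
      \<le> (p - 1) / p * a powr p + 1 / p * b powr p"
    by (intro Youngs_inequality_0) (auto simp: field_simps)
  then have "a powr (p - 1) * b \<le> ((p - 1) * a powr p + b powr p) / p"
    using \<open>p > 1\<close> \<open>b > 0\<close> by (simp add: powr_powr add_divide_distrib)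
  then show ?thesis using \<open>p > 1\<close> by (simp add: field_simps)
qed

text \<open>Convexity at the points \<open>x / \<theta>\<close> and
  \<open>y / (1 - \<theta>)\<close>. For small \<theta> the coefficient of the second term is close
  to 1, so the inequality can be iterated along a chain at the price of a mild geometric factor; the
  choice of weight 1/2 gives the symmetric version below.\<close>

lemma powr_add_le_weighted:
  fixes x y k \<theta> :: real
  assumes "1 \<le> k" "0 < \<theta>" "\<theta> < 1" "0 \<le> x" "0 \<le> y"
  shows "(x + y) powr k \<le> \<theta> powr (1 - k) * x powr k + (1 - \<theta>) powr (1 - k) * y powr k"
proof (cases "x = 0 \<or> y = 0")
  case True
  \<comment> \<open>If a summand vanishes, the claim reduces to both coefficients being at least
    1.\<close>
  have ge1: "1 \<le> \<theta> powr (1 - k)" "1 \<le> (1 - \<theta>) powr (1 - k)"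
    using powr_mono2'[of "1 - k" \<theta> 1] powr_mono2'[of "1 - k" "1 - \<theta>" 1] assms by auto
  have "1 * z \<le> c * z" if "1 \<le> c" "z = x powr k \<or> z = y powr k" for c z
    using that by (intro mult_right_mono) auto
  then show ?thesis using True ge1 by auto
next
  case False
  then have xy: "x > 0" "y > 0" using assms by auto
  have "((1 - \<theta>) *\<^sub>R (y / (1 - \<theta>)) + \<theta> *\<^sub>R (x / \<theta>)) powr k
      \<le> (1 - \<theta>) * (y / (1 - \<theta>)) powr k + \<theta> * (x / \<theta>) powr k"
    using assms xy by (intro convex_onD[OF powr_convex]) auto
  also have "\<theta> * (x / \<theta>) powr k = \<theta> powr (1 - k) * x powr k"
    using assms xy by (simp add: powr_divide powr_diff)
  also have "(1 - \<theta>) * (y / (1 - \<theta>)) powr k = (1 - \<theta>) powr (1 - k) * y powr k"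
    using assms xy by (simp add: powr_divide powr_diff)
  finally show ?thesis using assms by (simp add: add.commute)
qed

lemma abs_add_powr_le:
  fixes x y k :: real
  assumes "1 \<le> k"
  shows "\<bar>x + y\<bar> powr k \<le> 2 powr (k - 1) * (\<bar>x\<bar> powr k + \<bar>y\<bar> powr k)"
proof -
  have "\<bar>x + y\<bar> powr k \<le> (\<bar>x\<bar> + \<bar>y\<bar>) powr k"
    using assms by (intro powr_mono2) auto
  also have "\<dots> \<le> (1/2) powr (1 - k) * \<bar>x\<bar> powr k + (1 - 1/2) powr (1 - k) * \<bar>y\<bar> powr k"
    using assms by (intro powr_add_le_weighted) auto
  also have "(1/2::real) powr (1 - k) = 2 powr (k - 1)"
    by (simp add: powr_divide powr_diff)
  also have "(1 - 1/2::real) powr (1 - k) = 2 powr (k - 1)"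
    by (simp add: powr_divide powr_diff)
  finally show ?thesis by (simp add: algebra_simps)
qed

lemma abs_diff_powr_le:
  fixes x y k :: real
  assumes "1 \<le> k"
  shows "\<bar>x - z\<bar> powr k \<le> 2 powr (k - 1) * (\<bar>x - y\<bar> powr k + \<bar>y - z\<bar> powr k)"
  using abs_add_powr_le[OF assms, of "x - y" "y - z"] by simp

section \<open>Compactness in seminorm topologies\<close>

text \<open>Allowing a factor in the triangle inequality spares Minkowski's inequality in the Lebesgue
  spaces.\<close>

locale quasi_pseudometric =
  fixes T :: "'a topology" and V :: "'a set" and qd :: "'a \<Rightarrow> 'a \<Rightarrow> real" and C :: real
  assumes openin_iff: "openin T U \<longleftrightarrow> U \<subseteq> V \<and> (\<forall>f\<in>U. \<exists>r>0. \<forall>g\<in>V. qd g f < r \<longrightarrow> g \<in> U)"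
    and C: "1 \<le> C"
    and zero: "f \<in> V \<Longrightarrow> qd f f = 0"
    and sym: "f \<in> V \<Longrightarrow> g \<in> V \<Longrightarrow> qd f g = qd g f"
    and tri: "f \<in> V \<Longrightarrow> g \<in> V \<Longrightarrow> h \<in> V \<Longrightarrow> qd f h \<le> C * (qd f g + qd g h)"
    and nonneg: "f \<in> V \<Longrightarrow> g \<in> V \<Longrightarrow> 0 \<le> qd f g"
begin

lemma topspace_eq: "topspace T = V"
proof -
  have "openin T V"
    unfolding openin_iff by (auto intro: exI[of _ 1])
  then show ?thesis
    by (meson openin_iff openin_subset openin_topspace subset_antisym)
qed

lemma tri_small:
  assumes "f \<in> V" "g \<in> V" "h \<in> V" "qd f g < e / (2 * C)" "qd g h < e / (2 * C)"
  shows "qd f h < e"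
proof -
  have "qd f h \<le> C * (qd f g + qd g h)" using assms tri by blast
  also have "\<dots> < C * (e / (2 * C) + e / (2 * C))"
    using assms C by (intro mult_strict_left_mono) auto
  also have "\<dots> = e" using C by (simp add: field_simps)
  finally show ?thesis .
qed

lemma nbhd_exists:
  assumes "f \<in> V" "r > 0"
  shows "\<exists>U. openin T U \<and> f \<in> U \<and> (\<forall>g\<in>U. qd g f < r)"
proof -
  \<comment> \<open>With a factor in the triangle inequality a ball need not be open. This set is
    its interior: the points around which some smaller ball stays inside.\<close>
  define U where "U = {g \<in> V. \<exists>s>0. \<forall>h\<in>V. qd h g < s \<longrightarrow> qd h f < r}"
  have "openin T U"
    unfolding openin_iff
  proof (intro conjI ballI)
    fix g assume "g \<in> U"
    then obtain s where s: "s > 0" "\<And>h. h \<in> V \<Longrightarrow> qd h g < s \<Longrightarrow> qd h f < r" and g: "g \<in> V"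
      by (auto simp: U_def)
    have "h \<in> U" if h: "h \<in> V" "qd h g < s / (2 * C)" for h
      unfolding U_def
      using h s C g tri_small[of _ h g s] by (auto intro!: exI[of _ "s / (2 * C)"])
    then show "\<exists>r>0. \<forall>h\<in>V. qd h g < r \<longrightarrow> h \<in> U"
      using s C by (intro exI[of _ "s / (2 * C)"]) auto
  qed (auto simp: U_def)
  moreover have "f \<in> U" using assms by (auto simp: U_def)
  moreover have "qd g f < r" if "g \<in> U" for g
    using that zero by (force simp: U_def)
  ultimately show ?thesis by blast
qed

lemma in_closure_approx:
  assumes "f \<in> T closure_of S" "r > 0"
  shows "\<exists>g\<in>S. g \<in> V \<and> qd g f < r"
proof -
  have f: "f \<in> V" using assms topspace_eq by (auto simp: in_closure_of)
  obtain U where U: "openin T U" "f \<in> U" "\<And>g. g \<in> U \<Longrightarrow> qd g f < r"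
    using nbhd_exists[OF f assms(2)] by blast
  obtain g where "g \<in> S" "g \<in> U"
    using U(1,2) assms(1) unfolding in_closure_of by blast
  moreover from this have "g \<in> V" using openin_subset[OF U(1)] topspace_eq by blast
  ultimately show ?thesis using U(3) by blast
qed

lemma closure_of_limit:
  assumes "f \<in> V" "\<And>n::nat. F n \<in> S" "\<And>n. F n \<in> V" "(\<lambda>n. qd (F n) f) \<longlonglongrightarrow> 0"
  shows "f \<in> T closure_of S"
  unfolding in_closure_of topspace_eq
proof (intro conjI allI impI)
  fix U assume U: "f \<in> U \<and> openin T U"
  then obtain r where "r > 0" "\<And>g. g \<in> V \<Longrightarrow> qd g f < r \<Longrightarrow> g \<in> U"
    unfolding openin_iff by blast
  moreover have "\<forall>\<^sub>F n in sequentially. qd (F n) f < r"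
    using assms(4) \<open>r > 0\<close> by (rule order_tendstoD)
  ultimately show "\<exists>y. y \<in> S \<and> y \<in> U"
    using assms(2,3) by (meson eventually_sequentially order_refl)
qed (use assms in auto)

text \<open>Sequential compactness gives compactness through a Lebesgue number and a finite net.
  Only sequences in \<open>S\<close> are assumed to have convergent subsequences; a sequence in the
  closure is replaced by one in \<open>S\<close> whose n-th term is within \<open>1 / Suc n\<close>
  of it, and limits of the latter lie in the closure.\<close>

theorem compactin_closure_of:
  assumes S: "S \<subseteq> V"
    and seq: "\<And>F. (\<And>n::nat. F n \<in> S) \<Longrightarrow>
      \<exists>f\<in>V. \<exists>r. strict_mono r \<and> (\<lambda>n. qd (F (r n)) f) \<longlonglongrightarrow> 0"
  shows "compactin T (T closure_of S)" (is "compactin _ ?K")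
proof -
  have K: "?K \<subseteq> V" using closure_of_subset_topspace[of T S] topspace_eq by simp
  have seqK: "\<exists>f\<in>?K. \<exists>r. strict_mono r \<and> (\<lambda>n. qd (F (r n)) f) \<longlonglongrightarrow> 0"
    if F: "\<And>n::nat. F n \<in> ?K" for F
  proof -
    have "\<forall>n. \<exists>g. g \<in> S \<and> qd g (F n) < 1 / real (Suc n)"
      using in_closure_approx[OF F] by (metis of_nat_0_less_iff zero_less_Suc zero_less_divide_1_iff)
    from choice[OF this] obtain H where "\<forall>n. H n \<in> S \<and> qd (H n) (F n) < 1 / real (Suc n)" ..
    then have H: "H n \<in> S" "qd (H n) (F n) < 1 / real (Suc n)" for n by blast+
    have "\<exists>f\<in>V. \<exists>r. strict_mono r \<and> (\<lambda>n. qd (H (r n)) f) \<longlonglongrightarrow> 0"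
      by (rule seq) (rule H)
    then obtain f r where f: "f \<in> V" "strict_mono r" "(\<lambda>n. qd (H (r n)) f) \<longlonglongrightarrow> 0"
      by (elim bexE exE conjE)
    have "f \<in> ?K"
      using f H S by (intro closure_of_limit[of f "\<lambda>n. H (r n)"]) auto
    moreover have "(\<lambda>n. qd (F (r n)) f) \<longlonglongrightarrow> 0"
    proof (rule tendsto_sandwich[of "\<lambda>_. 0" _ _ "\<lambda>n. C * (1 / real (Suc n) + qd (H (r n)) f)"])
      have "(\<lambda>n. C * (1 / real (Suc n) + qd (H (r n)) f)) \<longlonglongrightarrow> C * (0 + 0)"
        by (intro tendsto_intros f lim_1_over_n LIMSEQ_Suc)
      then show "(\<lambda>n. C * (1 / real (Suc n) + qd (H (r n)) f)) \<longlonglongrightarrow> 0" by simp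
      show "\<forall>\<^sub>F n in sequentially. qd (F (r n)) f \<le> C * (1 / real (Suc n) + qd (H (r n)) f)"
      proof (rule always_eventually, rule allI)
        fix n
        have mem: "F (r n) \<in> V" "H (r n) \<in> V" using F H S K by auto
        have "qd (F (r n)) f \<le> C * (qd (F (r n)) (H (r n)) + qd (H (r n)) f)"
          using mem f(1) tri by blast
        also have "qd (F (r n)) (H (r n)) = qd (H (r n)) (F (r n))"
          using mem sym by blast
        also have "\<dots> \<le> 1 / real (Suc (r n))" using H(2)[of "r n"] by simp
        also have "\<dots> \<le> 1 / real (Suc n)"
          using seq_suble[OF f(2), of n] by (intro divide_left_mono) auto
        finally show "qd (F (r n)) f \<le> C * (1 / real (Suc n) + qd (H (r n)) f)"
          using C by (simp add: mult_left_mono)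
      qed
    qed (use F K nonneg f(1) in \<open>auto intro!: always_eventually\<close>)
    ultimately show ?thesis using f(2) by blast
  qed
  \<comment> \<open>Otherwise every radius \<open>1 / Suc n\<close> has a centre whose ball fits
    into no member of the cover. The centres accumulate at a point \<open>f\<close>, and the member
    containing \<open>f\<close> also contains these balls for large \<open>n\<close>.\<close>
  have lebesgue_number: "\<exists>n::nat. \<forall>f\<in>?K. \<exists>U\<in>\<U>. \<forall>g\<in>V. qd g f < 1 / real (Suc n) \<longrightarrow> g \<in> U"
    if op: "\<forall>U\<in>\<U>. openin T U" and cov: "?K \<subseteq> \<Union>\<U>" for \<U>
  proof (rule ccontr)
    assume "\<not> ?thesis"
    then have "\<forall>n. \<exists>f\<in>?K. \<forall>U\<in>\<U>. \<exists>g\<in>V. qd g f < 1 / real (Suc n) \<and> g \<notin> U"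
      by (simp only: not_ex ball_simps bex_simps not_imp simp_thms)
    then have "\<forall>n. \<exists>f. f \<in> ?K \<and> (\<forall>U\<in>\<U>. \<exists>g\<in>V. qd g f < 1 / real (Suc n) \<and> g \<notin> U)"
      unfolding Bex_def[of ?K] .
    from choice[OF this] obtain F where
      F': "\<forall>n. F n \<in> ?K \<and> (\<forall>U\<in>\<U>. \<exists>g\<in>V. qd g (F n) < 1 / real (Suc n) \<and> g \<notin> U)" ..
    have F: "F n \<in> ?K" for n using F' by simp
    have "\<exists>f\<in>?K. \<exists>r. strict_mono r \<and> (\<lambda>n. qd (F (r n)) f) \<longlonglongrightarrow> 0"
      by (rule seqK) (rule F)
    then obtain f r where f: "f \<in> ?K" "strict_mono r" "(\<lambda>n. qd (F (r n)) f) \<longlonglongrightarrow> 0"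
      by (elim bexE exE conjE)
    have "f \<in> \<Union>\<U>" using cov f(1) by (rule subsetD)
    then obtain U where U: "U \<in> \<U>" "f \<in> U" by (rule UnionE)
    have "openin T U" using op U(1) by (rule bspec)
    then have "\<exists>r>0. \<forall>g\<in>V. qd g f < r \<longrightarrow> g \<in> U" using U(2) by (simp add: openin_iff)
    then obtain e where e: "e > 0" "\<And>g. g \<in> V \<Longrightarrow> qd g f < e \<Longrightarrow> g \<in> U"
      by (elim exE conjE) simp
    have e': "e / (2 * C) > 0" using e C by simp
    have "\<forall>\<^sub>F n in sequentially. qd (F (r n)) f < e / (2 * C)"
      using f(3) e' by (rule order_tendstoD)
    moreover have "\<forall>\<^sub>F n in sequentially. 1 / real (Suc n) < e / (2 * C)"
      using order_tendstoD(2)[OF LIMSEQ_Suc[OF lim_1_over_n] e'] .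
    ultimately have "\<forall>\<^sub>F n in sequentially. qd (F (r n)) f < e / (2 * C) \<and> 1 / real (Suc n) < e / (2 * C)"
      by eventually_elim simp
    from eventually_happens'[OF sequentially_bot this] obtain n
      where n: "qd (F (r n)) f < e / (2 * C)" "1 / real (Suc n) < e / (2 * C)"
      by (elim exE conjE)
    obtain g where g: "g \<in> V" "qd g (F (r n)) < 1 / real (Suc (r n))" "g \<notin> U"
      using bspec[OF conjunct2[OF spec[OF F', of "r n"]] U(1)] by (elim bexE conjE)
    have "1 / real (Suc (r n)) \<le> 1 / real (Suc n)"
      using seq_suble[OF f(2), of n] by (intro divide_left_mono) auto
    then have "qd g (F (r n)) < e / (2 * C)"
      using g n by linarith
    moreover have "F (r n) \<in> V" "f \<in> V" using F K f(1) by auto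
    ultimately have "qd g f < e"
      using g(1) n(1) by (intro tri_small[of g "F (r n)" f])
    then show False using e(2)[OF g(1)] g(3) by simp
  qed
  \<comment> \<open>Without a finite net one can pick successively an infinite
    \<open>e\<close>-separated sequence. Two consecutive terms of a convergent subsequence
    contradict the separation.\<close>
  have totally_bounded: "\<exists>A. finite A \<and> A \<subseteq> ?K \<and> (\<forall>f\<in>?K. \<exists>a\<in>A. qd f a < e)" if "e > 0" for e
  proof (rule ccontr)
    assume "\<not> ?thesis"
    then have *: "\<exists>f\<in>?K. \<forall>a\<in>A. \<not> qd f a < e" if "finite A" "A \<subseteq> ?K" for A
      using that by (simp only: not_ex de_Morgan_conj ball_simps bex_simps simp_thms) simp
    have "\<exists>F. \<forall>n::nat. F n \<in> ?K \<and> (\<forall>m<n. \<not> qd (F n) (F m) < e)"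
    proof -
      have "\<exists>F. \<forall>n::nat. (\<lambda>F n r. r \<in> ?K \<and> (\<forall>m<n. \<not> qd r (F m) < e)) F n (F n)"
      proof (rule dependent_wellorder_choice)
        fix n :: nat and F assume "\<And>y. y < n \<Longrightarrow> F y \<in> ?K \<and> (\<forall>m<y. \<not> qd (F y) (F m) < e)"
        then have "F ` {..<n} \<subseteq> ?K" by blast
        then have "\<exists>r\<in>?K. \<forall>a\<in>F ` {..<n}. \<not> qd r a < e" by (intro *) simp_all
        then obtain r where "r \<in> ?K" "\<forall>a\<in>F ` {..<n}. \<not> qd r a < e" by (rule bexE)
        then show "\<exists>r. r \<in> ?K \<and> (\<forall>m<n. \<not> qd r (F m) < e)"
          by (intro exI[of _ r]) simp
      qed auto
      then show ?thesis by simp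
    qed
    then obtain F where "\<forall>n::nat. F n \<in> ?K \<and> (\<forall>m<n. \<not> qd (F n) (F m) < e)" by (rule exE)
    then have F: "F n \<in> ?K" "m < n \<Longrightarrow> \<not> qd (F n) (F m) < e" for m n by simp_all
    have "\<exists>f\<in>?K. \<exists>r. strict_mono r \<and> (\<lambda>n. qd (F (r n)) f) \<longlonglongrightarrow> 0"
      by (rule seqK) (rule F)
    then obtain f r where f: "f \<in> ?K" "strict_mono r" "(\<lambda>n. qd (F (r n)) f) \<longlonglongrightarrow> 0"
      by (elim bexE exE conjE)
    have "e / (2 * C) > 0" using that C by simp
    then have "\<forall>\<^sub>F n in sequentially. qd (F (r n)) f < e / (2 * C)"
      using f(3) by (intro order_tendstoD)
    then obtain n where "\<forall>m\<ge>n. qd (F (r m)) f < e / (2 * C)"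
      unfolding eventually_sequentially by (rule exE)
    then have *: "n \<le> m \<longrightarrow> qd (F (r m)) f < e / (2 * C)" for m by (rule spec)
    have n: "qd (F (r n)) f < e / (2 * C)" "qd (F (r (Suc n))) f < e / (2 * C)"
      using *[of n] *[of "Suc n"] by simp_all
    have mem: "F (r n) \<in> V" "F (r (Suc n)) \<in> V" "f \<in> V"
      using F(1) f(1) by (blast intro: subsetD[OF K])+
    have "qd (F (r (Suc n))) (F (r n)) < e"
      using n sym[OF mem(1,3)] mem by (intro tri_small[OF mem(2,3,1)]) simp_all
    then show False
      using F(2)[of "r n" "r (Suc n)"] f(2) by (simp add: strict_mono_Suc_iff)
  qed
  show ?thesis
    unfolding compactin_def topspace_eq
  proof (intro conjI allI impI)
    fix \<U> assume \<U>: "(\<forall>U\<in>\<U>. openin T U) \<and> ?K \<subseteq> \<Union>\<U>"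
    then have "\<exists>n::nat. \<forall>f\<in>?K. \<exists>U\<in>\<U>. \<forall>g\<in>V. qd g f < 1 / real (Suc n) \<longrightarrow> g \<in> U"
      by (intro lebesgue_number) simp_all
    then obtain n :: nat where "\<forall>f\<in>?K. \<exists>U. U \<in> \<U> \<and> (\<forall>g\<in>V. qd g f < 1 / real (Suc n) \<longrightarrow> g \<in> U)"
      unfolding Bex_def by (elim exE)
    from bchoice[OF this] obtain U where
      U': "\<forall>f\<in>?K. U f \<in> \<U> \<and> (\<forall>g\<in>V. qd g f < 1 / real (Suc n) \<longrightarrow> g \<in> U f)" ..
    then have U: "f \<in> ?K \<Longrightarrow> U f \<in> \<U>"
      "f \<in> ?K \<Longrightarrow> g \<in> V \<Longrightarrow> qd g f < 1 / real (Suc n) \<Longrightarrow> g \<in> U f" for f g by simp_all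
    have "\<exists>A. finite A \<and> A \<subseteq> ?K \<and> (\<forall>f\<in>?K. \<exists>a\<in>A. qd f a < 1 / real (Suc n))"
      by (rule totally_bounded) simp
    then obtain A where A: "finite A" "A \<subseteq> ?K" "\<forall>f\<in>?K. \<exists>a\<in>A. qd f a < 1 / real (Suc n)"
      by (elim exE conjE)
    show "\<exists>\<F>. finite \<F> \<and> \<F> \<subseteq> \<U> \<and> ?K \<subseteq> \<Union>\<F>"
    proof (intro exI[of _ "U ` A"] conjI subsetI)
      fix f assume f: "f \<in> ?K"
      from bspec[OF A(3) f] obtain a where a: "a \<in> A" "qd f a < 1 / real (Suc n)" by (rule bexE)
      have "f \<in> U a" using A(2) f K a by (intro U(2)) (simp_all add: subsetD)
      then show "f \<in> \<Union>(U ` A)" using a(1) by blast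
    next
      fix V assume "V \<in> U ` A"
      then obtain a where "V = U a" "a \<in> A" by (rule imageE)
      then show "V \<in> \<U>" using A(2) U(1) by (simp add: subsetD)
    qed (use A(1) in simp)
  qed (rule K)
qed

end

section \<open>Averages\<close>

text \<open>\<open>ennreal\<close> cuts off negative values, so the right-hand side is the integral
  of the positive part of \<open>g\<close>.\<close>

lemma ennreal_integral_le_nn_integral:
  fixes g :: "'a \<Rightarrow> real"
  assumes "integrable M g"
  shows "ennreal (integral\<^sup>L M g) \<le> (\<integral>\<^sup>+x. ennreal (g x) \<partial>M)"
proof -
  have "ennreal (integral\<^sup>L M g) \<le> ennreal (integral\<^sup>L M (\<lambda>x. max 0 (g x)))"
    using assms by (intro ennreal_leI integral_mono) auto
  also have "\<dots> = (\<integral>\<^sup>+x. ennreal (max 0 (g x)) \<partial>M)"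
    using assms by (intro nn_integral_eq_integral[symmetric]) auto
  also have "\<dots> = (\<integral>\<^sup>+x. ennreal (g x) \<partial>M)"
    by (intro nn_integral_cong) (auto simp: max_def ennreal_neg)
  finally show ?thesis .
qed

definition average :: "'a measure \<Rightarrow> 'a set \<Rightarrow> ('a \<Rightarrow> real) \<Rightarrow> real" where
  "average M A u = (LINT x:A|M. u x) / measure M A"

text \<open>The function \<open>b powr p\<close> lies above its tangent at the point
  \<open>a\<close> defined below, by \<open>young_powr_tangent\<close>. Integrating this affine
  lower bound needs only integrability of \<open>u\<close>; the right-hand side may be
  infinite.\<close>

lemma jensen_average:
  fixes u :: "'a \<Rightarrow> real"
  assumes p: "1 \<le> p" and A: "A \<in> sets M" and m: "0 < measure M A" and u: "set_integrable M A u"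
  shows "ennreal (measure M A * \<bar>c - average M A u\<bar> powr p) \<le> (\<integral>\<^sup>+x\<in>A. ennreal (\<bar>c - u x\<bar> powr p) \<partial>M)"
proof -
  define a where "a = \<bar>c - average M A u\<bar>"
  define g where "g x = p * a powr (p - 1) * \<bar>c - u x\<bar> - (p - 1) * a powr p" for x
  \<comment> \<open>\<open>measure\<close> is 0 on sets of infinite measure, so a positive value
    implies finiteness.\<close>
  have fin: "emeasure M A \<noteq> \<infinity>"
    using m by (auto simp: measure_def)
  then have "integrable M (indicator A :: 'a \<Rightarrow> real)"
    using A by (intro integrable_real_indicator) (auto simp: less_top)
  then have const: "set_integrable M A (\<lambda>_. d)" for d :: real
    unfolding set_integrable_def by simp
  have constI: "(LINT x:A|M. d) = d * measure M A" for d :: real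
    using A fin by (simp add: set_integral_const)
  have diff: "set_integrable M A (\<lambda>x. c - u x)"
    by (intro set_integral_diff const u)
  then have absd: "set_integrable M A (\<lambda>x. p * a powr (p - 1) * \<bar>c - u x\<bar>)"
    by (intro set_integrable_mult_right set_integrable_abs)
  have g: "set_integrable M A g"
    unfolding g_def by (intro set_integral_diff const absd)
  have "measure M A * a = \<bar>LINT x:A|M. c - u x\<bar>"
    using m by (simp add: a_def average_def const u constI abs_mult[symmetric] field_simps flip: abs_mult_pos')
  also have "\<dots> \<le> (LINT x:A|M. \<bar>c - u x\<bar>)"
    using set_integral_norm_bound[OF diff] by simp
  finally have "p * a powr (p - 1) * (measure M A * a) \<le> p * a powr (p - 1) * (LINT x:A|M. \<bar>c - u x\<bar>)"
    using p by (intro mult_left_mono) auto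
  moreover have "a powr (p - 1) * a = a powr p"
    using powr_add[of a "p - 1" 1] by (cases "a = 0") (auto simp: a_def)
  ultimately have "p * (measure M A * a powr p) \<le> p * a powr (p - 1) * (LINT x:A|M. \<bar>c - u x\<bar>)"
    by (metis mult.assoc mult.commute)
  moreover have "(LINT x:A|M. g x) = p * a powr (p - 1) * (LINT x:A|M. \<bar>c - u x\<bar>) - (p - 1) * a powr p * measure M A"
    unfolding g_def using absd const constI by simp
  ultimately have "measure M A * a powr p \<le> (LINT x:A|M. g x)"
    by (simp add: algebra_simps)
  then have "ennreal (measure M A * a powr p) \<le> ennreal (LINT x:A|M. g x)" by (rule ennreal_leI)
  also have "\<dots> \<le> (\<integral>\<^sup>+x. ennreal (indicator A x *\<^sub>R g x) \<partial>M)"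
    using g unfolding set_integrable_def set_lebesgue_integral_def
    by (rule ennreal_integral_le_nn_integral)
  also have "\<dots> \<le> (\<integral>\<^sup>+x\<in>A. ennreal (\<bar>c - u x\<bar> powr p) \<partial>M)"
  proof (rule nn_integral_mono)
    fix x
    have "g x \<le> \<bar>c - u x\<bar> powr p"
      using young_powr_tangent[of p a "\<bar>c - u x\<bar>"] p by (simp add: g_def a_def)
    then show "ennreal (indicator A x *\<^sub>R g x) \<le> ennreal (\<bar>c - u x\<bar> powr p) * indicator A x"
      by (auto simp: indicator_def ennreal_leI)
  qed
  finally show ?thesis by (simp add: a_def)
qed

text \<open>Only monotonicity of the integral is used of \<kappa>. The fractional kernel can
  therefore be inserted later without a proof that it, or the graph distance, is measurable.\<close>

lemma jensen_average_kernel: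
  fixes u :: "'a \<Rightarrow> real"
  assumes p: "1 \<le> p" and A[measurable]: "A \<in> sets M" and m: "0 < measure M A" and u: "set_integrable M A u"
    and [measurable]: "u \<in> borel_measurable M" and b: "0 \<le> b"
    and \<kappa>: "\<And>x. x \<in> A \<Longrightarrow> ennreal (b * \<bar>c - u x\<bar> powr p) \<le> \<kappa> x"
  shows "ennreal (b * (measure M A * \<bar>c - average M A u\<bar> powr p)) \<le> (\<integral>\<^sup>+x. \<kappa> x \<partial>M)"
proof -
  have "ennreal (b * (measure M A * \<bar>c - average M A u\<bar> powr p))
      = ennreal b * ennreal (measure M A * \<bar>c - average M A u\<bar> powr p)"
    using b by (simp add: ennreal_mult)
  also have "\<dots> \<le> ennreal b * (\<integral>\<^sup>+x\<in>A. ennreal (\<bar>c - u x\<bar> powr p) \<partial>M)"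
    using jensen_average[OF p A m u] by (intro mult_left_mono) auto
  also have "\<dots> = (\<integral>\<^sup>+x. ennreal b * (ennreal (\<bar>c - u x\<bar> powr p) * indicator A x) \<partial>M)"
    by (rule nn_integral_cmult[symmetric]) measurable
  also have "\<dots> \<le> (\<integral>\<^sup>+x. \<kappa> x \<partial>M)"
    using \<kappa> b by (intro nn_integral_mono) (auto simp: indicator_def ennreal_mult)
  finally show ?thesis .
qed

text \<open>Jensen's inequality twice: in the inner variable, with \<open>u s\<close> as the
  constant, it replaces \<open>v t\<close> by the average of \<open>v\<close>; in the outer
  variable, with that average as the constant, it replaces \<open>u s\<close> by the average of
  \<open>u\<close>.\<close>

lemma average_diff_powr_le:
  fixes u :: "'a \<Rightarrow> real" and v :: "'b \<Rightarrow> real"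
  assumes p: "1 \<le> p"
    and A: "A \<in> sets M" "0 < measure M A" "set_integrable M A u"
    and B: "B \<in> sets N" "0 < measure N B" "set_integrable N B v"
    and [measurable]: "u \<in> borel_measurable M" "v \<in> borel_measurable N" and b: "0 \<le> b"
    and \<kappa>: "\<And>s t. s \<in> A \<Longrightarrow> t \<in> B \<Longrightarrow> ennreal (b * \<bar>u s - v t\<bar> powr p) \<le> \<kappa> s t"
  shows "ennreal (b * (measure M A * measure N B * \<bar>average M A u - average N B v\<bar> powr p))
    \<le> (\<integral>\<^sup>+s. (\<integral>\<^sup>+t. \<kappa> s t \<partial>N) \<partial>M)"
proof -
  define c where "c = average N B v"
  have "ennreal ((b * measure N B) * (measure M A * \<bar>c - average M A u\<bar> powr p))
      \<le> (\<integral>\<^sup>+s. (\<integral>\<^sup>+t. \<kappa> s t \<partial>N) \<partial>M)"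
  proof (rule jensen_average_kernel[OF p A])
    fix s assume s: "s \<in> A"
    have "ennreal (b * (measure N B * \<bar>u s - c\<bar> powr p)) \<le> (\<integral>\<^sup>+t. \<kappa> s t \<partial>N)"
      unfolding c_def by (rule jensen_average_kernel[OF p B]) (use b \<kappa> s in auto)
    then show "ennreal (b * measure N B * \<bar>c - u s\<bar> powr p) \<le> (\<integral>\<^sup>+t. \<kappa> s t \<partial>N)"
      by (simp add: abs_minus_commute mult.assoc)
  qed (use b in auto)
  then show ?thesis by (simp add: c_def abs_minus_commute mult_ac)
qed

lemma average_add:
  fixes u v :: "'a \<Rightarrow> real"
  assumes "set_integrable M A u" "set_integrable M A v"
  shows "average M A (\<lambda>x. u x + v x) = average M A u + average M A v"
  using assms by (simp add: average_def add_divide_distrib)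

lemma average_cmult:
  fixes u :: "'a \<Rightarrow> real"
  shows "average M A (\<lambda>x. c * u x) = c * average M A u"
  by (simp add: average_def)

section \<open>Geometrically convergent sequences of functions\<close>

text \<open>The first increment of the chain is split off with the small weight \<theta>, and the
  rest of the chain starts one level later, where its bound is smaller by the factor \<rho>. The
  constant \<open>K\<close> is chosen before \<open>u\<close>, which later makes the estimate
  uniform over a bounded set of functions.\<close>

lemma chain_powr_bound:
  assumes k: "1 \<le> k" and \<rho>: "0 < \<rho>" "\<rho> < 1" and C: "0 \<le> C"
  shows "\<exists>K\<ge>0. \<forall>u :: nat \<Rightarrow> 'a \<Rightarrow> real. (\<forall>n. u n \<in> borel_measurable M) \<longrightarrow>
      (\<forall>n. (\<integral>\<^sup>+x. ennreal (\<bar>u (Suc n) x - u n x\<bar> powr k) \<partial>M) \<le> ennreal (C * \<rho> ^ n)) \<longrightarrow>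
      (\<forall>n d. (\<integral>\<^sup>+x. ennreal (\<bar>u (n + d) x - u n x\<bar> powr k) \<partial>M) \<le> ennreal (K * \<rho> ^ n))"
proof -
  \<comment> \<open>small enough for the factor \<open>(1 - \<theta>) powr (1 - k)\<close> paid at each step to be absorbed by \<open>\<rho>\<close>\<close>
  define \<theta> where "\<theta> = 1 - \<rho> powr (1 / (2 * k))"
  have "\<rho> powr (1 / (2 * k)) < \<rho> powr 0"
    using k \<rho> by (intro powr_less_mono') auto
  then have \<theta>: "0 < \<theta>" "\<theta> < 1" using \<rho> by (auto simp: \<theta>_def)
  define q where "q = (1 - \<theta>) powr (1 - k) * \<rho>"
  have "q = \<rho> powr ((1 - k) / (2 * k) + 1)"
    using \<rho> by (simp add: q_def \<theta>_def powr_powr powr_add)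
  also have "\<dots> < \<rho> powr 0"
    using k \<rho> by (intro powr_less_mono') (auto simp: field_simps)
  finally have q: "q < 1" "0 \<le> q" using \<rho> by (auto simp: q_def)
  \<comment> \<open>The fixed point of the recursion
    \<open>K = \<theta> powr (1 - k) * C + q * K\<close>, so that the induction on the length of the
    chain reproduces its own bound.\<close>
  define K where "K = \<theta> powr (1 - k) * C / (1 - q)"
  have K: "K \<ge> 0" using q C by (simp add: K_def)
  have Keq: "\<theta> powr (1 - k) * (C * \<rho> ^ n) + (1 - \<theta>) powr (1 - k) * (K * \<rho> ^ Suc n) = K * \<rho> ^ n" for n
  proof -
    have "\<theta> powr (1 - k) * C = K * (1 - q)" using q by (simp add: K_def)
    then have "\<theta> powr (1 - k) * (C * \<rho> ^ n) = K * (1 - q) * \<rho> ^ n"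
      by (simp add: mult.assoc[symmetric])
    then show ?thesis by (simp add: q_def algebra_simps)
  qed
  have "(\<integral>\<^sup>+x. ennreal (\<bar>u (n + d) x - u n x\<bar> powr k) \<partial>M) \<le> ennreal (K * \<rho> ^ n)"
    if [measurable]: "\<And>n. u n \<in> borel_measurable M"
    and step: "\<And>n. (\<integral>\<^sup>+x. ennreal (\<bar>u (Suc n) x - u n x\<bar> powr k) \<partial>M) \<le> ennreal (C * \<rho> ^ n)"
    for u :: "nat \<Rightarrow> 'a \<Rightarrow> real" and n d
  proof (induction d arbitrary: n)
    case 0
    then show ?case using k by simp
  next
    case (Suc d)
    have "(\<integral>\<^sup>+x. ennreal (\<bar>u (n + Suc d) x - u n x\<bar> powr k) \<partial>M)
        \<le> (\<integral>\<^sup>+x. ennreal (\<theta> powr (1 - k)) * ennreal (\<bar>u (Suc n) x - u n x\<bar> powr k)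
            + ennreal ((1 - \<theta>) powr (1 - k)) * ennreal (\<bar>u (Suc n + d) x - u (Suc n) x\<bar> powr k) \<partial>M)"
    proof (rule nn_integral_mono)
      fix x
      have "\<bar>u (n + Suc d) x - u n x\<bar> powr k
          \<le> (\<bar>u (Suc n) x - u n x\<bar> + \<bar>u (Suc n + d) x - u (Suc n) x\<bar>) powr k"
        using k by (intro powr_mono2) auto
      also have "\<dots> \<le> \<theta> powr (1 - k) * \<bar>u (Suc n) x - u n x\<bar> powr k
          + (1 - \<theta>) powr (1 - k) * \<bar>u (Suc n + d) x - u (Suc n) x\<bar> powr k"
        using \<theta> k by (intro powr_add_le_weighted) auto
      finally show "ennreal (\<bar>u (n + Suc d) x - u n x\<bar> powr k)
          \<le> ennreal (\<theta> powr (1 - k)) * ennreal (\<bar>u (Suc n) x - u n x\<bar> powr k)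
            + ennreal ((1 - \<theta>) powr (1 - k)) * ennreal (\<bar>u (Suc n + d) x - u (Suc n) x\<bar> powr k)"
        by (simp add: ennreal_mult[symmetric] ennreal_plus[symmetric] ennreal_leI del: ennreal_plus)
    qed
    also have "\<dots> = ennreal (\<theta> powr (1 - k)) * (\<integral>\<^sup>+x. ennreal (\<bar>u (Suc n) x - u n x\<bar> powr k) \<partial>M)
        + ennreal ((1 - \<theta>) powr (1 - k)) * (\<integral>\<^sup>+x. ennreal (\<bar>u (Suc n + d) x - u (Suc n) x\<bar> powr k) \<partial>M)"
      by (subst nn_integral_add) (auto simp: nn_integral_cmult)
    also have "\<dots> \<le> ennreal (\<theta> powr (1 - k)) * ennreal (C * \<rho> ^ n)
        + ennreal ((1 - \<theta>) powr (1 - k)) * ennreal (K * \<rho> ^ Suc n)"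
      by (intro add_mono mult_left_mono step Suc) auto
    also have "\<dots> = ennreal (K * \<rho> ^ n)"
      using K C \<rho> by (subst Keq[symmetric]) (simp add: ennreal_mult[symmetric] ennreal_plus[symmetric] del: ennreal_plus)
    finally show ?case .
  qed
  then show ?thesis using K by blast
qed

lemma chain_AE_convergent:
  fixes u :: "nat \<Rightarrow> 'a \<Rightarrow> real"
  assumes k: "1 \<le> k" and \<rho>: "0 < \<rho>" "\<rho> < 1" and C: "0 \<le> C"
    and [measurable]: "\<And>n. u n \<in> borel_measurable M"
    and step: "\<And>n. (\<integral>\<^sup>+x. ennreal (\<bar>u (Suc n) x - u n x\<bar> powr k) \<partial>M) \<le> ennreal (C * \<rho> ^ n)"
  shows "AE x in M. convergent (\<lambda>n. u n x)"
proof -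
  \<comment> \<open>The square root splits the decay in two: one factor makes the integrals of the
    weighted increments summable, the other survives as pointwise geometric decay of the
    increments.\<close>
  define \<sigma> where "\<sigma> = sqrt \<rho>"
  have \<sigma>: "0 < \<sigma>" "\<sigma> < 1" "\<sigma> * \<sigma> = \<rho>" using \<rho> by (auto simp: \<sigma>_def)
  define S where "S x = (\<Sum>n. ennreal ((1 / \<sigma>) ^ n) * ennreal (\<bar>u (Suc n) x - u n x\<bar> powr k))" for x
  have [measurable]: "S \<in> borel_measurable M"
    unfolding S_def by measurable
  have "(\<integral>\<^sup>+x. S x \<partial>M) = (\<Sum>n. ennreal ((1 / \<sigma>) ^ n) * (\<integral>\<^sup>+x. ennreal (\<bar>u (Suc n) x - u n x\<bar> powr k) \<partial>M))"
    unfolding S_def by (subst nn_integral_suminf) (auto simp: nn_integral_cmult)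
  also have "\<dots> \<le> (\<Sum>n. ennreal (C * \<sigma> ^ n))"
  proof (intro suminf_le summableI)
    fix n
    have "ennreal ((1 / \<sigma>) ^ n) * (\<integral>\<^sup>+x. ennreal (\<bar>u (Suc n) x - u n x\<bar> powr k) \<partial>M)
        \<le> ennreal ((1 / \<sigma>) ^ n) * ennreal (C * \<rho> ^ n)"
      by (intro mult_left_mono step) auto
    also have "\<dots> = ennreal (C * \<sigma> ^ n)"
      using \<sigma> C by (simp add: ennreal_mult[symmetric] power_divide power_mult_distrib flip: \<sigma>(3))
    finally show "ennreal ((1 / \<sigma>) ^ n) * (\<integral>\<^sup>+x. ennreal (\<bar>u (Suc n) x - u n x\<bar> powr k) \<partial>M)
        \<le> ennreal (C * \<sigma> ^ n)" .
  qed
  also have "\<dots> < \<infinity>"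
    using \<sigma> C by (subst suminf_ennreal2) (auto intro!: summable_mult summable_geometric)
  finally have "AE x in M. S x \<noteq> \<infinity>"
    by (intro nn_integral_noteq_infinite) auto
  then show ?thesis
  proof eventually_elim
    case (elim x)
    define c where "c = enn2real (S x)"
    have "\<bar>u (Suc n) x - u n x\<bar> \<le> c powr (1 / k) * (\<sigma> powr (1 / k)) ^ n" for n
    proof -
      have "ennreal ((1 / \<sigma>) ^ n * \<bar>u (Suc n) x - u n x\<bar> powr k) \<le> S x"
        unfolding S_def using \<sigma> by (subst ennreal_mult) (auto intro!: ennreal_suminf_lessD sum_le_suminf[of _ "{n}", simplified] summableI)
      also have "S x = ennreal c" using elim by (simp add: c_def less_top)
      finally have "(1 / \<sigma>) ^ n * \<bar>u (Suc n) x - u n x\<bar> powr k \<le> c"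
        by (simp add: c_def)
      then have "\<bar>u (Suc n) x - u n x\<bar> powr k \<le> c * \<sigma> ^ n"
        using \<sigma> by (simp add: field_simps)
      then have "(\<bar>u (Suc n) x - u n x\<bar> powr k) powr (1 / k) \<le> (c * \<sigma> ^ n) powr (1 / k)"
        using k by (intro powr_mono2) auto
      then show ?thesis
        using k \<sigma> by (simp add: powr_powr powr_mult c_def powr_power powr_realpow[symmetric] mult.commute)
    qed
    moreover have "summable (\<lambda>n. c powr (1 / k) * (\<sigma> powr (1 / k)) ^ n)"
      using \<sigma> k powr_less_mono2[of "1 / k" \<sigma> 1] by (intro summable_mult summable_geometric) auto
    ultimately have "summable (\<lambda>n. u (Suc n) x - u n x)"
      by (intro summable_comparison_test[of "\<lambda>n. u (Suc n) x - u n x" "\<lambda>n. c powr (1 / k) * (\<sigma> powr (1 / k)) ^ n"])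
        (auto)
    then have "convergent (\<lambda>n. \<Sum>i<n. u (Suc i) x - u i x)"
      by (simp add: summable_iff_convergent)
    then have "convergent (\<lambda>n. (u n x - u 0 x) + u 0 x)"
      by (intro convergent_add) (auto simp: sum_lessThan_telescope[of "\<lambda>n. u n x"] convergent_const)
    then show ?case by simp
  qed
qed

text \<open>Fatou's lemma: almost everywhere the integrand on the left is the lower limit of
  measurable integrands. Passing on to the upper limit lets a bound that holds only eventually
  suffice.\<close>

lemma nn_integral_powr_limit_le:
  fixes u :: "nat \<Rightarrow> 'a \<Rightarrow> real"
  assumes k: "0 < k" 
    and [measurable]: "\<And>n. u n \<in> borel_measurable M"
    and lim: "AE x in M. (\<lambda>n. u n x) \<longlonglongrightarrow> f x"
    and bound: "\<forall>\<^sub>F n in sequentially. (\<integral>\<^sup>+x. ennreal (\<bar>u n x\<bar> powr k) \<partial>M) \<le> c"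
  shows "(\<integral>\<^sup>+x. ennreal (\<bar>f x\<bar> powr k) \<partial>M) \<le> c"
proof -
  have "(\<integral>\<^sup>+x. ennreal (\<bar>f x\<bar> powr k) \<partial>M) = (\<integral>\<^sup>+x. liminf (\<lambda>n. ennreal (\<bar>u n x\<bar> powr k)) \<partial>M)"
  proof (rule nn_integral_cong_AE)
    show "AE x in M. ennreal (\<bar>f x\<bar> powr k) = liminf (\<lambda>n. ennreal (\<bar>u n x\<bar> powr k))"
      using lim
    proof eventually_elim
      case (elim x)
      have "(\<lambda>n. ennreal (\<bar>u n x\<bar> powr k)) \<longlonglongrightarrow> ennreal (\<bar>f x\<bar> powr k)"
        using k by (intro tendsto_ennrealI tendsto_powr' tendsto_rabs elim tendsto_const) auto
      then show ?case using lim_imp_Liminf[OF sequentially_bot] by metis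
    qed
  qed
  also have "\<dots> \<le> liminf (\<lambda>n. \<integral>\<^sup>+x. ennreal (\<bar>u n x\<bar> powr k) \<partial>M)"
    by (intro nn_integral_liminf) auto
  also have "\<dots> \<le> limsup (\<lambda>n. \<integral>\<^sup>+x. ennreal (\<bar>u n x\<bar> powr k) \<partial>M)"
    by (rule Liminf_le_Limsup) simp
  also have "\<dots> \<le> c"
    by (intro Limsup_bounded bound)
  finally show ?thesis .
qed

lemma nn_integral_abs_diff_powr_le:
  assumes "1 \<le> k" and [measurable]: "f \<in> borel_measurable M" "g \<in> borel_measurable M" "h \<in> borel_measurable M"
  shows "(\<integral>\<^sup>+x. ennreal (\<bar>f x - h x\<bar> powr k) \<partial>M)
    \<le> ennreal (2 powr (k - 1)) * ((\<integral>\<^sup>+x. ennreal (\<bar>f x - g x\<bar> powr k) \<partial>M)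
        + (\<integral>\<^sup>+x. ennreal (\<bar>g x - h x\<bar> powr k) \<partial>M))"
proof -
  have "(\<integral>\<^sup>+x. ennreal (\<bar>f x - h x\<bar> powr k) \<partial>M)
      \<le> (\<integral>\<^sup>+x. ennreal (2 powr (k - 1)) * (ennreal (\<bar>f x - g x\<bar> powr k) + ennreal (\<bar>g x - h x\<bar> powr k)) \<partial>M)"
    using abs_diff_powr_le[OF assms(1)]
    by (intro nn_integral_mono) (simp add: ennreal_mult[symmetric] ennreal_plus[symmetric] ennreal_leI del: ennreal_plus)
  also have "\<dots> = ennreal (2 powr (k - 1)) * ((\<integral>\<^sup>+x. ennreal (\<bar>f x - g x\<bar> powr k) \<partial>M)
        + (\<integral>\<^sup>+x. ennreal (\<bar>g x - h x\<bar> powr k) \<partial>M))"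
    by (simp add: nn_integral_cmult nn_integral_add)
  finally show ?thesis .
qed

text \<open>The index \<open>i\<close> runs through the functions, \<open>n\<close> through the
  levels of approximation. The step bound does not depend on \<open>i\<close>, so by Fatou's lemma
  the limits \<open>G n\<close> inherit it and converge almost everywhere to a function
  \<open>f\<close>. The distance from \<open>F i\<close> to \<open>f\<close> is then estimated along
  \<open>U i n\<close> and \<open>G n\<close>. The second conclusion says that each
  \<open>F i\<close> is at finite distance from its approximations, which yields membership in the
  target space.\<close>

lemma chain_compactness:
  fixes U :: "nat \<Rightarrow> nat \<Rightarrow> 'a \<Rightarrow> real"
  assumes k: "1 \<le> k" and \<rho>: "0 < \<rho>" "\<rho> < 1" and C: "0 \<le> C"
    and U[measurable]: "\<And>i n. U i n \<in> borel_measurable M"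
    and F[measurable]: "\<And>i. F i \<in> borel_measurable M"
    and G[measurable]: "\<And>n. G n \<in> borel_measurable M"
    and UF: "\<And>i. AE x in M. (\<lambda>n. U i n x) \<longlonglongrightarrow> F i x"
    and step: "\<And>i n. (\<integral>\<^sup>+x. ennreal (\<bar>U i (Suc n) x - U i n x\<bar> powr k) \<partial>M) \<le> ennreal (C * \<rho> ^ n)"
    and UG: "\<And>n x. (\<lambda>i. U i n x) \<longlonglongrightarrow> G n x"
    and UG_int: "\<And>n. (\<lambda>i. \<integral>\<^sup>+x. ennreal (\<bar>U i n x - G n x\<bar> powr k) \<partial>M) \<longlonglongrightarrow> 0"
  shows "\<exists>f\<in>borel_measurable M. (\<lambda>i. \<integral>\<^sup>+x. ennreal (\<bar>F i x - f x\<bar> powr k) \<partial>M) \<longlonglongrightarrow> 0"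
    and "(\<integral>\<^sup>+x. ennreal (\<bar>F i x - U i n x\<bar> powr k) \<partial>M) < \<infinity>"
proof -
  obtain K where K: "K \<ge> 0" and Kb: "\<And>u n d. (\<And>n. u n \<in> borel_measurable M) \<Longrightarrow>
      (\<And>n. (\<integral>\<^sup>+x. ennreal (\<bar>u (Suc n) x - u n x\<bar> powr k) \<partial>M) \<le> ennreal (C * \<rho> ^ n)) \<Longrightarrow>
      (\<integral>\<^sup>+x. ennreal (\<bar>u (n + d) x - u n x\<bar> powr k) \<partial>M) \<le> ennreal (K * \<rho> ^ n)"
    using chain_powr_bound[OF k \<rho> C, of M] by auto
  have lim: "(\<integral>\<^sup>+x. ennreal (\<bar>f x - u n x\<bar> powr k) \<partial>M) \<le> ennreal (K * \<rho> ^ n)"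
    if [measurable]: "\<And>n. u n \<in> borel_measurable M"
      and s: "\<And>n. (\<integral>\<^sup>+x. ennreal (\<bar>u (Suc n) x - u n x\<bar> powr k) \<partial>M) \<le> ennreal (C * \<rho> ^ n)"
      and l: "AE x in M. (\<lambda>n. u n x) \<longlonglongrightarrow> f x" for u f n
  proof (rule nn_integral_powr_limit_le[where u = "\<lambda>d x. u (n + d) x - u n x"])
    show "AE x in M. (\<lambda>d. u (n + d) x - u n x) \<longlonglongrightarrow> f x - u n x"
      using l
    proof eventually_elim
      case (elim x)
      then show ?case
        by (intro tendsto_diff tendsto_const) (use LIMSEQ_ignore_initial_segment[OF elim, of n] in \<open>simp add: add.commute\<close>)
    qed
  qed (use k Kb[OF that(1,2)] in auto)
  have stepG: "(\<integral>\<^sup>+x. ennreal (\<bar>G (Suc n) x - G n x\<bar> powr k) \<partial>M) \<le> ennreal (C * \<rho> ^ n)" for n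
    using k step by (intro nn_integral_powr_limit_le[where u = "\<lambda>i x. U i (Suc n) x - U i n x"] AE_I2 tendsto_diff UG) auto
  define f where "f x = lim (\<lambda>n. G n x)" for x
  have [measurable]: "f \<in> borel_measurable M"
    unfolding f_def by measurable
  have "AE x in M. convergent (\<lambda>n. G n x)"
    by (rule chain_AE_convergent[OF k \<rho> C G stepG])
  then have "AE x in M. (\<lambda>n. G n x) \<longlonglongrightarrow> f x"
    by eventually_elim (simp add: f_def convergent_LIMSEQ_iff)
  note fG = lim[OF G stepG this]
  define A :: real where "A = 2 powr (k - 1)"
  have A: "A \<ge> 0" by (simp add: A_def)
  have main: "(\<integral>\<^sup>+x. ennreal (\<bar>F i x - f x\<bar> powr k) \<partial>M)
      \<le> ennreal ((A + A * A) * (K * \<rho> ^ n)) + ennreal (A * A) * (\<integral>\<^sup>+x. ennreal (\<bar>U i n x - G n x\<bar> powr k) \<partial>M)" for i n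
  proof -
    have Gf: "(\<integral>\<^sup>+x. ennreal (\<bar>G n x - f x\<bar> powr k) \<partial>M) \<le> ennreal (K * \<rho> ^ n)"
      using fG[of n] by (simp add: abs_minus_commute)
    have "(\<integral>\<^sup>+x. ennreal (\<bar>F i x - f x\<bar> powr k) \<partial>M)
        \<le> ennreal A * ((\<integral>\<^sup>+x. ennreal (\<bar>F i x - U i n x\<bar> powr k) \<partial>M) + (\<integral>\<^sup>+x. ennreal (\<bar>U i n x - f x\<bar> powr k) \<partial>M))"
      unfolding A_def using k by (intro nn_integral_abs_diff_powr_le) auto
    also have "\<dots> \<le> ennreal A * (ennreal (K * \<rho> ^ n) +
        ennreal A * ((\<integral>\<^sup>+x. ennreal (\<bar>U i n x - G n x\<bar> powr k) \<partial>M) + (\<integral>\<^sup>+x. ennreal (\<bar>G n x - f x\<bar> powr k) \<partial>M)))"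
      using k by (intro mult_left_mono add_mono lim U step UF)
        (auto simp: A_def intro!: nn_integral_abs_diff_powr_le)
    also have "\<dots> \<le> ennreal A * (ennreal (K * \<rho> ^ n) +
        ennreal A * ((\<integral>\<^sup>+x. ennreal (\<bar>U i n x - G n x\<bar> powr k) \<partial>M) + ennreal (K * \<rho> ^ n)))"
      by (intro mult_left_mono add_mono order_refl Gf) auto
    also have "\<dots> = ennreal ((A + A * A) * (K * \<rho> ^ n)) + ennreal (A * A) * (\<integral>\<^sup>+x. ennreal (\<bar>U i n x - G n x\<bar> powr k) \<partial>M)"
      using A K \<rho> by (simp add: ennreal_mult distrib_left distrib_right mult_ac add_ac)
    finally show ?thesis .
  qed
  have "(\<lambda>i. \<integral>\<^sup>+x. ennreal (\<bar>F i x - f x\<bar> powr k) \<partial>M) \<longlonglongrightarrow> 0"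
  proof (rule tendsto_zero_ennreal)
    fix r :: real assume r: "r > 0"
    have "(\<lambda>n. (A + A * A) * (K * \<rho> ^ n)) \<longlonglongrightarrow> (A + A * A) * (K * 0)"
      using \<rho> by (intro tendsto_intros LIMSEQ_power_zero) auto
    then have "\<forall>\<^sub>F n in sequentially. (A + A * A) * (K * \<rho> ^ n) < r / 2"
      using r by (intro order_tendstoD) auto
    \<comment> \<open>The level \<open>n\<close> is fixed first, making the two tails small
      uniformly in \<open>i\<close>; only then does \<open>i\<close> tend to infinity.\<close>
    from eventually_happens'[OF sequentially_bot this] obtain n where n: "(A + A * A) * (K * \<rho> ^ n) < r / 2" by blast
    have "(\<lambda>i. ennreal (A * A) * (\<integral>\<^sup>+x. ennreal (\<bar>U i n x - G n x\<bar> powr k) \<partial>M)) \<longlonglongrightarrow> ennreal (A * A) * 0"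
      by (intro ennreal_tendsto_cmult UG_int) auto
    then have "\<forall>\<^sub>F i in sequentially. ennreal (A * A) * (\<integral>\<^sup>+x. ennreal (\<bar>U i n x - G n x\<bar> powr k) \<partial>M) < ennreal (r / 2)"
      using r by (intro order_tendstoD) auto
    then show "\<forall>\<^sub>F i in sequentially. (\<integral>\<^sup>+x. ennreal (\<bar>F i x - f x\<bar> powr k) \<partial>M) < ennreal r"
    proof eventually_elim
      case (elim i)
      have "(\<integral>\<^sup>+x. ennreal (\<bar>F i x - f x\<bar> powr k) \<partial>M)
        \<le> ennreal (r / 2) + ennreal (A * A) * (\<integral>\<^sup>+x. ennreal (\<bar>U i n x - G n x\<bar> powr k) \<partial>M)"
        using main[of i n] n by (meson add_right_mono ennreal_leI less_imp_le order_trans)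
      also have "\<dots> < ennreal (r / 2) + ennreal (r / 2)"
        using elim by (simp add: ennreal_add_left_cancel_less)
      also have "\<dots> = ennreal r" using r by (simp add: ennreal_plus[symmetric] del: ennreal_plus)
      finally show ?case .
    qed
  qed
  then show "\<exists>f\<in>borel_measurable M. (\<lambda>i. \<integral>\<^sup>+x. ennreal (\<bar>F i x - f x\<bar> powr k) \<partial>M) \<longlonglongrightarrow> 0"
    by (intro bexI[of _ f]) auto
  show "(\<integral>\<^sup>+x. ennreal (\<bar>F i x - U i n x\<bar> powr k) \<partial>M) < \<infinity>"
    using lim[OF U step UF, of i n] by (rule le_less_trans) simp
qed

text \<open>The series of the p-th powers has a finite integral, hence converges almost everywhere,
  and the terms of a convergent series tend to 0.\<close>

lemma AE_tendsto_0_of_geometric: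
  fixes g :: "nat \<Rightarrow> 'a \<Rightarrow> real"
  assumes p: "0 < p" and \<rho>: "0 < \<rho>" "\<rho> < 1" and C: "0 \<le> C"
    and [measurable]: "\<And>n. g n \<in> borel_measurable M"
    and bound: "\<And>n. (\<integral>\<^sup>+x. ennreal (\<bar>g n x\<bar> powr p) \<partial>M) \<le> ennreal (C * \<rho> ^ n)"
  shows "AE x in M. (\<lambda>n. g n x) \<longlonglongrightarrow> 0"
proof -
  have "(\<integral>\<^sup>+x. (\<Sum>n. ennreal (\<bar>g n x\<bar> powr p)) \<partial>M) = (\<Sum>n. \<integral>\<^sup>+x. ennreal (\<bar>g n x\<bar> powr p) \<partial>M)"
    by (rule nn_integral_suminf) auto
  also have "\<dots> \<le> (\<Sum>n. ennreal (C * \<rho> ^ n))"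
    by (intro suminf_le bound summableI)
  also have "\<dots> < \<infinity>"
    using \<rho> C by (subst suminf_ennreal2) (auto intro!: summable_mult summable_geometric)
  finally have "AE x in M. (\<Sum>n. ennreal (\<bar>g n x\<bar> powr p)) \<noteq> \<infinity>"
    by (intro nn_integral_noteq_infinite) auto
  then show ?thesis
  proof eventually_elim
    case (elim x)
    then have "summable (\<lambda>n. \<bar>g n x\<bar> powr p)"
      by (intro summable_suminf_not_top) auto
    then have "(\<lambda>n. \<bar>g n x\<bar> powr p) \<longlonglongrightarrow> 0" by (rule summable_LIMSEQ_zero)
    then have "(\<lambda>n. (\<bar>g n x\<bar> powr p) powr (1 / p)) \<longlonglongrightarrow> 0 powr (1 / p)"
      using p by (intro tendsto_powr' tendsto_const) auto
    then have "(\<lambda>n. \<bar>g n x\<bar>) \<longlonglongrightarrow> 0" using p by (simp add: powr_powr)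
    then show ?case by (simp add: tendsto_rabs_zero_iff)
  qed
qed

text \<open>Below the threshold \<eta> the first term dominates, above it the second, as
  \<open>x powr (k - q)\<close> is decreasing. On a finite measure space this takes the place of
  Hoelder's inequality in passing from exponent \<open>q\<close> to a smaller exponent
  \<open>k\<close>.\<close>

lemma powr_le_interpolate:
  fixes x \<eta> k q :: real
  assumes "0 < k" "k \<le> q" "0 < \<eta>" "0 \<le> x"
  shows "x powr k \<le> \<eta> powr k + \<eta> powr (k - q) * x powr q"
proof (cases "x \<le> \<eta>")
  case True
  then have "x powr k \<le> \<eta> powr k" using assms by (intro powr_mono2) auto
  then show ?thesis by (simp add: add_increasing2)
next
  case False
  then have x: "0 < x" using assms by simp
  have "x powr k = x powr (k - q) * x powr q" using x by (simp add: powr_add[symmetric])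
  also have "\<dots> \<le> \<eta> powr (k - q) * x powr q"
    using False assms by (intro mult_right_mono powr_mono2') auto
  finally show ?thesis by (simp add: add_increasing)
qed

lemma nn_integral_powr_interpolate:
  assumes "0 < k" "k \<le> q" "0 < \<eta>" and [measurable]: "g \<in> borel_measurable M"
  shows "(\<integral>\<^sup>+x. ennreal (\<bar>g x\<bar> powr k) \<partial>M)
    \<le> ennreal (\<eta> powr k) * emeasure M (space M) + ennreal (\<eta> powr (k - q)) * (\<integral>\<^sup>+x. ennreal (\<bar>g x\<bar> powr q) \<partial>M)"
proof -
  have "(\<integral>\<^sup>+x. ennreal (\<bar>g x\<bar> powr k) \<partial>M)
      \<le> (\<integral>\<^sup>+x. ennreal (\<eta> powr k) + ennreal (\<eta> powr (k - q)) * ennreal (\<bar>g x\<bar> powr q) \<partial>M)"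
    using powr_le_interpolate[OF assms(1-3)]
    by (intro nn_integral_mono) (simp add: ennreal_mult[symmetric] ennreal_plus[symmetric] ennreal_leI del: ennreal_plus)
  also have "\<dots> = ennreal (\<eta> powr k) * emeasure M (space M) + ennreal (\<eta> powr (k - q)) * (\<integral>\<^sup>+x. ennreal (\<bar>g x\<bar> powr q) \<partial>M)"
    by (subst nn_integral_add) (auto simp: nn_integral_cmult)
  finally show ?thesis .
qed

lemma nn_integral_powr_tendsto_0_mono:
  assumes M: "finite_measure M" and kq: "0 < k" "k \<le> q" and [measurable]: "\<And>i. g i \<in> borel_measurable M"
    and lim: "((\<lambda>i. \<integral>\<^sup>+x. ennreal (\<bar>g i x\<bar> powr q) \<partial>M) \<longlongrightarrow> 0) F"
  shows "((\<lambda>i. \<integral>\<^sup>+x. ennreal (\<bar>g i x\<bar> powr k) \<partial>M) \<longlongrightarrow> 0) F"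
proof (rule tendsto_zero_ennreal)
  fix r :: real assume r: "0 < r"
  define \<mu> where "\<mu> = measure M (space M)"
  have \<mu>: "emeasure M (space M) = ennreal \<mu>" "0 \<le> \<mu>"
    using M by (simp_all add: \<mu>_def finite_measure.emeasure_eq_measure)
  \<comment> \<open>Chosen so that the contribution of the threshold is at most
    \<open>r / 2\<close>; \<open>\<mu> + 1\<close> keeps the quotient defined on a null
    space.\<close>
  define \<eta> where "\<eta> = (r / (2 * (\<mu> + 1))) powr (1 / k)"
  have \<eta>: "0 < \<eta>" "\<eta> powr k = r / (2 * (\<mu> + 1))"
    using r \<mu> kq by (simp_all add: \<eta>_def powr_powr)
  have "r / (2 * (\<mu> + 1)) * \<mu> \<le> r / 2" using r \<mu> by (simp add: field_simps)
  then have first: "ennreal (\<eta> powr k) * emeasure M (space M) \<le> ennreal (r / 2)"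
    using r \<mu> by (simp add: \<eta> ennreal_mult[symmetric] ennreal_leI)
  have "((\<lambda>i. ennreal (\<eta> powr (k - q)) * (\<integral>\<^sup>+x. ennreal (\<bar>g i x\<bar> powr q) \<partial>M)) \<longlongrightarrow> ennreal (\<eta> powr (k - q)) * 0) F"
    by (intro ennreal_tendsto_cmult lim) auto
  then have "\<forall>\<^sub>F i in F. ennreal (\<eta> powr (k - q)) * (\<integral>\<^sup>+x. ennreal (\<bar>g i x\<bar> powr q) \<partial>M) < ennreal (r / 2)"
    using r by (intro order_tendstoD) auto
  then show "\<forall>\<^sub>F i in F. (\<integral>\<^sup>+x. ennreal (\<bar>g i x\<bar> powr k) \<partial>M) < ennreal r"
  proof eventually_elim
    case (elim i)
    have "(\<integral>\<^sup>+x. ennreal (\<bar>g i x\<bar> powr k) \<partial>M)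
        \<le> ennreal (r / 2) + ennreal (\<eta> powr (k - q)) * (\<integral>\<^sup>+x. ennreal (\<bar>g i x\<bar> powr q) \<partial>M)"
      using nn_integral_powr_interpolate[OF kq \<eta>(1), of "g i" M] first
      by (meson add_right_mono order_trans \<open>\<And>i. g i \<in> borel_measurable M\<close>)
    also have "\<dots> < ennreal (r / 2) + ennreal (r / 2)"
      using elim by (simp add: ennreal_add_left_cancel_less)
    also have "\<dots> = ennreal r" using r by (simp add: ennreal_plus[symmetric] del: ennreal_plus)
    finally show ?case .
  qed
qed

lemma geometric_chain_limit:
  fixes a :: "nat \<Rightarrow> real"
  assumes step: "\<And>n. \<bar>a (Suc n) - a n\<bar> \<le> B * \<sigma> ^ n" and \<sigma>: "0 < \<sigma>" "\<sigma> < 1" and B: "0 \<le> B"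
  shows "a \<longlonglongrightarrow> lim a" and "\<bar>lim a - a n\<bar> \<le> B / (1 - \<sigma>) * \<sigma> ^ n"
proof -
  have tail: "\<bar>a (n + d) - a n\<bar> \<le> B / (1 - \<sigma>) * \<sigma> ^ n" for n d
  proof (induction d arbitrary: n)
    case 0
    then show ?case using \<sigma> B by simp
  next
    case (Suc d)
    have "\<bar>a (n + Suc d) - a n\<bar> \<le> \<bar>a (Suc n + d) - a (Suc n)\<bar> + \<bar>a (Suc n) - a n\<bar>" by simp
    also have "\<dots> \<le> B / (1 - \<sigma>) * \<sigma> ^ Suc n + B * \<sigma> ^ n"
      by (intro add_mono Suc step)
    also have "\<dots> = B / (1 - \<sigma>) * \<sigma> ^ n * (\<sigma> + (1 - \<sigma>))"
      using \<sigma> by (simp add: field_simps)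
    finally show ?case by simp
  qed
  have "summable (\<lambda>n. B * \<sigma> ^ n)" using \<sigma> by (intro summable_mult summable_geometric) simp
  then have "summable (\<lambda>n. a (Suc n) - a n)"
    by (rule summable_comparison_test'[of _ 0]) (use step in simp)
  then have "convergent (\<lambda>n. \<Sum>i<n. a (Suc i) - a i)" by (simp add: summable_iff_convergent)
  then have "convergent (\<lambda>n. (a n - a 0) + a 0)"
    by (intro convergent_add) (auto simp: sum_lessThan_telescope convergent_const)
  then show conv: "a \<longlonglongrightarrow> lim a" by (simp add: convergent_LIMSEQ_iff)
  have "(\<lambda>d. \<bar>a (n + d) - a n\<bar>) \<longlonglongrightarrow> \<bar>lim a - a n\<bar>"
    using LIMSEQ_ignore_initial_segment[OF conv, of n]
    by (intro tendsto_rabs tendsto_diff tendsto_const) (simp add: add.commute)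
  then show "\<bar>lim a - a n\<bar> \<le> B / (1 - \<sigma>) * \<sigma> ^ n"
    by (rule LIMSEQ_le_const2) (use tail in blast)
qed

section \<open>Dyadic averages on an interval\<close>

text \<open>Capping the index puts the right endpoint \<open>L\<close> into the last cell, so that every point of
  \<open>{0..L}\<close> lies in a cell of length \<open>L / 2 ^ n\<close>.\<close>

definition cell_index :: "real \<Rightarrow> nat \<Rightarrow> real \<Rightarrow> nat" where
  "cell_index L n t = min (nat \<lfloor>2 ^ n * t / L\<rfloor>) (2 ^ n - 1)"

definition dyadic_cell :: "real \<Rightarrow> nat \<Rightarrow> nat \<Rightarrow> real set" where
  "dyadic_cell L n j = {t \<in> {0..L}. cell_index L n t = j}"

lemma cell_index_less: "cell_index L n t < 2 ^ n"
  unfolding cell_index_def by (rule le_less_trans[OF min.cobounded2]) simp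

lemma measurable_cell_index: "cell_index L n \<in> measurable (lebesgue_on {0..L}) (count_space UNIV)"
proof -
  have "cell_index L n \<in> measurable borel (count_space UNIV)"
    unfolding cell_index_def by measurable
  then show ?thesis
    by (metis measurable_completion measurable_lborel2 measurable_restrict_space1)
qed

lemma dyadic_cell_sets: "dyadic_cell L n j \<in> sets (lebesgue_on {0..L})"
proof -
  have "cell_index L n -` {j} \<inter> space (lebesgue_on {0..L}) \<in> sets (lebesgue_on {0..L})"
    using measurable_cell_index by (rule measurable_sets) simp
  also have "cell_index L n -` {j} \<inter> space (lebesgue_on {0..L}) = dyadic_cell L n j"
    by (auto simp: dyadic_cell_def)
  finally show ?thesis .
qed

text \<open>Together with \<open>dyadic_cell_lower\<close> this determines a cell up to its
  endpoints, which gives its measure and bounds its diameter while treating the closed last cell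
  like the half-open others.\<close>

lemma dyadic_cell_upper:
  assumes L: "0 < L"
  shows "dyadic_cell L n j \<subseteq> {real j * (L / 2 ^ n)..(real j + 1) * (L / 2 ^ n)}"
proof
  fix t assume "t \<in> dyadic_cell L n j"
  then have t: "0 \<le> t" "t \<le> L" and j: "cell_index L n t = j" by (auto simp: dyadic_cell_def)
  define x where "x = 2 ^ n * t / L"
  have x: "0 \<le> x" "x \<le> 2 ^ n" using t L by (auto simp: x_def field_simps)
  have jm: "j = min (nat \<lfloor>x\<rfloor>) (2 ^ n - 1)" using j by (simp add: cell_index_def x_def)
  have "real (nat \<lfloor>x\<rfloor>) \<le> x" using x by simp
  then have "real j \<le> x" using jm by linarith
  moreover have "x \<le> real j + 1"
  proof (cases "nat \<lfloor>x\<rfloor> \<le> 2 ^ n - 1")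
    case True
    then have "j = nat \<lfloor>x\<rfloor>" using jm by simp
    then show ?thesis using x by linarith
  next
    case False
    then have "j = 2 ^ n - 1" using jm by simp
    then have "real j + 1 = 2 ^ n" by (simp add: of_nat_diff)
    then show ?thesis using x by simp
  qed
  ultimately show "t \<in> {real j * (L / 2 ^ n)..(real j + 1) * (L / 2 ^ n)}"
    using L by (auto simp: x_def field_simps)
qed

lemma dyadic_cell_lower:
  assumes L: "0 < L" and j: "j < 2 ^ n"
  shows "{real j * (L / 2 ^ n)<..<(real j + 1) * (L / 2 ^ n)} \<subseteq> dyadic_cell L n j"
proof
  fix t assume t: "t \<in> {real j * (L / 2 ^ n)<..<(real j + 1) * (L / 2 ^ n)}"
  define x where "x = 2 ^ n * t / L"
  have x: "real j < x" "x < real j + 1" using t L by (auto simp: x_def field_simps)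
  then have "\<lfloor>x\<rfloor> = int j" by linarith
  then have "cell_index L n t = j" using j by (simp add: cell_index_def x_def)
  moreover have "0 < t" using x L by (simp add: x_def zero_less_mult_iff zero_less_divide_iff)
    (smt (verit) of_nat_0_le_iff divide_nonpos_pos mult_nonneg_nonpos zero_le_power)
  moreover have "t \<le> L"
  proof -
    have "real j + 1 \<le> 2 ^ n" using j by (metis Suc_leI add.commute of_nat_Suc of_nat_le_iff of_nat_numeral of_nat_power)
    then have "x \<le> 2 ^ n" using x by simp
    then show ?thesis using L by (simp add: x_def field_simps)
  qed
  ultimately show "t \<in> dyadic_cell L n j" by (simp add: dyadic_cell_def)
qed

lemma measure_dyadic_cell:
  assumes L: "0 < L" and j: "j < 2 ^ n"
  shows "measure (lebesgue_on {0..L}) (dyadic_cell L n j) = L / 2 ^ n"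
proof -
  let ?a = "real j * (L / 2 ^ n)" and ?b = "(real j + 1) * (L / 2 ^ n)"
  have ab: "?b - ?a = L / 2 ^ n" "?a \<le> ?b" using L by (simp_all add: distrib_right add_divide_distrib)
  have sub: "dyadic_cell L n j \<subseteq> {0..L}" by (auto simp: dyadic_cell_def)
  have S: "dyadic_cell L n j \<in> sets lebesgue"
    using dyadic_cell_sets[of L n j] by (auto simp: sets_restrict_space intro!: sets.Int)
  have "measure lebesgue (dyadic_cell L n j) \<le> measure lebesgue {?a..?b}"
    using dyadic_cell_upper[OF L] S by (intro measure_mono_fmeasurable) auto
  moreover have "measure lebesgue {?a<..<?b} \<le> measure lebesgue (dyadic_cell L n j)"
    using dyadic_cell_lower[OF L j] S sub
    by (intro measure_mono_fmeasurable) (auto intro: fmeasurableI2[of "{0..L}"])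
  ultimately have "measure lebesgue (dyadic_cell L n j) = L / 2 ^ n"
    using ab by simp
  then show ?thesis using sub by (simp add: measure_restrict_space)
qed

lemma dyadic_cell_diam:
  assumes "0 < L" "s \<in> dyadic_cell L n j" "t \<in> dyadic_cell L n j"
  shows "\<bar>s - t\<bar> \<le> L / 2 ^ n"
proof -
  have "s \<in> {real j * (L / 2 ^ n)..(real j + 1) * (L / 2 ^ n)}" "t \<in> {real j * (L / 2 ^ n)..(real j + 1) * (L / 2 ^ n)}"
    using dyadic_cell_upper[OF assms(1)] assms(2,3) by blast+
  then show ?thesis unfolding distrib_right by auto
qed

lemma mem_dyadic_cell_index: "t \<in> {0..L} \<Longrightarrow> t \<in> dyadic_cell L n (cell_index L n t)"
  by (simp add: dyadic_cell_def)

definition dyadic_average :: "real \<Rightarrow> (real \<Rightarrow> real) \<Rightarrow> nat \<Rightarrow> nat \<Rightarrow> real" where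
  "dyadic_average L u n j = average (lebesgue_on {0..L}) (dyadic_cell L n j) u"

lemma measurable_cell_index_comp:
  "(\<lambda>t. a (cell_index L n t)) \<in> borel_measurable (lebesgue_on {0..L})" for a :: "nat \<Rightarrow> real"
  using measurable_compose[OF measurable_cell_index, of a borel] by simp

lemma finite_measure_interval: "finite_measure (lebesgue_on {0..L::real})"
  by (rule finite_measure_lebesgue_on) simp

lemma set_integrable_dyadic_cell:
  fixes u :: "real \<Rightarrow> real"
  assumes "integrable (lebesgue_on {0..L}) u"
  shows "set_integrable (lebesgue_on {0..L}) (dyadic_cell L n j) u"
  unfolding set_integrable_def using assms dyadic_cell_sets by (rule integrable_mult_indicator[rotated])

text \<open>Jensen's inequality is used in the inner variable alone, over the cell of
  \<open>s\<close> and with \<open>u s\<close> as the constant; the outer integral remains and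
  becomes the integral of the error. The factor \<open>2 ^ n / L\<close> is the inverse of the
  measure of a cell.\<close>

lemma nn_integral_diff_dyadic_average_le:
  assumes p: "1 \<le> p" and L: "0 < L" and u: "integrable (lebesgue_on {0..L}) u"
    and b: "0 < b" and E: "0 \<le> E"
    and \<kappa>: "\<And>s t. s \<in> {0..L} \<Longrightarrow> t \<in> {0..L} \<Longrightarrow> \<bar>s - t\<bar> \<le> L / 2 ^ n \<Longrightarrow> ennreal (b * \<bar>u s - u t\<bar> powr p) \<le> \<kappa> s t"
    and bound: "(\<integral>\<^sup>+s. (\<integral>\<^sup>+t. \<kappa> s t \<partial>lebesgue_on {0..L}) \<partial>lebesgue_on {0..L}) \<le> ennreal E"
  shows "(\<integral>\<^sup>+s. ennreal (\<bar>u s - dyadic_average L u n (cell_index L n s)\<bar> powr p) \<partial>lebesgue_on {0..L})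
    \<le> ennreal (E * 2 ^ n / (b * L))"
proof -
  let ?M = "lebesgue_on {0..L}" and ?X = "\<lambda>s. \<bar>u s - dyadic_average L u n (cell_index L n s)\<bar> powr p"
  have [measurable]: "u \<in> borel_measurable ?M" using u by auto
  have [measurable]: "(\<lambda>s. dyadic_average L u n (cell_index L n s)) \<in> borel_measurable ?M"
    by (rule measurable_cell_index_comp)
  have c: "0 < b * L / 2 ^ n" using b L by simp
  have "ennreal (b * L / 2 ^ n) * (\<integral>\<^sup>+s. ennreal (?X s) \<partial>?M) = (\<integral>\<^sup>+s. ennreal (b * L / 2 ^ n) * ennreal (?X s) \<partial>?M)"
    by (rule nn_integral_cmult[symmetric]) measurable
  also have "\<dots> \<le> (\<integral>\<^sup>+s. (\<integral>\<^sup>+t. \<kappa> s t \<partial>?M) \<partial>?M)"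
  proof (rule nn_integral_mono)
    fix s assume "s \<in> space ?M"
    then have s: "s \<in> {0..L}" by simp
    have "ennreal (b * (measure ?M (dyadic_cell L n (cell_index L n s)) * ?X s)) \<le> (\<integral>\<^sup>+t. \<kappa> s t \<partial>?M)"
      unfolding dyadic_average_def
    proof (rule jensen_average_kernel[OF p dyadic_cell_sets])
      fix t assume t: "t \<in> dyadic_cell L n (cell_index L n s)"
      then show "ennreal (b * \<bar>u s - u t\<bar> powr p) \<le> \<kappa> s t"
        using s dyadic_cell_diam[OF L mem_dyadic_cell_index[OF s] t]
        by (intro \<kappa>) (auto simp: dyadic_cell_def)
    qed (use b L u measure_dyadic_cell[OF L cell_index_less] set_integrable_dyadic_cell in auto)
    then show "ennreal (b * L / 2 ^ n) * ennreal (?X s) \<le> (\<integral>\<^sup>+t. \<kappa> s t \<partial>?M)"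
      using c measure_dyadic_cell[OF L cell_index_less] by (simp add: ennreal_mult[symmetric] mult_ac)
  qed
  also have "\<dots> \<le> ennreal E" by (rule bound)
  finally have *: "ennreal (b * L / 2 ^ n) * (\<integral>\<^sup>+s. ennreal (?X s) \<partial>?M) \<le> ennreal E" .
  have "(\<integral>\<^sup>+s. ennreal (?X s) \<partial>?M) = ennreal (2 ^ n / (b * L)) * (ennreal (b * L / 2 ^ n) * (\<integral>\<^sup>+s. ennreal (?X s) \<partial>?M))"
    using b L by (simp add: mult.assoc[symmetric] ennreal_mult[symmetric])
  also have "\<dots> \<le> ennreal (2 ^ n / (b * L)) * ennreal E"
    by (intro mult_left_mono *) auto
  also have "\<dots> = ennreal (E * 2 ^ n / (b * L))"
    using b L E by (simp add: ennreal_mult[symmetric] mult.commute)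
  finally show ?thesis .
qed

lemma dyadic_average_diff_powr_le:
  assumes p: "1 \<le> p" and L: "0 < L" "integrable (lebesgue_on {0..L}) u" "i < 2 ^ m"
    and L': "0 < L'" "integrable (lebesgue_on {0..L'}) v" "j < 2 ^ n"
    and b: "0 \<le> b" and E: "0 \<le> E"
    and \<kappa>: "\<And>s t. s \<in> dyadic_cell L m i \<Longrightarrow> t \<in> dyadic_cell L' n j \<Longrightarrow>
      ennreal (b * \<bar>u s - v t\<bar> powr p) \<le> \<kappa> s t"
    and bound: "(\<integral>\<^sup>+s. (\<integral>\<^sup>+t. \<kappa> s t \<partial>lebesgue_on {0..L'}) \<partial>lebesgue_on {0..L}) \<le> ennreal E"
  shows "b * (L / 2 ^ m * (L' / 2 ^ n) * \<bar>dyadic_average L u m i - dyadic_average L' v n j\<bar> powr p) \<le> E"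
proof -
  have "ennreal (b * (measure (lebesgue_on {0..L}) (dyadic_cell L m i) * measure (lebesgue_on {0..L'}) (dyadic_cell L' n j) *
      \<bar>dyadic_average L u m i - dyadic_average L' v n j\<bar> powr p)) \<le> ennreal E"
    unfolding dyadic_average_def
    by (rule order_trans[OF average_diff_powr_le[where \<kappa> = \<kappa>] bound])
      (use p L L' b \<kappa> measure_dyadic_cell[OF L(1,3)] measure_dyadic_cell[OF L'(1,3)] dyadic_cell_sets set_integrable_dyadic_cell in auto)
  then show ?thesis
    using E by (simp add: measure_dyadic_cell L L')
qed

text \<open>Away from the endpoints a graph point determines its edge and its parameter. Data given
  edge by edge thus define a function on the graph up to a null set.\<close>

lemma AE_interval_not_endpoint:
  "AE t in lebesgue_on {0..L::real}. t \<noteq> 0 \<and> t \<noteq> L"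
proof -
  have "{0, L} \<in> null_sets lebesgue"
    by (simp add: negligible_iff_null_sets[symmetric] negligible_finite)
  then have "AE t in lebesgue. t \<notin> {0, L}" by (rule AE_not_in)
  then show ?thesis by (subst AE_restrict_space_iff) (auto elim: eventually_mono)
qed

text \<open>Jensen's inequality with the constant 0. The bound depends on the level but not on the
  function, as needed for extracting a subsequence along which every average converges.\<close>

lemma abs_dyadic_average_le:
  assumes p: "1 \<le> p" and L: "0 < L" and u: "integrable (lebesgue_on {0..L}) u" and j: "j < 2 ^ n"
    and E: "0 \<le> E" "(\<integral>\<^sup>+ t. ennreal (\<bar>u t\<bar> powr p) \<partial>lebesgue_on {0..L}) \<le> ennreal E"
  shows "\<bar>dyadic_average L u n j\<bar> \<le> (E * 2 ^ n / L) powr (1 / p)"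
proof -
  have "ennreal (1 * (measure (lebesgue_on {0..L}) (dyadic_cell L n j) * \<bar>0 - dyadic_average L u n j\<bar> powr p))
      \<le> (\<integral>\<^sup>+ t. ennreal (\<bar>u t\<bar> powr p) \<partial>lebesgue_on {0..L})"
    unfolding dyadic_average_def
    by (rule jensen_average_kernel[OF p dyadic_cell_sets])
      (use L u j measure_dyadic_cell[OF L j] set_integrable_dyadic_cell in auto)
  also note E(2)
  finally have "L / 2 ^ n * \<bar>dyadic_average L u n j\<bar> powr p \<le> E"
    using E by (simp add: measure_dyadic_cell[OF L j])
  then have "\<bar>dyadic_average L u n j\<bar> powr p \<le> E * 2 ^ n / L"
    using L by (simp add: field_simps)
  then have "(\<bar>dyadic_average L u n j\<bar> powr p) powr (1 / p) \<le> (E * 2 ^ n / L) powr (1 / p)"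
    using p by (intro powr_mono2) auto
  then show ?thesis using p by (simp add: powr_powr)
qed

section \<open>Suprema of absolute values\<close>

lemma cSUP_abs_add_le:
  fixes u v :: "'a \<Rightarrow> real"
  assumes "I \<noteq> {}" "bdd_above ((\<lambda>i. \<bar>u i\<bar>) ` I)" "bdd_above ((\<lambda>i. \<bar>v i\<bar>) ` I)"
    and w: "\<And>i. i \<in> I \<Longrightarrow> w i = u i + v i"
  shows "(SUP i\<in>I. \<bar>w i\<bar>) \<le> (SUP i\<in>I. \<bar>u i\<bar>) + (SUP i\<in>I. \<bar>v i\<bar>)"
proof (rule cSUP_least)
  fix i assume i: "i \<in> I"
  have "\<bar>w i\<bar> \<le> \<bar>u i\<bar> + \<bar>v i\<bar>" using w[OF i] by simp
  also have "\<dots> \<le> (SUP i\<in>I. \<bar>u i\<bar>) + (SUP i\<in>I. \<bar>v i\<bar>)"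
    using i assms by (intro add_mono cSUP_upper)
  finally show "\<bar>w i\<bar> \<le> (SUP i\<in>I. \<bar>u i\<bar>) + (SUP i\<in>I. \<bar>v i\<bar>)" .
qed (rule assms)

lemma bdd_above_abs_diff:
  fixes u v :: "'a \<Rightarrow> real"
  assumes "bdd_above ((\<lambda>i. \<bar>u i\<bar>) ` I)" "bdd_above ((\<lambda>i. \<bar>v i\<bar>) ` I)"
    and w: "\<And>i. i \<in> I \<Longrightarrow> w i = u i - v i"
  shows "bdd_above ((\<lambda>i. \<bar>w i\<bar>) ` I)"
proof -
  obtain a b where "\<And>i. i \<in> I \<Longrightarrow> \<bar>u i\<bar> \<le> a" "\<And>i. i \<in> I \<Longrightarrow> \<bar>v i\<bar> \<le> b"
    using assms(1,2) by (auto simp: bdd_above_def)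
  then have "\<bar>w i\<bar> \<le> a + b" if "i \<in> I" for i using that w[OF that] by (smt (verit))
  then show ?thesis by (auto simp: bdd_above_def)
qed

section \<open>Averages on the edges of a metric graph\<close>

context compact_metric_graph
begin

lemma mg_dist_edge_pt_le:
  assumes "e \<in> arcs G" "s \<in> {0..l e}" "t \<in> {0..l e}"
  shows "mg_dist G l (edge_pt G l e s) (edge_pt G l e t) \<le> \<bar>s - t\<bar>"
  using mg_dist_le[of "edge_pt G l e s" "edge_pt G l e t" "[(e, s, t)]"] assms edge_pt_in_mg_space
  by (simp add: path_len_def abs_minus_commute)

lemma length_bounds:
  obtains a b where "0 < a" "0 < b" "\<And>e. e \<in> arcs G \<Longrightarrow> a \<le> l e \<and> l e \<le> b"
proof
  \<comment> \<open>Inserting 1 makes the minimum and maximum meaningful for a graph without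
    edges.\<close>
  show "0 < Min (insert 1 (l ` arcs G))" "0 < Max (insert 1 (l ` arcs G))"
    using length_pos by (auto simp: Max_gr_iff)
qed auto

lemma Lebesgue_space_edge_measurable:
  "f \<in> fst (Lebesgue_space G l p) \<Longrightarrow> e \<in> arcs G \<Longrightarrow>
    (\<lambda>t. f (edge_pt G l e t)) \<in> borel_measurable (lebesgue_on {0..l e})"
  by (simp add: Lebesgue_space_def)

lemma mg_nn_integral_edge_le:
  assumes "e \<in> arcs G"
  shows "(\<integral>\<^sup>+ t. F (edge_pt G l e t) \<partial>lebesgue_on {0..l e}) \<le> mg_nn_integral G l F"
  unfolding mg_nn_integral_def using assms by (intro member_le_sum) auto

lemma Lebesgue_space_edge_integrable:
  assumes p: "1 \<le> p" and f: "f \<in> fst (Lebesgue_space G l p)" and e: "e \<in> arcs G"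
  shows "integrable (lebesgue_on {0..l e}) (\<lambda>t. f (edge_pt G l e t))"
proof (rule integrableI_bounded)
  show [measurable]: "(\<lambda>t. f (edge_pt G l e t)) \<in> borel_measurable (lebesgue_on {0..l e})"
    using f e by (rule Lebesgue_space_edge_measurable)
  have "(\<integral>\<^sup>+ t. ennreal (norm (f (edge_pt G l e t))) \<partial>lebesgue_on {0..l e})
      \<le> (\<integral>\<^sup>+ t. 1 + ennreal (\<bar>f (edge_pt G l e t)\<bar> powr p) \<partial>lebesgue_on {0..l e})"
  proof (rule nn_integral_mono)
    fix t
    have "x \<le> 1 + x powr p" if "0 \<le> x" for x :: real
    proof (cases "x \<le> 1")
      case True
      then show ?thesis by (simp add: add_increasing2)
    next
      case False
      then show ?thesis using powr_mono[of 1 p x] p by simp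
    qed
    then have "ennreal (norm (f (edge_pt G l e t))) \<le> ennreal (1 + \<bar>f (edge_pt G l e t)\<bar> powr p)"
      by (intro ennreal_leI) simp
    then show "ennreal (norm (f (edge_pt G l e t))) \<le> 1 + ennreal (\<bar>f (edge_pt G l e t)\<bar> powr p)"
      by simp
  qed
  also have "\<dots> = emeasure (lebesgue_on {0..l e}) {0..l e}
      + (\<integral>\<^sup>+ t. ennreal (\<bar>f (edge_pt G l e t)\<bar> powr p) \<partial>lebesgue_on {0..l e})"
    by (subst nn_integral_add) auto
  also have "\<dots> < \<infinity>"
  proof -
    have "emeasure (lebesgue_on {0..l e}) {0..l e} < \<infinity>"
      using finite_measure.emeasure_finite[OF finite_measure_interval] by (simp add: less_top)
    moreover have "(\<integral>\<^sup>+ t. ennreal (\<bar>f (edge_pt G l e t)\<bar> powr p) \<partial>lebesgue_on {0..l e}) < \<infinity>"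
      using f mg_nn_integral_edge_le[OF e, of "\<lambda>x. ennreal (\<bar>f x\<bar> powr p)"]
      by (auto simp: Lebesgue_space_def intro: le_less_trans)
    ultimately show ?thesis by simp
  qed
  finally show "(\<integral>\<^sup>+ t. ennreal (norm (f (edge_pt G l e t))) \<partial>lebesgue_on {0..l e}) < \<infinity>" .
qed

section \<open>Lower bounds for the fractional kernel\<close>

definition frac_kernel :: "real \<Rightarrow> real \<Rightarrow> (('v, 'e) mg_point \<Rightarrow> real) \<Rightarrow> ('v, 'e) mg_point \<Rightarrow> ('v, 'e) mg_point \<Rightarrow> ennreal" where
  "frac_kernel \<alpha> p f x y = ennreal (\<bar>f x - f y\<bar> powr p / mg_dist G l x y powr (1 + \<alpha> * p))"

lemma frac_kernel_integral_le:
  assumes "e \<in> arcs G" "e' \<in> arcs G"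
  shows "(\<integral>\<^sup>+ s. (\<integral>\<^sup>+ t. frac_kernel \<alpha> p f (edge_pt G l e s) (edge_pt G l e' t) \<partial>lebesgue_on {0..l e'}) \<partial>lebesgue_on {0..l e})
    \<le> frac_seminorm_pow G l \<alpha> p f"
proof -
  have "(\<integral>\<^sup>+ s. (\<integral>\<^sup>+ t. frac_kernel \<alpha> p f (edge_pt G l e s) (edge_pt G l e' t) \<partial>lebesgue_on {0..l e'}) \<partial>lebesgue_on {0..l e})
    \<le> (\<integral>\<^sup>+ s. mg_nn_integral G l (frac_kernel \<alpha> p f (edge_pt G l e s)) \<partial>lebesgue_on {0..l e})"
    using assms by (intro nn_integral_mono mg_nn_integral_edge_le)
  also have "\<dots> \<le> frac_seminorm_pow G l \<alpha> p f"
    using mg_nn_integral_edge_le[OF assms(1), of "\<lambda>x. mg_nn_integral G l (frac_kernel \<alpha> p f x)"]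
    by (simp add: frac_seminorm_pow_def frac_kernel_def[abs_def])
  finally show ?thesis .
qed

lemma frac_kernel_ge:
  assumes x: "x \<in> mg_space G l" and y: "y \<in> mg_space G l" and R: "0 < R" "mg_dist G l x y \<le> R"
    and p: "1 \<le> p" "0 < \<alpha>"
  shows "ennreal (inverse (R powr (1 + \<alpha> * p)) * \<bar>f x - f y\<bar> powr p) \<le> frac_kernel \<alpha> p f x y"
proof (cases "x = y")
  case True
  then show ?thesis using p by simp
next
  case False
  \<comment> \<open>Positivity matters because the kernel would otherwise be a division by zero,
    that is 0, and bound nothing.\<close>
  then have d: "0 < mg_dist G l x y" using x y by (rule mg_dist_pos[rotated 2])
  then have "mg_dist G l x y powr (1 + \<alpha> * p) \<le> R powr (1 + \<alpha> * p)"
    using R p by (intro powr_mono2) auto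
  then have "\<bar>f x - f y\<bar> powr p / R powr (1 + \<alpha> * p) \<le> \<bar>f x - f y\<bar> powr p / mg_dist G l x y powr (1 + \<alpha> * p)"
    using R d by (intro divide_left_mono) auto
  then show ?thesis
    by (auto simp: frac_kernel_def divide_inverse mult.commute intro!: ennreal_leI)
qed

text \<open>The graph distance never exceeds the distance along the edge, so the graph kernel is the
  larger one. Hence the sum inside the Sobolev norm is finite; \<open>enn2real\<close> does not
  collapse it to 0, and a bound on the norm controls every summand.\<close>

lemma edge_frac_seminorm_pow_le:
  assumes p: "1 \<le> p" "0 < \<alpha>" and e: "e \<in> arcs G"
  shows "edge_frac_seminorm_pow G l \<alpha> p e f \<le> frac_seminorm_pow G l \<alpha> p f"
proof -
  have "edge_frac_seminorm_pow G l \<alpha> p e f \<le> (\<integral>\<^sup>+ s. (\<integral>\<^sup>+ t. frac_kernel \<alpha> p f (edge_pt G l e s) (edge_pt G l e t) \<partial>lebesgue_on {0..l e}) \<partial>lebesgue_on {0..l e})"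
    unfolding edge_frac_seminorm_pow_def
  proof (intro nn_integral_mono)
    fix s t assume "s \<in> space (lebesgue_on {0..l e})" "t \<in> space (lebesgue_on {0..l e})"
    then have st: "s \<in> {0..l e}" "t \<in> {0..l e}" by simp_all
    show "ennreal (\<bar>f (edge_pt G l e s) - f (edge_pt G l e t)\<bar> powr p / \<bar>s - t\<bar> powr (1 + \<alpha> * p))
        \<le> frac_kernel \<alpha> p f (edge_pt G l e s) (edge_pt G l e t)"
    proof (cases "s = t")
      case False
      then show ?thesis
        using frac_kernel_ge[OF edge_pt_in_mg_space[OF e st(1)] edge_pt_in_mg_space[OF e st(2)], of "\<bar>s - t\<bar>" p \<alpha> f]
          mg_dist_edge_pt_le[OF e st] p by (simp add: divide_inverse mult.commute)
    qed (use p in simp)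
  qed
  also have "\<dots> \<le> frac_seminorm_pow G l \<alpha> p f" by (rule frac_kernel_integral_le[OF e e])
  finally show ?thesis .
qed

lemma Sobolev_space_bounds:
  assumes p: "1 \<le> p" "0 < \<alpha>" and f: "f \<in> fst (Sobolev_space G l \<alpha> p)" and M: "snd (Sobolev_space G l \<alpha> p) f \<le> M"
  shows "frac_seminorm_pow G l \<alpha> p f \<le> ennreal (M powr p)"
    and "e \<in> arcs G \<Longrightarrow> (\<integral>\<^sup>+ t. ennreal (\<bar>f (edge_pt G l e t)\<bar> powr p) \<partial>lebesgue_on {0..l e}) \<le> ennreal (M powr p)"
proof -
  define A where "A e = (\<integral>\<^sup>+ t. ennreal (\<bar>f (edge_pt G l e t)\<bar> powr p) \<partial>lebesgue_on {0..l e})" for e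
  define S where "S = frac_seminorm_pow G l \<alpha> p f"
  define T where "T = (\<Sum>e\<in>arcs G. A e + edge_frac_seminorm_pow G l \<alpha> p e f) + S"
  have S: "S < \<infinity>" using f by (simp add: Sobolev_space_def S_def)
  have "mg_nn_integral G l (\<lambda>x. ennreal (\<bar>f x\<bar> powr p)) < \<infinity>"
    using f by (simp add: Sobolev_space_def Lebesgue_space_def)
  then have A: "A e < \<infinity>" if "e \<in> arcs G" for e
    unfolding A_def using mg_nn_integral_edge_le[OF that, of "\<lambda>x. ennreal (\<bar>f x\<bar> powr p)"] by (rule le_less_trans[rotated])
  have "edge_frac_seminorm_pow G l \<alpha> p e f < \<infinity>" if "e \<in> arcs G" for e
    using edge_frac_seminorm_pow_le[OF p that, of f] S unfolding S_def by (rule le_less_trans)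
  then have T: "T < \<infinity>" using A S by (simp add: T_def)
  have "enn2real T powr (1 / p) \<le> M"
    using M by (simp add: Sobolev_space_def T_def S_def A_def)
  then have "(enn2real T powr (1 / p)) powr p \<le> M powr p"
    using p by (intro powr_mono2) auto
  then have "enn2real T \<le> M powr p" using p by (simp add: powr_powr)
  then have TM: "T \<le> ennreal (M powr p)"
    using T by (metis ennreal_enn2real ennreal_leI infinity_ennreal_def)
  have "S \<le> T" by (simp add: T_def)
  then show "frac_seminorm_pow G l \<alpha> p f \<le> ennreal (M powr p)" using TM by (simp add: S_def)
  assume e: "e \<in> arcs G"
  have "A e \<le> A e + edge_frac_seminorm_pow G l \<alpha> p e f" by simp
  also have "\<dots> \<le> (\<Sum>e\<in>arcs G. A e + edge_frac_seminorm_pow G l \<alpha> p e f)"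
    using e by (intro member_le_sum) auto
  also have "\<dots> \<le> T" by (simp add: T_def)
  finally show "(\<integral>\<^sup>+ t. ennreal (\<bar>f (edge_pt G l e t)\<bar> powr p) \<partial>lebesgue_on {0..l e}) \<le> ennreal (M powr p)"
    using TM by (simp add: A_def)
qed

section \<open>Averages of a Sobolev function: error and increments\<close>

abbreviation edge_average :: "(('v, 'e) mg_point \<Rightarrow> real) \<Rightarrow> 'e \<Rightarrow> nat \<Rightarrow> nat \<Rightarrow> real" where
  "edge_average f e n j \<equiv> dyadic_average (l e) (\<lambda>t. f (edge_pt G l e t)) n j"

text \<open>Inside a cell of length h the kernel is at least h^(-1 - \<alpha> p) times the p-th
  power of the difference; dividing by the measure h of the cell leaves the factor h^(\<alpha>
  p).\<close>

lemma edge_average_Lp_error: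
  assumes p: "1 \<le> p" "0 < \<alpha>" and f: "f \<in> fst (Lebesgue_space G l p)" and e: "e \<in> arcs G"
    and E: "0 \<le> E" "frac_seminorm_pow G l \<alpha> p f \<le> ennreal E"
  shows "(\<integral>\<^sup>+ s. ennreal (\<bar>f (edge_pt G l e s) - edge_average f e n (cell_index (l e) n s)\<bar> powr p) \<partial>lebesgue_on {0..l e})
    \<le> ennreal (E * (l e / 2 ^ n) powr (\<alpha> * p))"
proof -
  define h where "h = l e / 2 ^ n"
  have L: "0 < l e" using e by (rule length_pos)
  then have h: "0 < h" by (simp add: h_def)
  have "(\<integral>\<^sup>+ s. ennreal (\<bar>f (edge_pt G l e s) - edge_average f e n (cell_index (l e) n s)\<bar> powr p) \<partial>lebesgue_on {0..l e})
    \<le> ennreal (E * 2 ^ n / (inverse (h powr (1 + \<alpha> * p)) * l e))"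
  proof (rule nn_integral_diff_dyadic_average_le[OF p(1) L Lebesgue_space_edge_integrable[OF p(1) f e]])
    show "ennreal (inverse (h powr (1 + \<alpha> * p)) * \<bar>f (edge_pt G l e s) - f (edge_pt G l e t)\<bar> powr p)
        \<le> frac_kernel \<alpha> p f (edge_pt G l e s) (edge_pt G l e t)"
      if "s \<in> {0..l e}" "t \<in> {0..l e}" "\<bar>s - t\<bar> \<le> l e / 2 ^ n" for s t
      using that h p mg_dist_edge_pt_le[OF e that(1,2)]
      by (intro frac_kernel_ge edge_pt_in_mg_space[OF e]) (auto simp: h_def)
    show "(\<integral>\<^sup>+ s. (\<integral>\<^sup>+ t. frac_kernel \<alpha> p f (edge_pt G l e s) (edge_pt G l e t) \<partial>lebesgue_on {0..l e}) \<partial>lebesgue_on {0..l e}) \<le> ennreal E"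
      using frac_kernel_integral_le[OF e e] E(2) by (rule order_trans)
  qed (use h E in auto)
  also have "E * 2 ^ n / (inverse (h powr (1 + \<alpha> * p)) * l e) = E * (h powr (1 + \<alpha> * p) / h)"
    using L by (simp add: h_def divide_inverse)
  also have "h powr (1 + \<alpha> * p) / h = h powr (\<alpha> * p)"
    using h by (simp add: powr_add)
  finally show ?thesis by (simp add: h_def)
qed

text \<open>Serves two purposes. With \<open>D = 0\<close> and equal points it compares consecutive
  levels; with \<open>D\<close> the diameter of the graph it also compares nearby points, possibly
  on different edges. The bounds \<open>a\<close> and \<open>b\<close> on the edge lengths make the
  constant independent of the edges.\<close>

lemma edge_average_diff_le:
  assumes p: "1 \<le> p" "0 < \<alpha>" and f: "f \<in> fst (Lebesgue_space G l p)"
    and E: "0 \<le> E" "frac_seminorm_pow G l \<alpha> p f \<le> ennreal E"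
    and ab: "0 < a" "0 < b" "\<And>e. e \<in> arcs G \<Longrightarrow> a \<le> l e \<and> l e \<le> b"
    and e: "e \<in> arcs G" "t \<in> {0..l e}" and e': "e' \<in> arcs G" "t' \<in> {0..l e'}"
    and D: "0 \<le> D" "mg_dist G l (edge_pt G l e t) (edge_pt G l e' t') \<le> D / 2 ^ n"
    and m: "m = n \<or> m = Suc n"
  shows "\<bar>edge_average f e m (cell_index (l e) m t) - edge_average f e' n (cell_index (l e') n t')\<bar>
    \<le> (2 * E * (2 * b + D) powr (1 + \<alpha> * p) / a\<^sup>2) powr (1 / p) * (2 powr (1 / p - \<alpha>)) ^ n"
proof -
  \<comment> \<open>Bounds the distance between arbitrary points of the two cells: at most
    \<open>b / 2 ^ n\<close> within each cell, and \<open>D / 2 ^ n\<close> between the reference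
    points.\<close>
  define R where "R = (2 * b + D) / 2 ^ n"
  have R: "0 < R" using ab D by (simp add: R_def)
  define \<Delta> where "\<Delta> = \<bar>edge_average f e m (cell_index (l e) m t) - edge_average f e' n (cell_index (l e') n t')\<bar>"
  have L: "0 < l e" "0 < l e'" using e e' length_pos by auto
  have pw: "(2::real) ^ n \<le> 2 ^ m" "(2::real) ^ m \<le> 2 * 2 ^ n" using m by auto
  have dist: "mg_dist G l (edge_pt G l e s) (edge_pt G l e' s') \<le> R"
    if s: "s \<in> dyadic_cell (l e) m (cell_index (l e) m t)" and s': "s' \<in> dyadic_cell (l e') n (cell_index (l e') n t')" for s s'
  proof -
    have mem: "s \<in> {0..l e}" "s' \<in> {0..l e'}" using s s' by (auto simp: dyadic_cell_def)
    note ms = edge_pt_in_mg_space[OF e] edge_pt_in_mg_space[OF e'] edge_pt_in_mg_space[OF e(1) mem(1)] edge_pt_in_mg_space[OF e'(1) mem(2)]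
    have "mg_dist G l (edge_pt G l e s) (edge_pt G l e' s')
        \<le> mg_dist G l (edge_pt G l e s) (edge_pt G l e t) + mg_dist G l (edge_pt G l e t) (edge_pt G l e' s')"
      using ms by (intro triangle)
    moreover have "mg_dist G l (edge_pt G l e t) (edge_pt G l e' s')
        \<le> mg_dist G l (edge_pt G l e t) (edge_pt G l e' t') + mg_dist G l (edge_pt G l e' t') (edge_pt G l e' s')"
      using ms by (intro triangle)
    moreover have "mg_dist G l (edge_pt G l e s) (edge_pt G l e t) \<le> b / 2 ^ n"
    proof -
      have "mg_dist G l (edge_pt G l e s) (edge_pt G l e t) \<le> l e / 2 ^ m"
        using mg_dist_edge_pt_le[OF e(1) mem(1) e(2)] dyadic_cell_diam[OF L(1) s mem_dyadic_cell_index[OF e(2)]] by simp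
      also have "\<dots> \<le> b / 2 ^ n" using ab(3)[OF e(1)] L pw ab by (intro frac_le) auto
      finally show ?thesis .
    qed
    moreover have "mg_dist G l (edge_pt G l e' t') (edge_pt G l e' s') \<le> b / 2 ^ n"
    proof -
      have "mg_dist G l (edge_pt G l e' t') (edge_pt G l e' s') \<le> l e' / 2 ^ n"
        using mg_dist_edge_pt_le[OF e'(1) e'(2) mem(2)] dyadic_cell_diam[OF L(2) mem_dyadic_cell_index[OF e'(2)] s'] by simp
      also have "\<dots> \<le> b / 2 ^ n" using ab(3)[OF e'(1)] by (intro divide_right_mono) auto
      finally show ?thesis .
    qed
    ultimately show ?thesis using D(2) by (simp add: R_def add_divide_distrib)
  qed
  have "inverse (R powr (1 + \<alpha> * p)) * (l e / 2 ^ m * (l e' / 2 ^ n) * \<Delta> powr p) \<le> E"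
    unfolding \<Delta>_def
  proof (rule dyadic_average_diff_powr_le[OF p(1) L(1) _ _ L(2)])
    show "ennreal (inverse (R powr (1 + \<alpha> * p)) * \<bar>f (edge_pt G l e s) - f (edge_pt G l e' s')\<bar> powr p)
        \<le> frac_kernel \<alpha> p f (edge_pt G l e s) (edge_pt G l e' s')"
      if "s \<in> dyadic_cell (l e) m (cell_index (l e) m t)" "s' \<in> dyadic_cell (l e') n (cell_index (l e') n t')" for s s'
      using that R p dist[OF that] e(1) e'(1)
      by (intro frac_kernel_ge edge_pt_in_mg_space) (auto simp: dyadic_cell_def)
    show "(\<integral>\<^sup>+ s. (\<integral>\<^sup>+ t. frac_kernel \<alpha> p f (edge_pt G l e s) (edge_pt G l e' t) \<partial>lebesgue_on {0..l e'}) \<partial>lebesgue_on {0..l e}) \<le> ennreal E"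
      using frac_kernel_integral_le[OF e(1) e'(1)] E(2) by (rule order_trans)
  qed (use e e' E R cell_index_less Lebesgue_space_edge_integrable[OF p(1) f] in auto)
  \<comment> \<open>Both cell lengths are bounded below through level \<open>n\<close>; the extra 2
    allows for the finer level \<open>m = Suc n\<close>.\<close>
  moreover have "inverse (R powr (1 + \<alpha> * p)) * (a\<^sup>2 / (2 * 2 ^ n * 2 ^ n) * \<Delta> powr p)
      \<le> inverse (R powr (1 + \<alpha> * p)) * (l e / 2 ^ m * (l e' / 2 ^ n) * \<Delta> powr p)"
  proof (intro mult_left_mono mult_right_mono)
    have "a / (2 * 2 ^ n) * (a / 2 ^ n) \<le> l e / 2 ^ m * (l e' / 2 ^ n)"
      using ab(1) ab(3)[OF e(1)] ab(3)[OF e'(1)] pw by (intro mult_mono frac_le) auto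
    then show "a\<^sup>2 / (2 * 2 ^ n * 2 ^ n) \<le> l e / 2 ^ m * (l e' / 2 ^ n)"
      by (simp add: power2_eq_square)
  qed auto
  ultimately have "inverse (R powr (1 + \<alpha> * p)) * (a\<^sup>2 / (2 * 2 ^ n * 2 ^ n) * \<Delta> powr p) \<le> E" by linarith
  then have "\<Delta> powr p \<le> E * R powr (1 + \<alpha> * p) * (2 * 2 ^ n * 2 ^ n) / a\<^sup>2"
    using ab R by (simp add: field_simps)
  also have "R powr (1 + \<alpha> * p) = (2 * b + D) powr (1 + \<alpha> * p) * 2 powr (- real n * (1 + \<alpha> * p))"
  proof -
    have "R = (2 * b + D) * 2 powr (- real n)"
      by (simp add: R_def powr_minus powr_realpow divide_inverse)
    then show ?thesis using ab D by (simp add: powr_mult powr_powr)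
  qed
  \<comment> \<open>The kernel contributes the exponent \<open>- n * (1 + \<alpha> * p)\<close> and
    the two cell measures contribute \<open>2 * n\<close>.\<close>
  also have "E * ((2 * b + D) powr (1 + \<alpha> * p) * 2 powr (- real n * (1 + \<alpha> * p))) * (2 * 2 ^ n * 2 ^ n) / a\<^sup>2
      = (2 * E * (2 * b + D) powr (1 + \<alpha> * p) / a\<^sup>2) * 2 powr (real n * (1 - \<alpha> * p))"
  proof -
    have "2 powr (- real n * (1 + \<alpha> * p)) * (2 ^ n * 2 ^ n) = 2 powr (- real n * (1 + \<alpha> * p) + (real n + real n))"
      by (simp only: powr_add powr_realpow)
    also have "\<dots> = 2 powr (real n * (1 - \<alpha> * p))" by (simp add: algebra_simps)
    finally show ?thesis by (simp add: mult_ac)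
  qed
  finally have "(\<Delta> powr p) powr (1 / p)
      \<le> ((2 * E * (2 * b + D) powr (1 + \<alpha> * p) / a\<^sup>2) * 2 powr (real n * (1 - \<alpha> * p))) powr (1 / p)"
    using p by (intro powr_mono2) auto
  moreover have "(\<Delta> powr p) powr (1 / p) = \<Delta>" using p by (simp add: powr_powr \<Delta>_def)
  moreover have "(2 powr (real n * (1 - \<alpha> * p))) powr (1 / p) = (2 powr (1 / p - \<alpha>)) ^ n"
    using p by (simp add: powr_powr powr_power field_simps)
  moreover have "((2 * E * (2 * b + D) powr (1 + \<alpha> * p) / a\<^sup>2) * 2 powr (real n * (1 - \<alpha> * p))) powr (1 / p)
      = (2 * E * (2 * b + D) powr (1 + \<alpha> * p) / a\<^sup>2) powr (1 / p) * (2 powr (real n * (1 - \<alpha> * p))) powr (1 / p)"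
    by (rule powr_mult)
  ultimately show ?thesis
    by (simp only: \<Delta>_def[symmetric])
qed

lemma measurable_edge_average:
  "(\<lambda>t. edge_average f e n (cell_index (l e) n t)) \<in> borel_measurable (lebesgue_on {0..l e})"
  by (rule measurable_cell_index_comp)

text \<open>A case of the Lebesgue differentiation theorem that the seminorm provides directly: the
  p-th powers of the errors have integrals decaying with ratio
  \<open>2 powr - (\<alpha> * p)\<close>, and a geometric rate suffices for convergence almost
  everywhere.\<close>

lemma edge_average_AE_tendsto:
  assumes p: "1 \<le> p" "0 < \<alpha>" and f: "f \<in> fst (Lebesgue_space G l p)" and e: "e \<in> arcs G"
    and E: "0 \<le> E" "frac_seminorm_pow G l \<alpha> p f \<le> ennreal E"
  shows "AE t in lebesgue_on {0..l e}. (\<lambda>n. edge_average f e n (cell_index (l e) n t)) \<longlonglongrightarrow> f (edge_pt G l e t)"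
proof -
  have [measurable]: "(\<lambda>t. f (edge_pt G l e t)) \<in> borel_measurable (lebesgue_on {0..l e})"
    using f e by (rule Lebesgue_space_edge_measurable)
  note [measurable] = measurable_edge_average
  define \<rho> where "\<rho> = (2::real) powr - (\<alpha> * p)"
  have "\<rho> < 2 powr 0" unfolding \<rho>_def using p by (intro powr_less_mono) auto
  then have \<rho>: "0 < \<rho>" "\<rho> < 1" by (simp_all add: \<rho>_def)
  have "AE t in lebesgue_on {0..l e}. (\<lambda>n. f (edge_pt G l e t) - edge_average f e n (cell_index (l e) n t)) \<longlonglongrightarrow> 0"
  proof (rule AE_tendsto_0_of_geometric[OF _ \<rho>])
    show "(\<integral>\<^sup>+ t. ennreal (\<bar>f (edge_pt G l e t) - edge_average f e n (cell_index (l e) n t)\<bar> powr p) \<partial>lebesgue_on {0..l e})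
        \<le> ennreal (E * l e powr (\<alpha> * p) * \<rho> ^ n)" for n
    proof -
      have "(l e / 2 ^ n) powr (\<alpha> * p) = l e powr (\<alpha> * p) * \<rho> ^ n"
      proof -
        have "l e / 2 ^ n = l e * 2 powr (- real n)"
          by (simp add: powr_minus powr_realpow divide_inverse)
        then show ?thesis
          using length_pos[OF e] by (simp add: powr_mult powr_powr \<rho>_def powr_power mult_ac)
      qed
      then show ?thesis
        using edge_average_Lp_error[OF p f e E, of n] by (simp add: mult.assoc)
    qed
  qed (use p E in auto)
  then show ?thesis
  proof eventually_elim
    case (elim t)
    then show ?case using tendsto_diff[OF tendsto_const elim, of "f (edge_pt G l e t)"] by simp
  qed
qed

text \<open>Interpolates between the uniform bound and the \<open>L\<^sub>p\<close> bound for the difference of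
  consecutive averages; the geometric ratio is below \<open>1\<close> exactly for subcritical \<open>q\<close>.\<close>

lemma edge_average_step:
  assumes p: "1 \<le> p" "0 < \<alpha>" and q: "p \<le> q" and E: "0 \<le> E" and e: "e \<in> arcs G"
  shows "\<exists>C\<ge>0. \<forall>f\<in>fst (Lebesgue_space G l p). frac_seminorm_pow G l \<alpha> p f \<le> ennreal E \<longrightarrow>
    (\<forall>n. (\<integral>\<^sup>+ t. ennreal (\<bar>edge_average f e (Suc n) (cell_index (l e) (Suc n) t)
        - edge_average f e n (cell_index (l e) n t)\<bar> powr q) \<partial>lebesgue_on {0..l e})
      \<le> ennreal (C * (2 powr (q * (1 / p - \<alpha>) - 1)) ^ n))"
proof -
  obtain a b where ab: "0 < a" "0 < b" "\<And>e. e \<in> arcs G \<Longrightarrow> a \<le> l e \<and> l e \<le> b"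
    using length_bounds by blast
  \<comment> \<open>The constant of \<open>edge_average_diff_le\<close> for \<open>D = 0\<close>,
    since both averages are taken around the same point.\<close>
  define B where "B = (2 * E * (2 * b + 0) powr (1 + \<alpha> * p) / a\<^sup>2) powr (1 / p)"
  define \<sigma> where "\<sigma> = (2::real) powr (1 / p - \<alpha>)"
  define A where "A = (2::real) powr (p - 1)"
  \<comment> \<open>\<open>B powr (q - p)\<close> comes from the uniform bound; the rest is the
    error bound at both levels, combined by the quasi-triangle inequality with factor
    \<open>A\<close>.\<close>
  define C where "C = B powr (q - p) * (A * (2 * (E * b powr (\<alpha> * p))))"
  have C: "0 \<le> C" using E by (simp add: C_def A_def)
  have "(\<integral>\<^sup>+ t. ennreal (\<bar>edge_average f e (Suc n) (cell_index (l e) (Suc n) t)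
        - edge_average f e n (cell_index (l e) n t)\<bar> powr q) \<partial>lebesgue_on {0..l e})
      \<le> ennreal (C * (2 powr (q * (1 / p - \<alpha>) - 1)) ^ n)"
    if f: "f \<in> fst (Lebesgue_space G l p)" and fE: "frac_seminorm_pow G l \<alpha> p f \<le> ennreal E" for f n
  proof -
    let ?M = "lebesgue_on {0..l e}"
    let ?u = "\<lambda>n t. edge_average f e n (cell_index (l e) n t)"
    let ?f = "\<lambda>t. f (edge_pt G l e t)"
    have [measurable]: "?f \<in> borel_measurable ?M"
      using f e by (rule Lebesgue_space_edge_measurable)
    note [measurable] = measurable_edge_average
    define h where "h = (b / 2 ^ n) powr (\<alpha> * p)"
    have err: "(\<integral>\<^sup>+ t. ennreal (\<bar>?f t - ?u m t\<bar> powr p) \<partial>?M) \<le> ennreal (E * h)" if m: "n \<le> m" for m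
    proof -
      have "l e / 2 ^ m \<le> b / 2 ^ n" using ab(3)[OF e] m ab length_pos[OF e] by (intro frac_le) auto
      then have "E * (l e / 2 ^ m) powr (\<alpha> * p) \<le> E * h"
        unfolding h_def using E p length_pos[OF e] by (intro mult_left_mono powr_mono2) auto
      then show ?thesis
        using edge_average_Lp_error[OF p f e E fE, of m] by (meson ennreal_leI order_trans)
    qed
    have Lp: "(\<integral>\<^sup>+ t. ennreal (\<bar>?u (Suc n) t - ?u n t\<bar> powr p) \<partial>?M) \<le> ennreal (A * (2 * (E * h)))"
    proof -
      have "(\<integral>\<^sup>+ t. ennreal (\<bar>?u (Suc n) t - ?u n t\<bar> powr p) \<partial>?M)
          \<le> ennreal A * ((\<integral>\<^sup>+ t. ennreal (\<bar>?u (Suc n) t - ?f t\<bar> powr p) \<partial>?M) + (\<integral>\<^sup>+ t. ennreal (\<bar>?f t - ?u n t\<bar> powr p) \<partial>?M))"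
        unfolding A_def using p by (intro nn_integral_abs_diff_powr_le) auto
      also have "\<dots> \<le> ennreal A * (ennreal (E * h) + ennreal (E * h))"
        using err[of n] err[of "Suc n"] by (intro mult_left_mono add_mono) (auto simp: abs_minus_commute)
      also have "\<dots> = ennreal (A * (2 * (E * h)))"
        using E by (simp add: A_def h_def ennreal_mult[symmetric] ennreal_plus[symmetric] del: ennreal_plus)
      finally show ?thesis .
    qed
    have "(\<integral>\<^sup>+ t. ennreal (\<bar>?u (Suc n) t - ?u n t\<bar> powr q) \<partial>?M)
        \<le> (\<integral>\<^sup>+ t. ennreal ((B * \<sigma> ^ n) powr (q - p)) * ennreal (\<bar>?u (Suc n) t - ?u n t\<bar> powr p) \<partial>?M)"
    proof (rule nn_integral_mono)
      fix t assume "t \<in> space ?M"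
      then have t: "t \<in> {0..l e}" by simp
      define x where "x = \<bar>?u (Suc n) t - ?u n t\<bar>"
      have "x \<le> B * \<sigma> ^ n"
        unfolding x_def B_def \<sigma>_def
        by (rule edge_average_diff_le[OF p f E fE ab e t e t]) (use edge_pt_in_mg_space[OF e t] in auto)
      moreover have "0 \<le> x" by (simp add: x_def)
      ultimately have "x powr (q - p) * x powr p \<le> (B * \<sigma> ^ n) powr (q - p) * x powr p"
        using q by (intro mult_right_mono powr_mono2) auto
      moreover have "x powr q = x powr (q - p) * x powr p"
        by (simp add: powr_add[symmetric])
      ultimately show "ennreal (\<bar>?u (Suc n) t - ?u n t\<bar> powr q)
          \<le> ennreal ((B * \<sigma> ^ n) powr (q - p)) * ennreal (\<bar>?u (Suc n) t - ?u n t\<bar> powr p)"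
        by (simp add: x_def ennreal_mult[symmetric] ennreal_leI)
    qed
    also have "\<dots> = ennreal ((B * \<sigma> ^ n) powr (q - p)) * (\<integral>\<^sup>+ t. ennreal (\<bar>?u (Suc n) t - ?u n t\<bar> powr p) \<partial>?M)"
      by (rule nn_integral_cmult) measurable
    also have "\<dots> \<le> ennreal ((B * \<sigma> ^ n) powr (q - p)) * ennreal (A * (2 * (E * h)))"
      by (intro mult_left_mono Lp) auto
    also have "\<dots> = ennreal ((B * \<sigma> ^ n) powr (q - p) * (A * (2 * (E * h))))"
      using E by (simp add: A_def h_def ennreal_mult[symmetric])
    also have "(B * \<sigma> ^ n) powr (q - p) = B powr (q - p) * 2 powr (real n * ((1 / p - \<alpha>) * (q - p)))"
      by (simp add: powr_mult B_def \<sigma>_def powr_powr powr_power mult_ac)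
    also have "h = b powr (\<alpha> * p) * 2 powr (real n * - (\<alpha> * p))"
    proof -
      have "b / 2 ^ n = b * 2 powr (- real n)"
        by (simp add: powr_minus powr_realpow divide_inverse)
      then show ?thesis using ab by (simp add: h_def powr_mult powr_powr)
    qed
    also have "B powr (q - p) * 2 powr (real n * ((1 / p - \<alpha>) * (q - p))) * (A * (2 * (E * (b powr (\<alpha> * p) * 2 powr (real n * - (\<alpha> * p))))))
        = C * (2 powr (real n * ((1 / p - \<alpha>) * (q - p))) * 2 powr (real n * - (\<alpha> * p)))"
      by (simp add: C_def mult_ac)
    \<comment> \<open>The exponents add up since
      \<open>(1 / p - \<alpha>) * p = 1 - \<alpha> * p\<close>, so the terms
      \<open>\<alpha> * p\<close> cancel.\<close>
    also have "2 powr (real n * ((1 / p - \<alpha>) * (q - p))) * 2 powr (real n * - (\<alpha> * p)) = 2 powr (real n * (q * (1 / p - \<alpha>) - 1))"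
      unfolding powr_add[symmetric] using p by (simp add: algebra_simps diff_divide_distrib)
    also have "(2::real) powr (real n * (q * (1 / p - \<alpha>) - 1)) = (2 powr (q * (1 / p - \<alpha>) - 1)) ^ n"
      by (simp add: powr_power)
    finally show ?thesis .
  qed
  then show ?thesis using C by blast
qed

section \<open>Diagonal subsequence of averages\<close>

lemma edge_average_convergent_subsequence:
  assumes p: "1 \<le> p" "0 < \<alpha>" and F: "\<And>i. F i \<in> fst (Sobolev_space G l \<alpha> p)" "\<And>i. snd (Sobolev_space G l \<alpha> p) (F i) \<le> M"
  obtains r A where "strict_mono (r :: nat \<Rightarrow> nat)"
    "\<And>e n j. e \<in> arcs G \<Longrightarrow> j < 2 ^ n \<Longrightarrow> (\<lambda>i. edge_average (F (r i)) e n j) \<longlonglongrightarrow> A e n j"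
proof -
  \<comment> \<open>\<open>function_convergent_subsequence\<close> asks for one bound at all
    indices, while the bound on the averages grows with the level. Dividing by \<open>W\<close>
    normalises it to 1; the added 1 keeps the divisor positive.\<close>
  define W where "W e n = (M powr p * 2 ^ n / l e) powr (1 / p) + 1" for e and n :: nat
  have W: "0 < W e n" for e n by (simp add: W_def add_nonneg_pos)
  define S where "S = {(e, n, j). e \<in> arcs G \<and> j < (2::nat) ^ n}"
  define g where "g i = (\<lambda>(e, n, j). edge_average (F i) e n j / W e n)" for i
  have "countable S"
    by (rule countable_subset[of _ "arcs G \<times> UNIV \<times> UNIV"])
      (auto simp: S_def intro!: countable_finite[OF finite_arcs])
  moreover have "norm (g i x) \<le> 1" if xS: "x \<in> S" for i x
  proof -
    obtain e n j where x: "x = (e, n, j)" "e \<in> arcs G" "j < 2 ^ n" using xS by (auto simp: S_def)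
    have "\<bar>edge_average (F i) e n j\<bar> \<le> (M powr p * 2 ^ n / l e) powr (1 / p)"
      using Sobolev_space_bounds(2)[OF p F x(2)] F(1)[of i] x length_pos
      by (intro abs_dyadic_average_le[OF p(1)] Lebesgue_space_edge_integrable[OF p(1)]) (auto simp: Sobolev_space_def)
    then show ?thesis using W[of e n] by (simp add: g_def x W_def)
  qed
  ultimately obtain r where r: "strict_mono r" "\<And>x. x \<in> S \<Longrightarrow> \<exists>c. (\<lambda>i. g (r i) x) \<longlonglongrightarrow> c"
    using function_convergent_subsequence[of S g 1] by blast
  show ?thesis
  proof (rule that[of r "\<lambda>e n j. lim (\<lambda>i. edge_average (F (r i)) e n j)"])
    fix e n j assume "e \<in> arcs G" "j < (2::nat) ^ n"
    then have "(e, n, j) \<in> S" by (simp add: S_def)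
    then obtain c where "(\<lambda>i. g (r i) (e, n, j)) \<longlonglongrightarrow> c" using r(2) by blast
    then have "(\<lambda>i. W e n * g (r i) (e, n, j)) \<longlonglongrightarrow> W e n * c" by (rule tendsto_mult_left)
    then have "(\<lambda>i. edge_average (F (r i)) e n j) \<longlonglongrightarrow> W e n * c"
      using W[of e n] by (simp add: g_def)
    then show "(\<lambda>i. edge_average (F (r i)) e n j) \<longlonglongrightarrow> lim (\<lambda>i. edge_average (F (r i)) e n j)"
      by (metis convergentI convergent_LIMSEQ_iff)
  qed (rule r)
qed

section \<open>Embedding into Lebesgue spaces\<close>

lemma Sobolev_subset_Lebesgue: "f \<in> fst (Sobolev_space G l \<alpha> p) \<Longrightarrow> f \<in> fst (Lebesgue_space G l p)"
  by (simp add: Sobolev_space_def)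

lemma subcritical_ratio:
  fixes q p \<alpha> :: real
  assumes "q * (1 / p - \<alpha>) < 1"
  shows "0 < (2::real) powr (q * (1 / p - \<alpha>) - 1)" "2 powr (q * (1 / p - \<alpha>) - 1) < (1::real)"
  using powr_less_mono[of "q * (1 / p - \<alpha>) - 1" 0 2] assms by simp_all

text \<open>Applies \<open>chain_compactness\<close> to a constant family, for the sake of its
  second conclusion: \<open>f\<close> is at finite distance from its average at level 0.\<close>

lemma Sobolev_edge_finite:
  assumes p: "1 \<le> p" "0 < \<alpha>" and q: "p \<le> q" "q * (1 / p - \<alpha>) < 1"
    and f: "f \<in> fst (Sobolev_space G l \<alpha> p)" and e: "e \<in> arcs G"
  shows "(\<integral>\<^sup>+ t. ennreal (\<bar>f (edge_pt G l e t)\<bar> powr q) \<partial>lebesgue_on {0..l e}) < \<infinity>"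
proof -
  let ?M = "lebesgue_on {0..l e}" and ?u = "\<lambda>n t. edge_average f e n (cell_index (l e) n t)"
  define M where "M = snd (Sobolev_space G l \<alpha> p) f"
  have E: "0 \<le> M powr p" "frac_seminorm_pow G l \<alpha> p f \<le> ennreal (M powr p)"
    using Sobolev_space_bounds(1)[OF p f] by (simp_all add: M_def)
  have fL: "f \<in> fst (Lebesgue_space G l p)" using f by (rule Sobolev_subset_Lebesgue)
  have [measurable]: "(\<lambda>t. f (edge_pt G l e t)) \<in> borel_measurable ?M"
    using fL e by (rule Lebesgue_space_edge_measurable)
  note [measurable] = measurable_edge_average
  obtain C where C: "0 \<le> C" "\<And>n. (\<integral>\<^sup>+ t. ennreal (\<bar>?u (Suc n) t - ?u n t\<bar> powr q) \<partial>?M)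
      \<le> ennreal (C * (2 powr (q * (1 / p - \<alpha>) - 1)) ^ n)"
    using edge_average_step[OF p q(1) E(1) e] fL E(2) by blast
  have "(\<integral>\<^sup>+ t. ennreal (\<bar>f (edge_pt G l e t) - ?u 0 t\<bar> powr q) \<partial>?M) < \<infinity>"
    by (rule chain_compactness(2)[where U = "\<lambda>i. ?u" and G = ?u and F = "\<lambda>i t. f (edge_pt G l e t)" and n = 0, OF _ subcritical_ratio[OF q(2)] C(1)])
      (use p q C(2) edge_average_AE_tendsto[OF p fL e E] in auto)
  moreover have "(\<integral>\<^sup>+ t. ennreal (\<bar>?u 0 t - 0\<bar> powr q) \<partial>?M) < \<infinity>"
  proof -
    \<comment> \<open>At level 0 the whole edge is a single cell, so the step function is
      constant.\<close>
    have "cell_index (l e) 0 t = 0" for t using cell_index_less[of "l e" 0 t] by simp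
    moreover have "emeasure ?M (space ?M) < \<infinity>"
      using finite_measure.emeasure_finite[OF finite_measure_interval] by (simp add: less_top)
    ultimately show ?thesis by (simp add: ennreal_mult_less_top)
  qed
  ultimately have fin: "ennreal (2 powr (q - 1)) * ((\<integral>\<^sup>+ t. ennreal (\<bar>f (edge_pt G l e t) - ?u 0 t\<bar> powr q) \<partial>?M)
      + (\<integral>\<^sup>+ t. ennreal (\<bar>?u 0 t - 0\<bar> powr q) \<partial>?M)) < \<infinity>"
    by (simp add: ennreal_mult_less_top)
  have "(\<integral>\<^sup>+ t. ennreal (\<bar>f (edge_pt G l e t) - 0\<bar> powr q) \<partial>?M)
      \<le> ennreal (2 powr (q - 1)) * ((\<integral>\<^sup>+ t. ennreal (\<bar>f (edge_pt G l e t) - ?u 0 t\<bar> powr q) \<partial>?M)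
      + (\<integral>\<^sup>+ t. ennreal (\<bar>?u 0 t - 0\<bar> powr q) \<partial>?M))"
    by (rule nn_integral_abs_diff_powr_le) (use p q in simp, measurable)
  from le_less_trans[OF this fin] show ?thesis by simp
qed

text \<open>The subsequence makes the averages on all edges converge at once, so one
  \<open>r\<close> serves every edge; only the limit is produced edge by edge.\<close>

lemma Sobolev_edge_compact:
  assumes p: "1 \<le> p" "0 < \<alpha>" and q: "p \<le> q" "q * (1 / p - \<alpha>) < 1"
    and F: "\<And>i. F i \<in> fst (Sobolev_space G l \<alpha> p)" "\<And>i. snd (Sobolev_space G l \<alpha> p) (F i) \<le> M"
  shows "\<exists>r \<phi>. strict_mono (r :: nat \<Rightarrow> nat) \<and> (\<forall>e\<in>arcs G. \<phi> e \<in> borel_measurable (lebesgue_on {0..l e}) \<and>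
    (\<lambda>i. \<integral>\<^sup>+ t. ennreal (\<bar>F (r i) (edge_pt G l e t) - \<phi> e t\<bar> powr q) \<partial>lebesgue_on {0..l e}) \<longlonglongrightarrow> 0)"
proof -
  obtain r A where r: "strict_mono (r :: nat \<Rightarrow> nat)"
    and A: "\<And>e n j. e \<in> arcs G \<Longrightarrow> j < 2 ^ n \<Longrightarrow> (\<lambda>i. edge_average (F (r i)) e n j) \<longlonglongrightarrow> A e n j"
    by (rule edge_average_convergent_subsequence[OF p, of F M, OF F]) blast
  have FL: "F i \<in> fst (Lebesgue_space G l p)" for i using F(1) by (rule Sobolev_subset_Lebesgue)
  have E: "0 \<le> M powr p" "frac_seminorm_pow G l \<alpha> p (F i) \<le> ennreal (M powr p)" for i
    using Sobolev_space_bounds(1)[OF p F(1) F(2)] by simp_all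
  have "\<exists>\<phi>\<in>borel_measurable (lebesgue_on {0..l e}).
      (\<lambda>i. \<integral>\<^sup>+ t. ennreal (\<bar>F (r i) (edge_pt G l e t) - \<phi> t\<bar> powr q) \<partial>lebesgue_on {0..l e}) \<longlonglongrightarrow> 0"
    if e: "e \<in> arcs G" for e
  proof -
    let ?M = "lebesgue_on {0..l e}" and ?u = "\<lambda>i n t. edge_average (F (r i)) e n (cell_index (l e) n t)"
    let ?g = "\<lambda>n t. A e n (cell_index (l e) n t)"
    note [measurable] = measurable_edge_average measurable_cell_index_comp
    obtain C where C: "0 \<le> C" "\<And>i n. (\<integral>\<^sup>+ t. ennreal (\<bar>?u i (Suc n) t - ?u i n t\<bar> powr q) \<partial>?M)
        \<le> ennreal (C * (2 powr (q * (1 / p - \<alpha>) - 1)) ^ n)"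
      using edge_average_step[OF p q(1) E(1) e] FL E(2) by blast
    have ug: "(\<lambda>i. ?u i n t) \<longlonglongrightarrow> ?g n t" for n t
      using A[OF e cell_index_less] .
    have ug_int: "(\<lambda>i. \<integral>\<^sup>+ t. ennreal (\<bar>?u i n t - ?g n t\<bar> powr q) \<partial>?M) \<longlonglongrightarrow> 0" for n
    proof (rule tendsto_sandwich[of "\<lambda>_. 0"])
      \<comment> \<open>A fixed level has finitely many cells, so this sum bounds the integrand
        uniformly in \<open>t\<close>.\<close>
      define s where "s i = (\<Sum>j<(2::nat) ^ n. \<bar>edge_average (F (r i)) e n j - A e n j\<bar> powr q)" for i
      have "s \<longlonglongrightarrow> (\<Sum>j<(2::nat) ^ n. 0 powr q)"
        unfolding s_def using p q A[OF e, of _ n]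
        by (intro tendsto_sum tendsto_powr' tendsto_const tendsto_rabs_zero) (auto simp: LIM_zero)
      then have "(\<lambda>i. emeasure ?M (space ?M) * ennreal (s i)) \<longlonglongrightarrow> emeasure ?M (space ?M) * ennreal 0"
        using finite_measure.emeasure_finite[OF finite_measure_interval, of "l e" "space ?M"]
        by (intro ennreal_tendsto_cmult tendsto_ennrealI) (auto simp: less_top)
      then show "(\<lambda>i. emeasure ?M (space ?M) * ennreal (s i)) \<longlonglongrightarrow> 0" by simp
      have "(\<integral>\<^sup>+ t. ennreal (\<bar>?u i n t - ?g n t\<bar> powr q) \<partial>?M) \<le> (\<integral>\<^sup>+ t. ennreal (s i) \<partial>?M)" for i
        unfolding s_def using cell_index_less[of "l e" n]
        by (intro nn_integral_mono ennreal_leI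
            member_le_sum[of _ _ "\<lambda>j. \<bar>edge_average (F (r i)) e n j - A e n j\<bar> powr q"]) auto
      then show "\<forall>\<^sub>F i in sequentially. (\<integral>\<^sup>+ t. ennreal (\<bar>?u i n t - ?g n t\<bar> powr q) \<partial>?M) \<le> emeasure ?M (space ?M) * ennreal (s i)"
        by (simp add: mult.commute)
    qed auto
    show ?thesis
    proof (rule chain_compactness(1)[OF _ subcritical_ratio[OF q(2)] C(1), where U = ?u and G = ?g])
      show "(\<lambda>t. F (r i) (edge_pt G l e t)) \<in> borel_measurable ?M" for i
        using FL e by (rule Lebesgue_space_edge_measurable)
      show "AE t in ?M. (\<lambda>n. ?u i n t) \<longlonglongrightarrow> F (r i) (edge_pt G l e t)" for i
        using FL e E by (rule edge_average_AE_tendsto[OF p])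
    qed (use p q C(2) ug ug_int in auto)
  qed
  then have "\<forall>e\<in>arcs G. \<exists>\<phi>. \<phi> \<in> borel_measurable (lebesgue_on {0..l e}) \<and>
      (\<lambda>i. \<integral>\<^sup>+ t. ennreal (\<bar>F (r i) (edge_pt G l e t) - \<phi> t\<bar> powr q) \<partial>lebesgue_on {0..l e}) \<longlonglongrightarrow> 0"
    by blast
  from bchoice[OF this] show ?thesis using r by blast
qed

section \<open>Lebesgue spaces of the graph as quasi-pseudometric spaces\<close>

lemma mg_powr_diff_le:
  assumes k: "1 \<le> k"
    and "f \<in> fst (Lebesgue_space G l k)" "g \<in> fst (Lebesgue_space G l k)" "h \<in> fst (Lebesgue_space G l k)"
  shows "mg_nn_integral G l (\<lambda>x. ennreal (\<bar>f x - h x\<bar> powr k))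
    \<le> ennreal (2 powr (k - 1)) * (mg_nn_integral G l (\<lambda>x. ennreal (\<bar>f x - g x\<bar> powr k))
        + mg_nn_integral G l (\<lambda>x. ennreal (\<bar>g x - h x\<bar> powr k)))"
  unfolding mg_nn_integral_def sum.distrib[symmetric] sum_distrib_left
  using assms by (intro sum_mono nn_integral_abs_diff_powr_le Lebesgue_space_edge_measurable)

lemma zero_in_Lebesgue_space: "(\<lambda>x. 0) \<in> fst (Lebesgue_space G l k)"
  by (simp add: Lebesgue_space_def mg_nn_integral_def)

lemma mg_powr_diff_finite:
  assumes k: "1 \<le> k" and f: "f \<in> fst (Lebesgue_space G l k)" and h: "h \<in> fst (Lebesgue_space G l k)"
  shows "mg_nn_integral G l (\<lambda>x. ennreal (\<bar>f x - h x\<bar> powr k)) < \<infinity>"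
proof -
  have "mg_nn_integral G l (\<lambda>x. ennreal (\<bar>f x - h x\<bar> powr k))
      \<le> ennreal (2 powr (k - 1)) * (mg_nn_integral G l (\<lambda>x. ennreal (\<bar>f x - 0\<bar> powr k))
        + mg_nn_integral G l (\<lambda>x. ennreal (\<bar>0 - h x\<bar> powr k)))"
    by (rule mg_powr_diff_le[OF k f zero_in_Lebesgue_space h])
  also have "\<dots> < \<infinity>" using f h by (simp add: Lebesgue_space_def ennreal_mult_less_top)
  finally show ?thesis .
qed

lemma quasi_pseudometric_Lebesgue_space:
  assumes k: "1 \<le> k"
  shows "quasi_pseudometric (seminorm_topology (Lebesgue_space G l k)) (fst (Lebesgue_space G l k))
    (\<lambda>f g. snd (Lebesgue_space G l k) (\<lambda>x. f x - g x)) 2"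
proof
  fix f g h assume f: "f \<in> fst (Lebesgue_space G l k)" and g: "g \<in> fst (Lebesgue_space G l k)"
    and h: "h \<in> fst (Lebesgue_space G l k)"
  let ?I = "\<lambda>f g. mg_nn_integral G l (\<lambda>x. ennreal (\<bar>f x - g x\<bar> powr k))"
  define a b where "a = enn2real (?I f g)" and "b = enn2real (?I g h)"
  have ab: "0 \<le> a" "0 \<le> b" by (simp_all add: a_def b_def)
  have eq: "?I f g = ennreal a" "?I g h = ennreal b"
    using mg_powr_diff_finite[OF k f g] mg_powr_diff_finite[OF k g h] by (simp_all add: a_def b_def less_top)
  have "enn2real (?I f h) \<le> enn2real (ennreal (2 powr (k - 1)) * (ennreal a + ennreal b))"
    using mg_powr_diff_le[OF k f g h] by (intro enn2real_mono) (simp_all add: eq ennreal_mult_less_top)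
  also have "\<dots> = 2 powr (k - 1) * (a + b)"
    using ab by (simp add: ennreal_mult[symmetric] ennreal_plus[symmetric] del: ennreal_plus)
  \<comment> \<open>Replacing the sum by twice the maximum turns the factor into
    \<open>2 powr k\<close>, whose root of order \<open>k\<close> is the constant 2 for every
    \<open>k\<close>.\<close>
  also have "\<dots> \<le> 2 powr (k - 1) * (2 * max a b)" by (intro mult_left_mono) auto
  also have "\<dots> = 2 powr k * max a b" by (simp add: powr_diff)
  finally have "enn2real (?I f h) powr (1 / k) \<le> (2 powr k * max a b) powr (1 / k)"
    using k by (intro powr_mono2) auto
  also have "\<dots> = 2 * max a b powr (1 / k)" using k by (simp add: powr_mult powr_powr)
  also have "\<dots> \<le> 2 * (a powr (1 / k) + b powr (1 / k))" by (simp add: max_def)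
  finally show "snd (Lebesgue_space G l k) (\<lambda>x. f x - h x)
      \<le> 2 * (snd (Lebesgue_space G l k) (\<lambda>x. f x - g x) + snd (Lebesgue_space G l k) (\<lambda>x. g x - h x))"
    by (simp add: Lebesgue_space_def a_def b_def)
qed (use k in \<open>auto simp: openin_seminorm_topology Lebesgue_space_def abs_minus_commute mg_nn_integral_def\<close>)

text \<open>The interpolation works for exponents from \<open>p\<close> upwards. A target exponent
  \<open>k\<close>, possibly below \<open>p\<close>, is reached through an auxiliary subcritical
  \<open>q\<close> above both, since the edges have finite measure. The embedding operator is the
  identity.\<close>

theorem Sobolev_compactly_embeds_Lebesgue:
  assumes p: "1 \<le> p" "0 < \<alpha>" and k: "1 \<le> k" and q: "p \<le> q" "k \<le> q" "q * (1 / p - \<alpha>) < 1"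
  shows "compactly_embeds G l (Sobolev_space G l \<alpha> p) (Lebesgue_space G l k)"
proof -
  let ?X = "Sobolev_space G l \<alpha> p" and ?Y = "Lebesgue_space G l k"
  interpret Y: quasi_pseudometric "seminorm_topology ?Y" "fst ?Y" "\<lambda>f g. snd ?Y (\<lambda>x. f x - g x)" 2
    using k by (rule quasi_pseudometric_Lebesgue_space)
  have XY: "f \<in> fst ?Y" if f: "f \<in> fst ?X" for f
  proof -
    have fL: "f \<in> fst (Lebesgue_space G l p)" using f by (rule Sobolev_subset_Lebesgue)
    have "(\<integral>\<^sup>+ t. ennreal (\<bar>f (edge_pt G l e t)\<bar> powr k) \<partial>lebesgue_on {0..l e}) < \<infinity>" if e: "e \<in> arcs G" for e
    proof -
      have "emeasure (lebesgue_on {0..l e}) (space (lebesgue_on {0..l e})) < \<infinity>"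
        using finite_measure.emeasure_finite[OF finite_measure_interval] by (simp add: less_top)
      then show ?thesis
        using nn_integral_powr_interpolate[of k q 1, OF _ q(2) _ Lebesgue_space_edge_measurable[OF fL e]] k
          Sobolev_edge_finite[OF p q(1,3) f e] by (auto intro: le_less_trans simp: ennreal_mult_less_top)
    qed
    then show ?thesis using Lebesgue_space_edge_measurable[OF fL] by (simp add: Lebesgue_space_def mg_nn_integral_def)
  qed
  have "compactin (seminorm_topology ?Y) (seminorm_topology ?Y closure_of B)"
    if B: "B \<subseteq> fst ?X" "\<forall>f\<in>B. snd ?X f \<le> M" for B M
  proof (rule Y.compactin_closure_of)
    show "B \<subseteq> fst ?Y" using B(1) XY by blast
    fix F :: "nat \<Rightarrow> ('v, 'e) mg_point \<Rightarrow> real" assume FB: "\<And>n. F n \<in> B"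
    have F: "F i \<in> fst ?X" "snd ?X (F i) \<le> M" "F i \<in> fst ?Y" for i using FB B XY by blast+
    obtain r \<phi> where r: "strict_mono (r :: nat \<Rightarrow> nat)"
      and \<phi>: "\<And>e. e \<in> arcs G \<Longrightarrow> \<phi> e \<in> borel_measurable (lebesgue_on {0..l e})"
      and lim: "\<And>e. e \<in> arcs G \<Longrightarrow>
        (\<lambda>i. \<integral>\<^sup>+ t. ennreal (\<bar>F (r i) (edge_pt G l e t) - \<phi> e t\<bar> powr q) \<partial>lebesgue_on {0..l e}) \<longlonglongrightarrow> 0"
      using Sobolev_edge_compact[OF p q(1,3), of F M, OF F(1,2)] by blast
    \<comment> \<open>The edgewise limits need not agree at a common vertex. The value 0 there is a
      free choice, as the endpoints are null sets.\<close>
    define f where "f x = (case x of Vertex v \<Rightarrow> 0 | Interior e t \<Rightarrow> \<phi> e t)" for x :: "('v, 'e) mg_point"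
    have f_edge: "f (edge_pt G l e t) = (if t = 0 \<or> t = l e then 0 else \<phi> e t)" for e t
      by (simp add: f_def edge_pt_def)
    have f_meas: "(\<lambda>t. f (edge_pt G l e t)) \<in> borel_measurable (lebesgue_on {0..l e})" if e: "e \<in> arcs G" for e
    proof -
      have "Measurable.pred borel (\<lambda>t::real. t = 0 \<or> t = l e)" by measurable
      then have [measurable]: "Measurable.pred (lebesgue_on {0..l e}) (\<lambda>t. t = 0 \<or> t = l e)"
        by (metis measurable_completion measurable_lborel2 measurable_restrict_space1)
      have [measurable]: "\<phi> e \<in> borel_measurable (lebesgue_on {0..l e})" using e by (rule \<phi>)
      show ?thesis unfolding f_edge by measurable
    qed
    have "(\<lambda>i. \<integral>\<^sup>+ t. ennreal (\<bar>F (r i) (edge_pt G l e t) - f (edge_pt G l e t)\<bar> powr k) \<partial>lebesgue_on {0..l e}) \<longlonglongrightarrow> 0"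
      if e: "e \<in> arcs G" for e
    proof -
      have "(\<lambda>i. \<integral>\<^sup>+ t. ennreal (\<bar>F (r i) (edge_pt G l e t) - \<phi> e t\<bar> powr k) \<partial>lebesgue_on {0..l e}) \<longlonglongrightarrow> 0"
      proof (rule nn_integral_powr_tendsto_0_mono[OF finite_measure_interval _ q(2) _ lim[OF e]])
        show "(\<lambda>t. F (r i) (edge_pt G l e t) - \<phi> e t) \<in> borel_measurable (lebesgue_on {0..l e})" for i
          using Lebesgue_space_edge_measurable[OF F(3) e] \<phi>[OF e] by (rule borel_measurable_diff)
      qed (use k in simp)
      moreover have "(\<integral>\<^sup>+ t. ennreal (\<bar>F (r i) (edge_pt G l e t) - \<phi> e t\<bar> powr k) \<partial>lebesgue_on {0..l e})
          = (\<integral>\<^sup>+ t. ennreal (\<bar>F (r i) (edge_pt G l e t) - f (edge_pt G l e t)\<bar> powr k) \<partial>lebesgue_on {0..l e})" for i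
        by (rule nn_integral_cong_AE, use AE_interval_not_endpoint[of "l e"] in eventually_elim) (simp add: f_edge)
      ultimately show ?thesis by simp
    qed
    then have "(\<lambda>i. mg_nn_integral G l (\<lambda>x. ennreal (\<bar>F (r i) x - f x\<bar> powr k))) \<longlonglongrightarrow> (\<Sum>e\<in>arcs G. 0)"
      unfolding mg_nn_integral_def by (rule tendsto_sum)
    then have conv: "(\<lambda>i. mg_nn_integral G l (\<lambda>x. ennreal (\<bar>F (r i) x - f x\<bar> powr k))) \<longlonglongrightarrow> 0" by simp
    \<comment> \<open>It suffices that \<open>f\<close> is at finite distance from one member of the
      sequence, which lies in the space itself.\<close>
    have "f \<in> fst ?Y"
    proof -
      have "\<forall>\<^sub>F i in sequentially. mg_nn_integral G l (\<lambda>x. ennreal (\<bar>F (r i) x - f x\<bar> powr k)) < 1"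
        using conv by (rule order_tendstoD) simp
      from eventually_happens'[OF sequentially_bot this] obtain i where
        i: "mg_nn_integral G l (\<lambda>x. ennreal (\<bar>F (r i) x - f x\<bar> powr k)) < 1" by blast
      have "(\<integral>\<^sup>+ t. ennreal (\<bar>f (edge_pt G l e t)\<bar> powr k) \<partial>lebesgue_on {0..l e}) < \<infinity>" if e: "e \<in> arcs G" for e
      proof -
        let ?M = "lebesgue_on {0..l e}"
        have "(\<integral>\<^sup>+ t. ennreal (\<bar>f (edge_pt G l e t) - F (r i) (edge_pt G l e t)\<bar> powr k) \<partial>?M) < \<infinity>"
          using mg_nn_integral_edge_le[OF e, of "\<lambda>x. ennreal (\<bar>F (r i) x - f x\<bar> powr k)"] i
          by (simp add: abs_minus_commute) (meson ennreal_one_less_top le_less_trans less_trans)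
        moreover have "(\<integral>\<^sup>+ t. ennreal (\<bar>F (r i) (edge_pt G l e t) - 0\<bar> powr k) \<partial>?M) < \<infinity>"
          using mg_nn_integral_edge_le[OF e, of "\<lambda>x. ennreal (\<bar>F (r i) x\<bar> powr k)"] F(3)[of "r i"]
          by (auto simp: Lebesgue_space_def intro: le_less_trans)
        ultimately have fin: "ennreal (2 powr (k - 1)) * ((\<integral>\<^sup>+ t. ennreal (\<bar>f (edge_pt G l e t) - F (r i) (edge_pt G l e t)\<bar> powr k) \<partial>?M)
            + (\<integral>\<^sup>+ t. ennreal (\<bar>F (r i) (edge_pt G l e t) - 0\<bar> powr k) \<partial>?M)) < \<infinity>"
          by (simp add: ennreal_mult_less_top)
        have [measurable]: "(\<lambda>t. f (edge_pt G l e t)) \<in> borel_measurable ?M" "(\<lambda>t. F (r i) (edge_pt G l e t)) \<in> borel_measurable ?M"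
          using f_meas[OF e] Lebesgue_space_edge_measurable[OF F(3) e] by simp_all
        have "(\<integral>\<^sup>+ t. ennreal (\<bar>f (edge_pt G l e t) - 0\<bar> powr k) \<partial>?M)
          \<le> ennreal (2 powr (k - 1)) * ((\<integral>\<^sup>+ t. ennreal (\<bar>f (edge_pt G l e t) - F (r i) (edge_pt G l e t)\<bar> powr k) \<partial>?M)
            + (\<integral>\<^sup>+ t. ennreal (\<bar>F (r i) (edge_pt G l e t) - 0\<bar> powr k) \<partial>?M))"
          by (rule nn_integral_abs_diff_powr_le) (use k in simp, measurable)
        from le_less_trans[OF this fin] show ?thesis by simp
      qed
      then show ?thesis using f_meas by (simp add: Lebesgue_space_def mg_nn_integral_def)
    qed
    moreover have "(\<lambda>i. snd ?Y (\<lambda>x. F (r i) x - f x)) \<longlonglongrightarrow> 0"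
    proof -
      have "(\<lambda>i. enn2real (mg_nn_integral G l (\<lambda>x. ennreal (\<bar>F (r i) x - f x\<bar> powr k)))) \<longlonglongrightarrow> 0"
        using conv by (intro tendsto_enn2real) auto
      then have "(\<lambda>i. enn2real (mg_nn_integral G l (\<lambda>x. ennreal (\<bar>F (r i) x - f x\<bar> powr k))) powr (1 / k)) \<longlonglongrightarrow> 0 powr (1 / k)"
        using k by (intro tendsto_powr' tendsto_const) auto
      then show ?thesis by (simp add: Lebesgue_space_def)
    qed
    ultimately show "\<exists>f\<in>fst ?Y. \<exists>r. strict_mono r \<and> (\<lambda>n. snd ?Y (\<lambda>x. F (r n) x - f x)) \<longlonglongrightarrow> 0"
      using r by blast
  qed
  then have "compact_linear_operator ?X ?Y (\<lambda>f. f)"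
    unfolding compact_linear_operator_def using XY by auto
  then show ?thesis
    unfolding compactly_embeds_def mg_ae_eq_def using XY by (intro exI[of _ "\<lambda>f. f"]) auto
qed

section \<open>Compactness of the graph\<close>

lemma continuous_map_edge_pt:
  assumes e: "e \<in> arcs G"
  shows "continuous_map (top_of_set {0..l e}) mtopology (edge_pt G l e)"
  unfolding continuous_map_to_metric
proof (intro ballI allI impI)
  fix x \<epsilon> :: real assume x: "x \<in> topspace (top_of_set {0..l e})" and \<epsilon>: "0 < \<epsilon>"
  have xe: "x \<in> {0..l e}" using x by simp
  have "edge_pt G l e y \<in> mball (edge_pt G l e x) \<epsilon>" if "y \<in> {0..l e} \<inter> ball x \<epsilon>" for y
    using that mg_dist_edge_pt_le[OF e xe, of y] edge_pt_in_mg_space[OF e] xe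
    by (auto simp: in_mball dist_real_def)
  moreover have "openin (top_of_set {0..l e}) ({0..l e} \<inter> ball x \<epsilon>)"
    by (rule openin_open_Int) simp
  moreover have "x \<in> {0..l e} \<inter> ball x \<epsilon>" using xe \<epsilon> by simp
  ultimately show "\<exists>U. openin (top_of_set {0..l e}) U \<and> x \<in> U \<and> (\<forall>y\<in>U. edge_pt G l e y \<in> mball (edge_pt G l e x) \<epsilon>)"
    by blast
qed

lemma compactin_mg_space: "compactin mtopology (mg_space G l)"
proof -
  have "compactin mtopology (edge_pt G l e ` {0..l e})" if "e \<in> arcs G" for e
    using continuous_map_edge_pt[OF that]
    by (intro image_compactin) (auto simp: compactin_subtopology)
  moreover have "compactin mtopology (Vertex ` verts G)"
  proof -
    have "Vertex ` verts G \<subseteq> mg_space G l" by (auto simp: mg_space_def)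
    then show ?thesis by (intro finite_imp_compactin) simp_all
  qed
  ultimately have "compactin mtopology (Vertex ` verts G \<union> \<Union>((\<lambda>e. edge_pt G l e ` {0..l e}) ` arcs G))"
    by (intro compactin_Un compactin_Union) auto
  then show ?thesis using mg_space_eq by simp
qed

lemma diameter_bound:
  obtains D where "0 < D" "\<And>x y. x \<in> mg_space G l \<Longrightarrow> y \<in> mg_space G l \<Longrightarrow> mg_dist G l x y \<le> D"
  using compactin_imp_mbounded[OF compactin_mg_space] unfolding mbounded_alt_pos by blast

text \<open>Connectedness, as defined for digraphs, includes having a vertex. This keeps the suprema
  in the Hoelder norms from ranging over an empty set.\<close>

lemma mg_space_nonempty: "mg_space G l \<noteq> {}"
  using connected_graph by (auto simp: mg_space_def Digraph_Component.connected_def strongly_connected_def mk_symmetric_def)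

section \<open>The continuous representative\<close>

definition edge_points :: "('v, 'e) mg_point set" where
  "edge_points = (\<Union>e\<in>arcs G. edge_pt G l e ` {0..l e})"

lemma edge_pt_in_edge_points: "e \<in> arcs G \<Longrightarrow> t \<in> {0..l e} \<Longrightarrow> edge_pt G l e t \<in> edge_points"
  unfolding edge_points_def by blast

text \<open>Only a graph without edges has points that lie on no edge; it is then a single vertex.\<close>

lemma edge_pointsI:
  assumes "x \<in> mg_space G l" "y \<in> mg_space G l" "x \<noteq> y"
  shows "x \<in> edge_points"
proof -
  obtain ps where ps: "mg_path G l x ps y" using mg_path_exists[OF assms(1,2)] by blast
  show ?thesis
  proof (cases ps)
    case Nil
    then show ?thesis using ps assms(3) by simp
  next
    case (Cons q qs)
    obtain e s t where "q = (e, s, t)" by (cases q)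
    then have "e \<in> arcs G" "s \<in> {0..l e}" "x = edge_pt G l e s" using ps Cons by auto
    then show ?thesis using edge_pt_in_edge_points by simp
  qed
qed

lemma edge_points_subset: "x \<in> edge_points \<Longrightarrow> x \<in> mg_space G l"
  by (auto simp: edge_points_def intro: edge_pt_in_mg_space)

text \<open>A vertex has a coordinate on every incident edge, and two on a loop. A choice that
  depends on the point alone keeps the averages linear in the function.\<close>

definition edge_coord :: "('v, 'e) mg_point \<Rightarrow> 'e \<times> real" where
  "edge_coord x = (SOME z. fst z \<in> arcs G \<and> snd z \<in> {0..l (fst z)} \<and> edge_pt G l (fst z) (snd z) = x)"

lemma edge_coord:
  assumes "x \<in> edge_points"
  shows "fst (edge_coord x) \<in> arcs G" "snd (edge_coord x) \<in> {0..l (fst (edge_coord x))}"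
    "edge_pt G l (fst (edge_coord x)) (snd (edge_coord x)) = x"
proof -
  have "\<exists>z. fst z \<in> arcs G \<and> snd z \<in> {0..l (fst z)} \<and> edge_pt G l (fst z) (snd z) = x"
  proof -
    obtain e t where "e \<in> arcs G" "t \<in> {0..l e}" "x = edge_pt G l e t"
      using assms unfolding edge_points_def by blast
    then show ?thesis by (intro exI[of _ "(e, t)"]) simp
  qed
  from someI_ex[OF this] show "fst (edge_coord x) \<in> arcs G" "snd (edge_coord x) \<in> {0..l (fst (edge_coord x))}"
    "edge_pt G l (fst (edge_coord x)) (snd (edge_coord x)) = x"
    unfolding edge_coord_def by blast+
qed

lemma edge_coord_interior:
  assumes e: "e \<in> arcs G" and t: "0 < t" "t < l e"
  shows "edge_coord (edge_pt G l e t) = (e, t)"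
proof -
  have "edge_pt G l e t \<in> edge_points" using e t by (intro edge_pt_in_edge_points) auto
  from edge_coord(3)[OF this] have "fst (edge_coord (edge_pt G l e t)) = e" "snd (edge_coord (edge_pt G l e t)) = t"
    using t by (auto simp: edge_pt_def split: if_splits)
  then show ?thesis by (simp add: prod_eq_iff)
qed

definition point_average :: "(('v, 'e) mg_point \<Rightarrow> real) \<Rightarrow> nat \<Rightarrow> ('v, 'e) mg_point \<Rightarrow> real" where
  "point_average f n x = edge_average f (fst (edge_coord x)) n
     (cell_index (l (fst (edge_coord x))) n (snd (edge_coord x)))"

text \<open>Linearity is required as an identity of functions on the whole type, so points off the
  edges, including those outside the graph, receive the linear choice 0.\<close>

definition cont_rep :: "(('v, 'e) mg_point \<Rightarrow> real) \<Rightarrow> ('v, 'e) mg_point \<Rightarrow> real" where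
  "cont_rep f x = (if x \<in> edge_points then lim (\<lambda>n. point_average f n x) else 0)"

lemma point_average_diff_le:
  assumes p: "1 \<le> p" "0 < \<alpha>" and E: "0 \<le> E" and D: "0 \<le> D"
  obtains B where "0 \<le> B"
    "\<And>f x y n m. f \<in> fst (Lebesgue_space G l p) \<Longrightarrow> frac_seminorm_pow G l \<alpha> p f \<le> ennreal E \<Longrightarrow>
      x \<in> edge_points \<Longrightarrow> y \<in> edge_points \<Longrightarrow> mg_dist G l x y \<le> D / 2 ^ n \<Longrightarrow> m = n \<or> m = Suc n \<Longrightarrow>
      \<bar>point_average f m x - point_average f n y\<bar> \<le> B * (2 powr (1 / p - \<alpha>)) ^ n"
proof -
  obtain a b where ab: "0 < a" "0 < b" "\<And>e. e \<in> arcs G \<Longrightarrow> a \<le> l e \<and> l e \<le> b"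
    using length_bounds by blast
  show thesis
  proof (rule that[of "(2 * E * (2 * b + D) powr (1 + \<alpha> * p) / a\<^sup>2) powr (1 / p)"])
    fix f x y and n m :: nat
    assume f: "f \<in> fst (Lebesgue_space G l p)" "frac_seminorm_pow G l \<alpha> p f \<le> ennreal E"
      and x: "x \<in> edge_points" and y: "y \<in> edge_points" and d: "mg_dist G l x y \<le> D / 2 ^ n" and m: "m = n \<or> m = Suc n"
    show "\<bar>point_average f m x - point_average f n y\<bar>
        \<le> (2 * E * (2 * b + D) powr (1 + \<alpha> * p) / a\<^sup>2) powr (1 / p) * (2 powr (1 / p - \<alpha>)) ^ n"
      unfolding point_average_def
      by (rule edge_average_diff_le[OF p f(1) E f(2) ab edge_coord(1,2)[OF x] edge_coord(1,2)[OF y] D _ m])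
        (assumption, subst edge_coord(3)[OF x], subst edge_coord(3)[OF y], rule d)
  qed simp
qed

text \<open>An argument in the style of Campanato. At the level \<open>n\<close> where
  \<open>D / 2 ^ n\<close> is comparable to the distance of \<open>x\<close> and \<open>y\<close>,
  both limits are within \<open>K * \<sigma> ^ n\<close> of their averages, and the averages differ
  by at most \<open>B * \<sigma> ^ n\<close>. Finally \<open>\<sigma> ^ n\<close> is the power
  \<open>\<alpha> - 1 / p\<close> of the scale \<open>1 / 2 ^ n\<close>.\<close>

lemma cont_rep_bounds:
  assumes p: "1 \<le> p" "0 < \<alpha>" and \<beta>: "1 / p < \<alpha>" and E: "0 \<le> E"
  obtains B H where "0 \<le> B" "0 \<le> H"
    "\<And>f x n. f \<in> fst (Lebesgue_space G l p) \<Longrightarrow> frac_seminorm_pow G l \<alpha> p f \<le> ennreal E \<Longrightarrow> x \<in> edge_points \<Longrightarrow>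
      \<bar>point_average f (Suc n) x - point_average f n x\<bar> \<le> B * (2 powr (1 / p - \<alpha>)) ^ n"
    "\<And>f x y. f \<in> fst (Lebesgue_space G l p) \<Longrightarrow> frac_seminorm_pow G l \<alpha> p f \<le> ennreal E \<Longrightarrow>
      x \<in> mg_space G l \<Longrightarrow> y \<in> mg_space G l \<Longrightarrow> \<bar>cont_rep f x - cont_rep f y\<bar> \<le> H * mg_dist G l x y powr (\<alpha> - 1 / p)"
proof -
  define \<sigma> where "\<sigma> = (2::real) powr (1 / p - \<alpha>)"
  have "\<sigma> < 2 powr 0" unfolding \<sigma>_def using \<beta> by (intro powr_less_mono) auto
  then have \<sigma>: "0 < \<sigma>" "\<sigma> < 1" by (simp_all add: \<sigma>_def)
  obtain D where D: "0 < D" "\<And>x y. x \<in> mg_space G l \<Longrightarrow> y \<in> mg_space G l \<Longrightarrow> mg_dist G l x y \<le> D"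
    by (rule diameter_bound) blast
  obtain B where B: "0 \<le> B"
    and diff: "\<And>f x y n m. f \<in> fst (Lebesgue_space G l p) \<Longrightarrow> frac_seminorm_pow G l \<alpha> p f \<le> ennreal E \<Longrightarrow>
      x \<in> edge_points \<Longrightarrow> y \<in> edge_points \<Longrightarrow> mg_dist G l x y \<le> D / 2 ^ n \<Longrightarrow> m = n \<or> m = Suc n \<Longrightarrow>
      \<bar>point_average f m x - point_average f n y\<bar> \<le> B * \<sigma> ^ n"
    unfolding \<sigma>_def by (rule point_average_diff_le[OF p E less_imp_le[OF D(1)]]) blast
  define K where "K = B / (1 - \<sigma>)"
  \<comment> \<open>Two tails \<open>K\<close> and one comparison \<open>B\<close>; the factor
    \<open>2 / D\<close> converts the scale, since \<open>1 / 2 ^ n\<close> is at most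
    \<open>2 / D\<close> times the distance.\<close>
  define H where "H = (2 * K + B) * (2 / D) powr (\<alpha> - 1 / p)"
  have K: "0 \<le> K" using B \<sigma> by (simp add: K_def)
  have H: "0 \<le> H" using B K by (simp add: H_def)
  show thesis
  proof (rule that[OF B H])
    fix f assume f: "f \<in> fst (Lebesgue_space G l p)" "frac_seminorm_pow G l \<alpha> p f \<le> ennreal E"
    have step: "\<bar>point_average f (Suc n) x - point_average f n x\<bar> \<le> B * \<sigma> ^ n" if x: "x \<in> edge_points" for x n
      by (rule diff[OF f x x]) (use D(1) edge_points_subset[OF x] in auto)
    then show "\<bar>point_average f (Suc n) x - point_average f n x\<bar> \<le> B * (2 powr (1 / p - \<alpha>)) ^ n"
      if x: "x \<in> edge_points" for x n using x unfolding \<sigma>_def .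
    have rep: "\<bar>cont_rep f x - point_average f n x\<bar> \<le> K * \<sigma> ^ n" if x: "x \<in> edge_points" for x n
      using geometric_chain_limit(2)[OF step[OF x] \<sigma> B, of n] x by (simp add: cont_rep_def K_def)
    fix x y assume x: "x \<in> mg_space G l" and y: "y \<in> mg_space G l"
    show "\<bar>cont_rep f x - cont_rep f y\<bar> \<le> H * mg_dist G l x y powr (\<alpha> - 1 / p)"
    proof (cases "x = y")
      case True
      then show ?thesis using H by simp
    next
      case False
      define d where "d = mg_dist G l x y"
      have d: "0 < d" "d \<le> D" using mg_dist_pos[OF x y False] D(2)[OF x y] by (simp_all add: d_def)
      have xy: "x \<in> edge_points" "y \<in> edge_points"
        using edge_pointsI[OF x y False] edge_pointsI[OF y x] False by auto
      obtain N where "(1 / 2) ^ N < d / D" using real_arch_pow_inv[of "d / D" "1 / 2"] d D by auto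
      then have ex: "D / 2 ^ N < d" using D by (simp add: field_simps)
      \<comment> \<open>The first level finer than the distance. It is not 0 because the distance is
        at most \<open>D\<close>, so its predecessor \<open>n\<close> is the last level with the
        distance at most \<open>D / 2 ^ n\<close>.\<close>
      define N0 where "N0 = (LEAST N. D / 2 ^ N < d)"
      have N0: "D / 2 ^ N0 < d" unfolding N0_def using ex by (rule LeastI)
      obtain n where n: "N0 = Suc n" using N0 d by (cases N0) auto
      have dn: "d \<le> D / 2 ^ n" using not_less_Least[of n "\<lambda>N. D / 2 ^ N < d"] n unfolding N0_def by simp
      have "1 / 2 ^ n \<le> 2 / D * d" using N0 n D by (simp add: field_simps)
      then have "(1 / 2 ^ n) powr (\<alpha> - 1 / p) \<le> (2 / D * d) powr (\<alpha> - 1 / p)"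
        using \<beta> by (intro powr_mono2) auto
      also have "\<dots> = (2 / D) powr (\<alpha> - 1 / p) * d powr (\<alpha> - 1 / p)" by (rule powr_mult)
      also have "(1 / 2 ^ n) powr (\<alpha> - 1 / p) = \<sigma> ^ n"
      proof -
        have "1 / 2 ^ n = (2::real) powr - real n" by (simp add: powr_minus powr_realpow divide_inverse)
        then show ?thesis by (simp add: \<sigma>_def powr_powr powr_power algebra_simps)
      qed
      finally have \<sigma>n: "\<sigma> ^ n \<le> (2 / D) powr (\<alpha> - 1 / p) * d powr (\<alpha> - 1 / p)" .
      have "\<bar>point_average f n x - point_average f n y\<bar> \<le> B * \<sigma> ^ n"
        using dn by (intro diff[OF f xy]) (auto simp: d_def)
      then have "\<bar>cont_rep f x - cont_rep f y\<bar> \<le> K * \<sigma> ^ n + K * \<sigma> ^ n + B * \<sigma> ^ n"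
        using rep[OF xy(1), of n] rep[OF xy(2), of n] by linarith
      also have "\<dots> = (2 * K + B) * \<sigma> ^ n" by (simp add: algebra_simps)
      also have "\<dots> \<le> (2 * K + B) * ((2 / D) powr (\<alpha> - 1 / p) * d powr (\<alpha> - 1 / p))"
        using \<sigma>n B K by (intro mult_left_mono) auto
      finally show ?thesis by (simp add: H_def d_def mult.assoc)
    qed
  qed
qed

lemma point_average_tendsto_cont_rep:
  assumes p: "1 \<le> p" "0 < \<alpha>" and \<beta>: "1 / p < \<alpha>" and f: "f \<in> fst (Sobolev_space G l \<alpha> p)" and x: "x \<in> edge_points"
  shows "(\<lambda>n. point_average f n x) \<longlonglongrightarrow> cont_rep f x"
proof -
  define E where "E = snd (Sobolev_space G l \<alpha> p) f powr p"
  have E: "0 \<le> E" "frac_seminorm_pow G l \<alpha> p f \<le> ennreal E"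
    using Sobolev_space_bounds(1)[OF p f order_refl] by (simp_all add: E_def)
  obtain B where B: "0 \<le> B" and step: "\<And>f x n. f \<in> fst (Lebesgue_space G l p) \<Longrightarrow> frac_seminorm_pow G l \<alpha> p f \<le> ennreal E \<Longrightarrow> x \<in> edge_points \<Longrightarrow>
      \<bar>point_average f (Suc n) x - point_average f n x\<bar> \<le> B * (2 powr (1 / p - \<alpha>)) ^ n"
    by (rule cont_rep_bounds[OF p \<beta> E(1)]) blast
  have \<sigma>: "(2::real) powr (1 / p - \<alpha>) < 1" using powr_less_mono[of "1 / p - \<alpha>" 0 2] \<beta> by simp
  have "(\<lambda>n. point_average f n x) \<longlonglongrightarrow> lim (\<lambda>n. point_average f n x)"
    by (rule geometric_chain_limit(1)[OF step[OF Sobolev_subset_Lebesgue[OF f] E(2) x] _ \<sigma> B]) simp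
  then show ?thesis using x by (simp add: cont_rep_def)
qed

text \<open>At interior points \<open>edge_coord\<close> has no choice, so
  \<open>point_average\<close> is the average on the edge itself, which converges to
  \<open>f\<close> almost everywhere.\<close>

lemma cont_rep_ae_eq:
  assumes p: "1 \<le> p" "0 < \<alpha>" and f: "f \<in> fst (Sobolev_space G l \<alpha> p)"
  shows "mg_ae_eq G l (cont_rep f) f"
  unfolding mg_ae_eq_def
proof
  fix e assume e: "e \<in> arcs G"
  have E: "frac_seminorm_pow G l \<alpha> p f \<le> ennreal (snd (Sobolev_space G l \<alpha> p) f powr p)"
    using Sobolev_space_bounds(1)[OF p f order_refl] .
  have "AE t in lebesgue_on {0..l e}. t \<in> {0..l e}" by (rule AE_I2) simp
  with edge_average_AE_tendsto[OF p Sobolev_subset_Lebesgue[OF f] e powr_ge_zero E] AE_interval_not_endpoint[of "l e"]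
  show "AE t in lebesgue_on {0..l e}. cont_rep f (edge_pt G l e t) = f (edge_pt G l e t)"
  proof (eventually_elim, simp)
    fix t assume lim: "(\<lambda>n. edge_average f e n (cell_index (l e) n t)) \<longlonglongrightarrow> f (edge_pt G l e t)"
      and t: "t \<noteq> 0 \<and> t \<noteq> l e" "0 \<le> t \<and> t \<le> l e"
    have "edge_pt G l e t \<in> edge_points" using e t by (intro edge_pt_in_edge_points) auto
    moreover have "point_average f n (edge_pt G l e t) = edge_average f e n (cell_index (l e) n t)" for n
      unfolding point_average_def using edge_coord_interior[OF e, of t] t by simp
    ultimately show "cont_rep f (edge_pt G l e t) = f (edge_pt G l e t)"
      using limI[OF lim] by (simp add: cont_rep_def)
  qed
qed

lemma point_average_add:
  assumes p: "1 \<le> p" and f: "f \<in> fst (Lebesgue_space G l p)" and g: "g \<in> fst (Lebesgue_space G l p)" and x: "x \<in> edge_points"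
  shows "point_average (\<lambda>x. f x + g x) n x = point_average f n x + point_average g n x"
  unfolding point_average_def dyadic_average_def
  by (intro average_add set_integrable_dyadic_cell Lebesgue_space_edge_integrable[OF p] f g edge_coord(1)[OF x])

lemma point_average_cmult: "point_average (\<lambda>x. c * f x) n x = c * point_average f n x"
  unfolding point_average_def dyadic_average_def by (rule average_cmult)

text \<open>The averages converge at every point of every edge, not only almost everywhere; hence
  \<open>lim\<close> is additive pointwise and no null set appears.\<close>

lemma cont_rep_add:
  assumes p: "1 \<le> p" "0 < \<alpha>" and \<beta>: "1 / p < \<alpha>" and f: "f \<in> fst (Sobolev_space G l \<alpha> p)" and g: "g \<in> fst (Sobolev_space G l \<alpha> p)"
  shows "cont_rep (\<lambda>x. f x + g x) = (\<lambda>x. cont_rep f x + cont_rep g x)"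
proof
  fix x show "cont_rep (\<lambda>x. f x + g x) x = cont_rep f x + cont_rep g x"
  proof (cases "x \<in> edge_points")
    case True
    have "(\<lambda>n. point_average (\<lambda>x. f x + g x) n x) \<longlonglongrightarrow> cont_rep f x + cont_rep g x"
      using tendsto_add[OF point_average_tendsto_cont_rep[OF p \<beta> f True] point_average_tendsto_cont_rep[OF p \<beta> g True]]
        point_average_add[OF p(1) Sobolev_subset_Lebesgue[OF f] Sobolev_subset_Lebesgue[OF g] True] by simp
    then show ?thesis using True limI by (simp add: cont_rep_def)
  qed (simp add: cont_rep_def)
qed

lemma cont_rep_cmult:
  assumes p: "1 \<le> p" "0 < \<alpha>" and \<beta>: "1 / p < \<alpha>" and f: "f \<in> fst (Sobolev_space G l \<alpha> p)"
  shows "cont_rep (\<lambda>x. c * f x) = (\<lambda>x. c * cont_rep f x)"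
proof
  fix x show "cont_rep (\<lambda>x. c * f x) x = c * cont_rep f x"
  proof (cases "x \<in> edge_points")
    case True
    have "(\<lambda>n. point_average (\<lambda>x. c * f x) n x) \<longlonglongrightarrow> c * cont_rep f x"
      using tendsto_mult_left[OF point_average_tendsto_cont_rep[OF p \<beta> f True], of c] by (simp add: point_average_cmult)
    then show ?thesis using True limI by (simp add: cont_rep_def)
  qed (simp add: cont_rep_def)
qed

section \<open>Hoelder spaces\<close>

lemma Hoelder_space_pos:
  "lam \<noteq> 0 \<Longrightarrow> f \<in> fst (Hoelder_space G l lam) \<longleftrightarrow>
    (\<exists>C. \<forall>x\<in>mg_space G l. \<forall>y\<in>mg_space G l. \<bar>f x - f y\<bar> \<le> C * mg_dist G l x y powr lam)"
  by (simp add: Hoelder_space_def)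

text \<open>Covers the diagonal as well: there the quotient is a division by zero, hence 0, and
  \<open>0 \<le> C\<close> is what remains to be used.\<close>

lemma Hoelder_quotient_le:
  assumes "x \<in> mg_space G l" "y \<in> mg_space G l" "0 \<le> C" "\<bar>z\<bar> \<le> C * mg_dist G l x y powr lam"
  shows "\<bar>z\<bar> / mg_dist G l x y powr lam \<le> C"
proof (cases "mg_dist G l x y powr lam = 0")
  case True
  then show ?thesis using assms(3) by simp
next
  case False
  then have "0 < mg_dist G l x y powr lam" by (simp add: order_less_le)
  then show ?thesis using assms(4) by (simp add: divide_le_eq)
qed

text \<open>A real supremum carries information only on a bounded set. Boundedness comes from
  compactness of the graph for continuous functions, and from its finite diameter for positive
  order.\<close>

lemma Hoelder_space_bdd:
  assumes lam: "0 \<le> lam" and f: "f \<in> fst (Hoelder_space G l lam)"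
  shows "bdd_above ((\<lambda>x. \<bar>f x\<bar>) ` mg_space G l)"
proof (cases "lam = 0")
  case True
  then have "continuous_map mtopology euclideanreal f" using f by (simp add: Hoelder_space_def)
  then have "compactin euclideanreal (f ` mg_space G l)" by (rule image_compactin[OF compactin_mg_space])
  then have "bounded (f ` mg_space G l)" by (simp add: compact_imp_bounded)
  then show ?thesis by (simp add: bdd_above_norm[symmetric] image_image)
next
  case False
  then obtain C where C: "\<And>x y. x \<in> mg_space G l \<Longrightarrow> y \<in> mg_space G l \<Longrightarrow> \<bar>f x - f y\<bar> \<le> C * mg_dist G l x y powr lam"
    using f Hoelder_space_pos by blast
  obtain D where D: "0 < D" "\<And>x y. x \<in> mg_space G l \<Longrightarrow> y \<in> mg_space G l \<Longrightarrow> mg_dist G l x y \<le> D"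
    by (rule diameter_bound) blast
  obtain x0 where x0: "x0 \<in> mg_space G l" using mg_space_nonempty by blast
  have "\<bar>f x\<bar> \<le> \<bar>f x0\<bar> + \<bar>C\<bar> * D powr lam" if x: "x \<in> mg_space G l" for x
  proof -
    have "\<bar>f x - f x0\<bar> \<le> C * mg_dist G l x x0 powr lam" by (rule C[OF x x0])
    also have "\<dots> \<le> \<bar>C\<bar> * D powr lam"
      using lam D(2)[OF x x0] by (intro mult_mono powr_mono2) auto
    finally show ?thesis by linarith
  qed
  then show ?thesis unfolding bdd_above_def by blast
qed

text \<open>Kept signed, and thus linear in \<open>f\<close>, so that \<open>cSUP_abs_add_le\<close>
  applies to both suprema in the norm.\<close>

abbreviation hoelder_quotient :: "real \<Rightarrow> (('v, 'e) mg_point \<Rightarrow> real) \<Rightarrow> ('v, 'e) mg_point \<times> ('v, 'e) mg_point \<Rightarrow> real" where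
  "hoelder_quotient lam f z \<equiv> (f (fst z) - f (snd z)) / mg_dist G l (fst z) (snd z) powr lam"

lemma Hoelder_space_bdd_quotient:
  assumes lam: "lam \<noteq> 0" and f: "f \<in> fst (Hoelder_space G l lam)"
  shows "bdd_above ((\<lambda>z. \<bar>hoelder_quotient lam f z\<bar>) ` (mg_space G l \<times> mg_space G l))"
proof -
  obtain C where C: "\<And>x y. x \<in> mg_space G l \<Longrightarrow> y \<in> mg_space G l \<Longrightarrow> \<bar>f x - f y\<bar> \<le> C * mg_dist G l x y powr lam"
    using f Hoelder_space_pos[OF lam] by blast
  have "\<bar>hoelder_quotient lam f (x, y)\<bar> \<le> \<bar>C\<bar>" if "x \<in> mg_space G l" "y \<in> mg_space G l" for x y
  proof -
    have "\<bar>f x - f y\<bar> \<le> \<bar>C\<bar> * mg_dist G l x y powr lam"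
      by (rule order_trans[OF C[OF that]]) (intro mult_right_mono, auto)
    then show ?thesis using Hoelder_quotient_le[OF that] by (simp add: abs_divide)
  qed
  then show ?thesis unfolding bdd_above_def by auto
qed

lemma Hoelder_norm_eq:
  "snd (Hoelder_space G l lam) f = (SUP x\<in>mg_space G l. \<bar>f x\<bar>) +
    (if lam = 0 then 0 else SUP z\<in>mg_space G l \<times> mg_space G l. \<bar>hoelder_quotient lam f z\<bar>)"
  by (simp add: Hoelder_space_def sup_norm_def case_prod_beta abs_divide)

lemma quasi_pseudometric_Hoelder_space:
  assumes lam: "0 \<le> lam"
  shows "quasi_pseudometric (seminorm_topology (Hoelder_space G l lam)) (fst (Hoelder_space G l lam))
    (\<lambda>f g. snd (Hoelder_space G l lam) (\<lambda>x. f x - g x)) 1"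
proof
  let ?Y = "Hoelder_space G l lam" and ?S = "mg_space G l"
  note ne = mg_space_nonempty
  have nep: "?S \<times> ?S \<noteq> {}" using ne by simp
  have bdd: "bdd_above ((\<lambda>x. \<bar>f x - g x\<bar>) ` ?S)" if "f \<in> fst ?Y" "g \<in> fst ?Y" for f g
    by (rule bdd_above_abs_diff[OF Hoelder_space_bdd[OF lam that(1)] Hoelder_space_bdd[OF lam that(2)]]) simp
  have bddq: "bdd_above ((\<lambda>z. \<bar>hoelder_quotient lam (\<lambda>x. f x - g x) z\<bar>) ` (?S \<times> ?S))"
    if "lam \<noteq> 0" "f \<in> fst ?Y" "g \<in> fst ?Y" for f g
    by (rule bdd_above_abs_diff[OF Hoelder_space_bdd_quotient[OF that(1,2)] Hoelder_space_bdd_quotient[OF that(1,3)]])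
      (simp add: diff_divide_distrib)
  show "openin (seminorm_topology ?Y) U \<longleftrightarrow> U \<subseteq> fst ?Y \<and>
     (\<forall>f\<in>U. \<exists>r>0. \<forall>g\<in>fst ?Y. snd ?Y (\<lambda>x. g x - f x) < r \<longrightarrow> g \<in> U)" for U
    by (rule openin_seminorm_topology)
  fix f g h assume f: "f \<in> fst ?Y" and g: "g \<in> fst ?Y"
  show "snd ?Y (\<lambda>x. f x - f x) = 0"
    unfolding Hoelder_norm_eq using ne nep by simp
  show "snd ?Y (\<lambda>x. f x - g x) = snd ?Y (\<lambda>x. g x - f x)"
  proof -
    have "(\<lambda>x. \<bar>f x - g x\<bar>) = (\<lambda>x. \<bar>g x - f x\<bar>)" by (simp add: abs_minus_commute)
    moreover have "(\<lambda>z. \<bar>hoelder_quotient lam (\<lambda>x. f x - g x) z\<bar>) = (\<lambda>z. \<bar>hoelder_quotient lam (\<lambda>x. g x - f x) z\<bar>)"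
    proof
      fix z
      have "hoelder_quotient lam (\<lambda>x. g x - f x) z = - hoelder_quotient lam (\<lambda>x. f x - g x) z"
        by (simp add: minus_divide_left)
      then show "\<bar>hoelder_quotient lam (\<lambda>x. f x - g x) z\<bar> = \<bar>hoelder_quotient lam (\<lambda>x. g x - f x) z\<bar>"
        by (simp only: abs_minus_cancel)
    qed
    ultimately show ?thesis by (simp only: Hoelder_norm_eq)
  qed
  obtain x0 where x0: "x0 \<in> ?S" using ne by blast
  have "0 \<le> (SUP x\<in>?S. \<bar>f x - g x\<bar>)"
    by (rule order_trans[OF abs_ge_zero cSUP_upper[OF x0 bdd[OF f g]]])
  moreover have "0 \<le> (SUP z\<in>?S \<times> ?S. \<bar>hoelder_quotient lam (\<lambda>x. f x - g x) z\<bar>)" if "lam \<noteq> 0"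
    by (rule order_trans[OF abs_ge_zero cSUP_upper[OF _ bddq[OF that f g]]]) (use x0 in blast)
  ultimately show "0 \<le> snd ?Y (\<lambda>x. f x - g x)"
    unfolding Hoelder_norm_eq by simp
  assume h: "h \<in> fst ?Y"
  have "(SUP x\<in>?S. \<bar>f x - h x\<bar>) \<le> (SUP x\<in>?S. \<bar>f x - g x\<bar>) + (SUP x\<in>?S. \<bar>g x - h x\<bar>)"
    by (rule cSUP_abs_add_le[OF ne bdd[OF f g] bdd[OF g h]]) simp
  moreover have "(SUP z\<in>?S \<times> ?S. \<bar>hoelder_quotient lam (\<lambda>x. f x - h x) z\<bar>)
      \<le> (SUP z\<in>?S \<times> ?S. \<bar>hoelder_quotient lam (\<lambda>x. f x - g x) z\<bar>) + (SUP z\<in>?S \<times> ?S. \<bar>hoelder_quotient lam (\<lambda>x. g x - h x) z\<bar>)"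
    if "lam \<noteq> 0"
    by (rule cSUP_abs_add_le[OF nep bddq[OF that f g] bddq[OF that g h]]) (simp add: add_divide_distrib[symmetric])
  ultimately show "snd ?Y (\<lambda>x. f x - h x) \<le> 1 * (snd ?Y (\<lambda>x. f x - g x) + snd ?Y (\<lambda>x. g x - h x))"
    unfolding Hoelder_norm_eq by (cases "lam = 0") auto
qed simp

lemma Hoelder_space_mem:
  assumes lam: "0 \<le> lam" "lam < \<beta>" and H: "0 \<le> H"
    and f: "\<And>x y. x \<in> mg_space G l \<Longrightarrow> y \<in> mg_space G l \<Longrightarrow> \<bar>f x - f y\<bar> \<le> H * mg_dist G l x y powr \<beta>"
  shows "f \<in> fst (Hoelder_space G l lam)"
proof (cases "lam = 0")
  case True
  have \<beta>: "0 < \<beta>" using lam by simp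
  have "continuous_map mtopology euclideanreal f"
    unfolding continuous_map_from_metric
  proof (intro conjI ballI allI impI)
    fix a U assume a: "a \<in> mg_space G l" and U: "openin euclideanreal U \<and> f a \<in> U"
    then obtain \<epsilon> where \<epsilon>: "0 < \<epsilon>" "\<And>y. dist y (f a) < \<epsilon> \<Longrightarrow> y \<in> U"
      by (auto simp: open_dist)
    \<comment> \<open>Makes \<open>H * r powr \<beta>\<close> strictly smaller than \<epsilon>,
      including for \<open>H = 0\<close>.\<close>
    define r where "r = (\<epsilon> / (H + 1)) powr (1 / \<beta>)"
    have r: "0 < r" "r powr \<beta> = \<epsilon> / (H + 1)" using \<epsilon> H \<beta> by (simp_all add: r_def powr_powr)
    have "f x \<in> U" if x: "x \<in> mg_space G l \<and> mg_dist G l a x < r" for x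
    proof (rule \<epsilon>(2))
      have "\<bar>f x - f a\<bar> \<le> H * mg_dist G l x a powr \<beta>" using f x a by blast
      also have "\<dots> \<le> H * r powr \<beta>"
        using x H \<beta> commute[of a x] by (intro mult_left_mono powr_mono2) auto
      also have "\<dots> < \<epsilon>" using \<epsilon> H by (simp add: r field_simps)
      finally show "dist (f x) (f a) < \<epsilon>" by (simp add: dist_real_def)
    qed
    then show "\<exists>r>0. \<forall>x. x \<in> mg_space G l \<and> mg_dist G l a x < r \<longrightarrow> f x \<in> U"
      using r(1) by blast
  qed simp
  then show ?thesis using True by (simp add: Hoelder_space_def)
next
  case False
  obtain D where D: "0 < D" "\<And>x y. x \<in> mg_space G l \<Longrightarrow> y \<in> mg_space G l \<Longrightarrow> mg_dist G l x y \<le> D"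
    by (rule diameter_bound) blast
  have "\<bar>f x - f y\<bar> \<le> (H * D powr (\<beta> - lam)) * mg_dist G l x y powr lam"
    if x: "x \<in> mg_space G l" and y: "y \<in> mg_space G l" for x y
  proof -
    have "\<bar>f x - f y\<bar> \<le> H * mg_dist G l x y powr \<beta>" by (rule f[OF x y])
    \<comment> \<open>The surplus power \<open>\<beta> - lam\<close> of the distance is absorbed by
      the diameter.\<close>
    also have "mg_dist G l x y powr \<beta> = mg_dist G l x y powr (\<beta> - lam) * mg_dist G l x y powr lam"
      by (simp add: powr_add[symmetric])
    also have "H * (mg_dist G l x y powr (\<beta> - lam) * mg_dist G l x y powr lam)
        \<le> H * (D powr (\<beta> - lam) * mg_dist G l x y powr lam)"
      using H lam D(2)[OF x y] by (intro mult_left_mono mult_right_mono powr_mono2) auto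
    finally show ?thesis by (simp add: mult.assoc)
  qed
  then show ?thesis using Hoelder_space_pos[OF False] by blast
qed

lemma Hoelder_norm_interpolate:
  assumes lam: "0 \<le> lam" "lam < \<beta>" and H: "0 \<le> H" and s: "0 \<le> s"
    and sup: "\<And>x. x \<in> mg_space G l \<Longrightarrow> \<bar>f x\<bar> \<le> s"
    and f: "\<And>x y. x \<in> mg_space G l \<Longrightarrow> y \<in> mg_space G l \<Longrightarrow> \<bar>f x - f y\<bar> \<le> H * mg_dist G l x y powr \<beta>"
  shows "snd (Hoelder_space G l lam) f \<le> s + (2 * s) powr (1 - lam / \<beta>) * H powr (lam / \<beta>)"
proof -
  have "(SUP x\<in>mg_space G l. \<bar>f x\<bar>) \<le> s"
    using mg_space_nonempty sup by (rule cSUP_least)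
  moreover have "(SUP z\<in>mg_space G l \<times> mg_space G l. \<bar>hoelder_quotient lam f z\<bar>) \<le> (2 * s) powr (1 - lam / \<beta>) * H powr (lam / \<beta>)"
    if lam0: "lam \<noteq> 0"
  proof (rule cSUP_least)
    fix z assume "z \<in> mg_space G l \<times> mg_space G l"
    then obtain x y where z: "z = (x, y)" and x: "x \<in> mg_space G l" and y: "y \<in> mg_space G l" by blast
    \<comment> \<open>One part of the difference is bounded by the supremum norm, the other by the
      Hoelder condition, with the exponent \<open>lam / \<beta>\<close> chosen so that exactly
      \<open>mg_dist G l x y powr lam\<close> appears.\<close>
    have "\<bar>f x - f y\<bar> = \<bar>f x - f y\<bar> powr (1 - lam / \<beta>) * \<bar>f x - f y\<bar> powr (lam / \<beta>)"
      by (simp add: powr_add[symmetric])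
    also have "\<dots> \<le> (2 * s) powr (1 - lam / \<beta>) * (H * mg_dist G l x y powr \<beta>) powr (lam / \<beta>)"
      using lam f[OF x y] sup[OF x] sup[OF y] by (intro mult_mono powr_mono2) auto
    also have "\<dots> = ((2 * s) powr (1 - lam / \<beta>) * H powr (lam / \<beta>)) * mg_dist G l x y powr lam"
      using lam by (simp add: powr_mult powr_powr)
    finally have "\<bar>f x - f y\<bar> / mg_dist G l x y powr lam \<le> (2 * s) powr (1 - lam / \<beta>) * H powr (lam / \<beta>)"
      using x y by (intro Hoelder_quotient_le) auto
    then show "\<bar>hoelder_quotient lam f z\<bar> \<le> (2 * s) powr (1 - lam / \<beta>) * H powr (lam / \<beta>)"
      by (simp add: z abs_divide)
  qed (use mg_space_nonempty in simp)
  ultimately show ?thesis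
    unfolding Hoelder_norm_eq by (auto simp: add_increasing2)
qed

text \<open>A three-term estimate: both tails beyond level \<open>n\<close> are small uniformly in
  the point and in the function, and at level \<open>n\<close> all points together involve only
  finitely many averages. Off the edges both functions are 0.\<close>

lemma cont_rep_uniform_limit:
  assumes p: "1 \<le> p" "0 < \<alpha>" and \<beta>: "1 / p < \<alpha>"
    and F: "\<And>i. F i \<in> fst (Sobolev_space G l \<alpha> p)" "\<And>i. snd (Sobolev_space G l \<alpha> p) (F i) \<le> M"
  obtains f and r :: "nat \<Rightarrow> nat" where "strict_mono r"
    "\<And>\<epsilon>. 0 < \<epsilon> \<Longrightarrow> \<forall>\<^sub>F i in sequentially. \<forall>x\<in>mg_space G l. \<bar>cont_rep (F (r i)) x - f x\<bar> \<le> \<epsilon>"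
proof -
  define \<sigma> where "\<sigma> = (2::real) powr (1 / p - \<alpha>)"
  have "\<sigma> < 2 powr 0" unfolding \<sigma>_def using \<beta> by (intro powr_less_mono) auto
  then have \<sigma>: "0 < \<sigma>" "\<sigma> < 1" by (simp_all add: \<sigma>_def)
  obtain r A where r: "strict_mono (r :: nat \<Rightarrow> nat)"
    and A: "\<And>e n j. e \<in> arcs G \<Longrightarrow> j < 2 ^ n \<Longrightarrow> (\<lambda>i. edge_average (F (r i)) e n j) \<longlonglongrightarrow> A e n j"
    by (rule edge_average_convergent_subsequence[OF p, of F M, OF F]) blast
  have E: "0 \<le> M powr p" by simp
  obtain B where B: "0 \<le> B" and B_step: "\<And>f x n. f \<in> fst (Lebesgue_space G l p) \<Longrightarrow>
      frac_seminorm_pow G l \<alpha> p f \<le> ennreal (M powr p) \<Longrightarrow> x \<in> edge_points \<Longrightarrow>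
      \<bar>point_average f (Suc n) x - point_average f n x\<bar> \<le> B * \<sigma> ^ n"
    unfolding \<sigma>_def by (rule cont_rep_bounds[OF p \<beta> E]) blast
  have step: "\<bar>point_average (F i) (Suc n) x - point_average (F i) n x\<bar> \<le> B * \<sigma> ^ n" if "x \<in> edge_points" for i n x
    by (rule B_step[OF Sobolev_subset_Lebesgue[OF F(1)] Sobolev_space_bounds(1)[OF p F(1) F(2)] that])
  define a where "a n x = A (fst (edge_coord x)) n (cell_index (l (fst (edge_coord x))) n (snd (edge_coord x)))" for n x
  define f where "f x = (if x \<in> edge_points then lim (\<lambda>n. a n x) else 0)" for x
  define K where "K = B / (1 - \<sigma>)"
  have a_lim: "(\<lambda>i. point_average (F (r i)) n x) \<longlonglongrightarrow> a n x" if x: "x \<in> edge_points" for n x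
    unfolding point_average_def a_def by (rule A[OF edge_coord(1)[OF x] cell_index_less])
  have a_step: "\<bar>a (Suc n) x - a n x\<bar> \<le> B * \<sigma> ^ n" if x: "x \<in> edge_points" for n x
  proof (rule LIMSEQ_le_const2)
    show "(\<lambda>i. \<bar>point_average (F (r i)) (Suc n) x - point_average (F (r i)) n x\<bar>) \<longlonglongrightarrow> \<bar>a (Suc n) x - a n x\<bar>"
      by (intro tendsto_rabs tendsto_diff a_lim x)
  qed (use step[OF x] in blast)
  have f_a: "\<bar>f x - a n x\<bar> \<le> K * \<sigma> ^ n" if x: "x \<in> edge_points" for n x
    using geometric_chain_limit(2)[OF a_step[OF x] \<sigma> B, of n] x by (simp add: f_def K_def)
  have F_a: "\<bar>cont_rep (F i) x - point_average (F i) n x\<bar> \<le> K * \<sigma> ^ n" if x: "x \<in> edge_points" for i n x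
  proof -
    have "\<bar>point_average (F i) (Suc m) x - point_average (F i) m x\<bar> \<le> B * \<sigma> ^ m" for m
      by (rule step[OF x])
    from geometric_chain_limit(2)[OF this \<sigma> B, of n] show ?thesis using x by (simp add: cont_rep_def K_def)
  qed
  have "\<forall>\<^sub>F i in sequentially. \<forall>x\<in>mg_space G l. \<bar>cont_rep (F (r i)) x - f x\<bar> \<le> \<epsilon>" if \<epsilon>: "0 < \<epsilon>" for \<epsilon>
  proof -
    have "(\<lambda>n. K * \<sigma> ^ n) \<longlonglongrightarrow> K * 0"
      using \<sigma> by (intro tendsto_mult_left LIMSEQ_power_zero) simp
    then have "\<forall>\<^sub>F n in sequentially. K * \<sigma> ^ n < \<epsilon> / 3"
      using \<epsilon> by (intro order_tendstoD) auto
    from eventually_happens'[OF sequentially_bot this] obtain n where n: "K * \<sigma> ^ n < \<epsilon> / 3" by blast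
    \<comment> \<open>Summing over all cells of all edges bounds the difference of averages at every
      point, whichever coordinate \<open>edge_coord\<close> has chosen.\<close>
    define T where "T i = (\<Sum>e\<in>arcs G. \<Sum>j<(2::nat) ^ n. \<bar>edge_average (F (r i)) e n j - A e n j\<bar>)" for i
    have "T \<longlonglongrightarrow> (\<Sum>e\<in>arcs G. \<Sum>j<(2::nat) ^ n. 0)"
      unfolding T_def by (intro tendsto_sum tendsto_rabs_zero LIM_zero A) auto
    then have "\<forall>\<^sub>F i in sequentially. T i < \<epsilon> / 3"
      using \<epsilon> by (intro order_tendstoD) auto
    then show ?thesis
    proof eventually_elim
      case (elim i)
      show ?case
      proof
        fix x assume "x \<in> mg_space G l"
        show "\<bar>cont_rep (F (r i)) x - f x\<bar> \<le> \<epsilon>"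
        proof (cases "x \<in> edge_points")
          case x: True
          define e j where "e = fst (edge_coord x)" and "j = cell_index (l e) n (snd (edge_coord x))"
          have e: "e \<in> arcs G" unfolding e_def by (rule edge_coord(1)[OF x])
          have j: "j < 2 ^ n" unfolding j_def by (rule cell_index_less)
          have "\<bar>point_average (F (r i)) n x - a n x\<bar> = \<bar>edge_average (F (r i)) e n j - A e n j\<bar>"
            by (simp add: point_average_def a_def e_def j_def)
          also have "\<dots> \<le> (\<Sum>j<(2::nat) ^ n. \<bar>edge_average (F (r i)) e n j - A e n j\<bar>)"
            using j by (intro member_le_sum[where f = "\<lambda>j. \<bar>edge_average (F (r i)) e n j - A e n j\<bar>"]) auto
          also have "\<dots> \<le> T i"
            unfolding T_def using e
            by (intro member_le_sum[where f = "\<lambda>e. \<Sum>j<(2::nat) ^ n. \<bar>edge_average (F (r i)) e n j - A e n j\<bar>"] sum_nonneg) auto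
          finally show ?thesis using f_a[OF x, of n] F_a[OF x, of "r i" n] n elim by linarith
        qed (use \<epsilon> in \<open>simp add: cont_rep_def f_def\<close>)
      qed
    qed
  qed
  then show thesis by (rule that[OF r])
qed

text \<open>The strict inequality for \<open>lam\<close> creates the compactness: a bounded set is
  controlled in the larger order \<beta>, and uniform convergence then improves to convergence in
  order \<open>lam\<close>.\<close>

theorem Sobolev_compactly_embeds_Hoelder:
  assumes p: "1 \<le> p" "0 < \<alpha>" and lam: "0 \<le> lam" "lam < \<alpha> - 1 / p"
  shows "compactly_embeds G l (Sobolev_space G l \<alpha> p) (Hoelder_space G l lam)"
proof -
  let ?X = "Sobolev_space G l \<alpha> p" and ?Y = "Hoelder_space G l lam" and ?S = "mg_space G l"
  define \<beta> where "\<beta> = \<alpha> - 1 / p"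
  have \<beta>: "1 / p < \<alpha>" "lam < \<beta>" "0 < \<beta>" using lam by (simp_all add: \<beta>_def)
  interpret Y: quasi_pseudometric "seminorm_topology ?Y" "fst ?Y" "\<lambda>f g. snd ?Y (\<lambda>x. f x - g x)" 1
    using lam(1) by (rule quasi_pseudometric_Hoelder_space)
  have hoelder: "\<exists>H\<ge>0. \<forall>f\<in>fst ?X. snd ?X f \<le> M \<longrightarrow>
      (\<forall>x\<in>?S. \<forall>y\<in>?S. \<bar>cont_rep f x - cont_rep f y\<bar> \<le> H * mg_dist G l x y powr \<beta>)" for M
  proof -
    have "0 \<le> M powr p" by simp
    from cont_rep_bounds[OF p \<beta>(1) this] obtain H where H: "0 \<le> H" 
      "\<And>f x y. f \<in> fst (Lebesgue_space G l p) \<Longrightarrow> frac_seminorm_pow G l \<alpha> p f \<le> ennreal (M powr p) \<Longrightarrow>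
      x \<in> ?S \<Longrightarrow> y \<in> ?S \<Longrightarrow> \<bar>cont_rep f x - cont_rep f y\<bar> \<le> H * mg_dist G l x y powr \<beta>"
      unfolding \<beta>_def by metis
    show ?thesis
    proof (intro exI[of _ H] conjI H(1) ballI impI)
      fix f x y assume f: "f \<in> fst ?X" "snd ?X f \<le> M" and "x \<in> ?S" "y \<in> ?S"
      then show "\<bar>cont_rep f x - cont_rep f y\<bar> \<le> H * mg_dist G l x y powr \<beta>"
        by (intro H(2) Sobolev_subset_Lebesgue[OF f(1)] Sobolev_space_bounds(1)[OF p f])
    qed
  qed
  have XY: "cont_rep f \<in> fst ?Y" if f: "f \<in> fst ?X" for f
  proof -
    obtain H where "0 \<le> H" "\<forall>x\<in>?S. \<forall>y\<in>?S. \<bar>cont_rep f x - cont_rep f y\<bar> \<le> H * mg_dist G l x y powr \<beta>"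
      using hoelder[of "snd ?X f"] f by blast
    then show ?thesis by (intro Hoelder_space_mem[OF lam(1) \<beta>(2)]) auto
  qed
  have "compactin (seminorm_topology ?Y) (seminorm_topology ?Y closure_of (cont_rep ` B))"
    if B: "B \<subseteq> fst ?X" "\<forall>f\<in>B. snd ?X f \<le> M" for B M
  proof (rule Y.compactin_closure_of)
    show "cont_rep ` B \<subseteq> fst ?Y" using B(1) XY by blast
    fix J :: "nat \<Rightarrow> ('v, 'e) mg_point \<Rightarrow> real" assume "\<And>n. J n \<in> cont_rep ` B"
    then have "\<forall>n. \<exists>f. f \<in> B \<and> J n = cont_rep f" by blast
    from choice[OF this] obtain F where JF: "\<forall>n. F n \<in> B \<and> J n = cont_rep (F n)" ..
    then have J: "J n = cont_rep (F n)" for n by simp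
    have F: "F n \<in> fst ?X" "snd ?X (F n) \<le> M" for n using JF B by blast+
    obtain H where H: "0 \<le> H"
      "\<forall>f\<in>fst ?X. snd ?X f \<le> M \<longrightarrow> (\<forall>x\<in>?S. \<forall>y\<in>?S. \<bar>cont_rep f x - cont_rep f y\<bar> \<le> H * mg_dist G l x y powr \<beta>)"
      using hoelder[of M] by (elim exE conjE)
    have HF: "\<bar>cont_rep (F n) x - cont_rep (F n) y\<bar> \<le> H * mg_dist G l x y powr \<beta>" if "x \<in> ?S" "y \<in> ?S" for n x y
      using H(2) F[of n] that by simp
    obtain f and r :: "nat \<Rightarrow> nat" where r: "strict_mono r"
      and unif: "\<And>\<epsilon>. 0 < \<epsilon> \<Longrightarrow> \<forall>\<^sub>F i in sequentially. \<forall>x\<in>?S. \<bar>cont_rep (F (r i)) x - f x\<bar> \<le> \<epsilon>"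
      by (rule cont_rep_uniform_limit[OF p \<beta>(1), of F M, OF F]) blast
    have lim: "(\<lambda>i. cont_rep (F (r i)) x) \<longlonglongrightarrow> f x" if x: "x \<in> ?S" for x
    proof (rule tendstoI)
      fix \<epsilon> :: real assume "0 < \<epsilon>"
      then have "\<forall>\<^sub>F i in sequentially. \<forall>x\<in>?S. \<bar>cont_rep (F (r i)) x - f x\<bar> \<le> \<epsilon> / 2" by (intro unif) simp
      then show "\<forall>\<^sub>F i in sequentially. dist (cont_rep (F (r i)) x) (f x) < \<epsilon>"
      proof eventually_elim
        case (elim i)
        then have "\<bar>cont_rep (F (r i)) x - f x\<bar> \<le> \<epsilon> / 2" using x by (rule bspec)
        then show ?case using \<open>0 < \<epsilon>\<close> by (simp add: dist_real_def)
      qed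
    qed
    \<comment> \<open>The Hoelder constant is common to the whole sequence, so the pointwise limit
      keeps it.\<close>
    have Hf: "\<bar>f x - f y\<bar> \<le> H * mg_dist G l x y powr \<beta>" if x: "x \<in> ?S" and y: "y \<in> ?S" for x y
    proof (rule LIMSEQ_le_const2)
      show "(\<lambda>i. \<bar>cont_rep (F (r i)) x - cont_rep (F (r i)) y\<bar>) \<longlonglongrightarrow> \<bar>f x - f y\<bar>"
        by (intro tendsto_rabs tendsto_diff lim x y)
    qed (use HF[OF x y] in blast)
    have f: "f \<in> fst ?Y" by (rule Hoelder_space_mem[OF lam(1) \<beta>(2) H(1) Hf])
    define s where "s i = (SUP x\<in>?S. \<bar>cont_rep (F (r i)) x - f x\<bar>)" for i
    have bdd: "bdd_above ((\<lambda>x. \<bar>cont_rep (F (r i)) x - f x\<bar>) ` ?S)" for i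
      by (rule bdd_above_abs_diff[OF Hoelder_space_bdd[OF lam(1) XY[OF F(1)]] Hoelder_space_bdd[OF lam(1) f]]) simp
    have s_ge: "\<bar>cont_rep (F (r i)) x - f x\<bar> \<le> s i" if x: "x \<in> ?S" for i x
      unfolding s_def by (rule cSUP_upper[OF x bdd])
    have s0: "0 \<le> s i" for i
    proof -
      obtain x where "x \<in> ?S" using mg_space_nonempty by blast
      from s_ge[OF this, of i] show ?thesis by linarith
    qed
    have "s \<longlonglongrightarrow> 0"
    proof (rule tendstoI)
      fix \<epsilon> :: real assume "0 < \<epsilon>"
      then have "\<forall>\<^sub>F i in sequentially. \<forall>x\<in>?S. \<bar>cont_rep (F (r i)) x - f x\<bar> \<le> \<epsilon> / 2" by (intro unif) simp
      then show "\<forall>\<^sub>F i in sequentially. dist (s i) 0 < \<epsilon>"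
      proof eventually_elim
        case (elim i)
        have "s i \<le> \<epsilon> / 2" unfolding s_def by (rule cSUP_least[OF mg_space_nonempty]) (rule bspec[OF elim])
        then show ?case using \<open>0 < \<epsilon>\<close> s0[of i] by (simp add: dist_real_def)
      qed
    qed
    have "(\<lambda>i. snd ?Y (\<lambda>x. cont_rep (F (r i)) x - f x)) \<longlonglongrightarrow> 0"
    proof (rule tendsto_sandwich[of "\<lambda>_. 0"])
      \<comment> \<open>The constant \<open>2 * H\<close> belongs to the difference of two functions
        with constant \<open>H\<close>. Since \<open>lam < \<beta>\<close>, the power of
        \<open>2 * s i\<close> has a positive exponent and tends to 0.\<close>
      let ?u = "\<lambda>i. s i + (2 * s i) powr (1 - lam / \<beta>) * (2 * H) powr (lam / \<beta>)"
      have "0 < 1 - lam / \<beta>" using \<beta> by simp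
      then have "(\<lambda>i. (2 * s i) powr (1 - lam / \<beta>)) \<longlonglongrightarrow> (2 * 0) powr (1 - lam / \<beta>)"
        using s0 by (intro tendsto_powr' tendsto_mult_left tendsto_const \<open>s \<longlonglongrightarrow> 0\<close>) auto
      then have "?u \<longlonglongrightarrow> 0 + (2 * 0) powr (1 - lam / \<beta>) * (2 * H) powr (lam / \<beta>)"
        by (intro tendsto_add tendsto_mult_right \<open>s \<longlonglongrightarrow> 0\<close>)
      then show "?u \<longlonglongrightarrow> 0" by simp
      show "\<forall>\<^sub>F i in sequentially. snd ?Y (\<lambda>x. cont_rep (F (r i)) x - f x) \<le> ?u i"
      proof (rule always_eventually, rule allI, rule Hoelder_norm_interpolate[OF lam(1) \<beta>(2) _ s0 s_ge])
        fix i x y assume x: "x \<in> ?S" and y: "y \<in> ?S"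
        have "\<bar>(cont_rep (F (r i)) x - f x) - (cont_rep (F (r i)) y - f y)\<bar>
            \<le> \<bar>cont_rep (F (r i)) x - cont_rep (F (r i)) y\<bar> + \<bar>f x - f y\<bar>" by linarith
        then show "\<bar>(cont_rep (F (r i)) x - f x) - (cont_rep (F (r i)) y - f y)\<bar> \<le> 2 * H * mg_dist G l x y powr \<beta>"
          using HF[OF x y, of "r i"] Hf[OF x y] by linarith
      qed (use H(1) in simp_all)
      show "\<forall>\<^sub>F i in sequentially. 0 \<le> snd ?Y (\<lambda>x. cont_rep (F (r i)) x - f x)"
        by (rule always_eventually, rule allI, rule Y.nonneg[OF XY[OF F(1)] f])
    qed simp
    then show "\<exists>f\<in>fst ?Y. \<exists>r. strict_mono r \<and> (\<lambda>n. snd ?Y (\<lambda>x. J (r n) x - f x)) \<longlonglongrightarrow> 0"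
      unfolding J using r f by (intro bexI[of _ f] exI[of _ r] conjI)
  qed
  then have "compact_linear_operator ?X ?Y cont_rep"
    unfolding compact_linear_operator_def
    using XY cont_rep_add[OF p \<beta>(1)] cont_rep_cmult[OF p \<beta>(1)] by auto
  then show ?thesis
    unfolding compactly_embeds_def using XY cont_rep_ae_eq[OF p] by (intro exI[of _ cont_rep]) auto
qed

end

theorem theorem5:
  fixes G :: "('v, 'e) pre_digraph" and l :: "'e \<Rightarrow> real" and p \<alpha> :: real
  assumes "compact_metric_graph G l"
    and "1 \<le> p" and "0 < \<alpha>" and "\<alpha> < 1"
  shows "(\<alpha> < 1 / p \<longrightarrow>
            (\<forall>k::real. 1 \<le> k \<and> k < p / (1 - \<alpha> * p) \<longrightarrow>
               compactly_embeds G l (Sobolev_space G l \<alpha> p) (Lebesgue_space G l k))) \<and>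
         (\<alpha> = 1 / p \<longrightarrow>
            (\<forall>k::real. 1 \<le> k \<longrightarrow>
               compactly_embeds G l (Sobolev_space G l \<alpha> p) (Lebesgue_space G l k))) \<and>
         (\<alpha> > 1 / p \<longrightarrow>
            (\<forall>lam::real. 0 \<le> lam \<and> lam < \<alpha> - 1 / p \<longrightarrow>
               compactly_embeds G l (Sobolev_space G l \<alpha> p) (Hoelder_space G l lam)))"
proof -
  interpret compact_metric_graph G l by fact
  have p: "0 < p" using assms(2) by simp
  have Lebesgue: "compactly_embeds G l (Sobolev_space G l \<alpha> p) (Lebesgue_space G l k)"
    if k: "1 \<le> k" "k * (1 / p - \<alpha>) < 1" for k
  \<comment> \<open>The exponent \<open>p\<close> is itself subcritical, as
    \<open>p * (1 / p - \<alpha>) = 1 - \<alpha> * p\<close>; so the larger of \<open>k\<close> and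
    \<open>p\<close> is an admissible auxiliary exponent.\<close>
  proof (rule Sobolev_compactly_embeds_Lebesgue[OF assms(2,3) k(1), of "max k p"])
    have "p * (1 / p - \<alpha>) < 1" using p assms(3) by (simp add: right_diff_distrib)
    then show "max k p * (1 / p - \<alpha>) < 1" using k(2) by (simp add: max_def)
  qed simp_all
  \<comment> \<open>Subcriticality without division by \<open>1 - \<alpha> * p\<close>; in this form
    it also covers \<open>\<alpha> = 1 / p\<close>, where it holds for every
    \<open>k\<close>.\<close>
  have "k * (1 / p - \<alpha>) < 1" if "\<alpha> < 1 / p" "k < p / (1 - \<alpha> * p)" for k
  proof -
    have "0 < 1 - \<alpha> * p" using that(1) p by (simp add: field_simps)
    then have "k * (1 - \<alpha> * p) < p" using that(2) by (simp add: pos_less_divide_eq)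
    then show ?thesis using p by (simp add: field_simps)
  qed
  then show ?thesis
    using Lebesgue Sobolev_compactly_embeds_Hoelder[OF assms(2,3)] by auto
qed

end
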